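(* Let $n\ge 1$ and let $\mu$ be an even finite Borel measure on $\mathbb{S}^n$ that satisfies the strict subspace concentration inequality. Then there exist an $O$-symmetric convex body $K$ in $\mathbb{R}^{n+1}$ and a positive constant $c$ such that $$\mu = c\, S_{0,\gamma_{n+1},K}.$$
   Context: $\mathbb{S}^n$ is the unit sphere in $\mathbb{R}^{n+1}$. A convex body is a compact convex subset of $\mathbb{R}^{n+1}$ with nonempty interior; it is $O$-symmetric if $K=-K$. A finite Borel measure $\mu$ on $\mathbb{S}^n$ satisfies the strict subspace concentration inequality if for every linear subspace $\xi\subset\mathbb{R}^{n+1}$ with $0<\dim\xi<n+1$ one has $\mu(\xi\cap\mathbb{S}^n)<\frac{1}{n+1}\,\mu(\mathbb{S}^n)\dim\xi$. For a convex body $K$ containing the origin in its interior, with support function $h_K(v)=\max\{v\cdot y:y\in K\}$, $\nu_K$ denotes the Gauss map (the outer unit normal $\nu_K(x)$ at $x\in\partial K$, defined for $\mathcal{H}^n$-a.e. $x\in\partial K$), and for Borel $\eta\subset\mathbb{S}^n$, $\nu_K^{-1}(\eta)=\{x\in\partial K:\nu_K(x)\in\eta\}$. The $L_p$-Gaussian surface area measure of $K$ is the Borel measure on $\mathbb{S}^n$ $$S_{p,\gamma_{n+1},K}(\eta)=\frac{1}{(\sqrt{2\pi})^{n+1}}\int_{\nu_K^{-1}(\eta)}e^{-\frac{|x|^2}{2}}(x\cdot\nu_K(x))^{1-p}\,d\mathcal{H}^n(x),$$ where $\mathcal{H}^n$ is $n$-dimensional Hausdorff measure; $S_{0,\gamma_{n+1},K}$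 is the case $p=0$. *)

theory Defs
  imports "HOL-Analysis.Analysis"
begin

section \<open>Hausdorff measure\<close>

(* The factor unit_ball_vol s / 2 ^ s is the usual normalisation, for which the s-dimensional
   Hausdorff measure of an s-dimensional Euclidean space is its Lebesgue measure.
   Empty covering sets count 0 also for s = 0; they make finite covers sequences.  The library's
   diameter is meaningful for bounded sets only, hence the explicit boundedness. *)
definition hausdorff_gauge :: "nat \<Rightarrow> 'a::metric_space set \<Rightarrow> ennreal" where
  "hausdorff_gauge s U =
     (if U = {} then 0 else ennreal (unit_ball_vol (real s) * (diameter U / 2) ^ s))"

definition hausdorff_premeasure :: "nat \<Rightarrow> real \<Rightarrow> 'a::metric_space set \<Rightarrow> ennreal" where
  "hausdorff_premeasure s \<delta> A =
     (INF U \<in> {U :: nat \<Rightarrow> 'a set. (\<forall>i. bounded (U i) \<and> diameter (U i) \<le> \<delta>) \<and> A \<subseteq> (\<Union>i. U i)}.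
        \<Sum>i. hausdorff_gauge s (U i))"

definition hausdorff_outer :: "nat \<Rightarrow> 'a::metric_space set \<Rightarrow> ennreal" where
  "hausdorff_outer s A = (SUP \<delta>\<in>{0<..}. hausdorff_premeasure s \<delta> A)"

definition hausdorff_measure :: "nat \<Rightarrow> 'a::metric_space measure" where
  "hausdorff_measure s = measure_of UNIV (sets borel) (hausdorff_outer s)"

lemma space_hausdorff_measure [simp]: "space (hausdorff_measure s) = UNIV"
  by (simp add: hausdorff_measure_def space_measure_of_conv)

lemma sets_hausdorff_measure [simp, measurable_cong]: "sets (hausdorff_measure s) = sets borel"
  by (simp add: hausdorff_measure_def sets_measure_of_conv sets.sigma_sets_eq[of borel, simplified])

lemma hausdorff_gauge_empty [simp]: "hausdorff_gauge s {} = 0"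
  by (simp add: hausdorff_gauge_def)

lemma hausdorff_premeasure_antimono:
  assumes "\<delta> \<le> \<epsilon>"
  shows "hausdorff_premeasure s \<epsilon> A \<le> hausdorff_premeasure s \<delta> A"
  unfolding hausdorff_premeasure_def
  by (rule INF_superset_mono) (use assms in \<open>auto intro: order_trans\<close>)

lemma hausdorff_premeasure_mono:
  assumes "A \<subseteq> B"
  shows "hausdorff_premeasure s \<delta> A \<le> hausdorff_premeasure s \<delta> B"
  unfolding hausdorff_premeasure_def
  by (rule INF_superset_mono) (use assms in auto)

lemma hausdorff_premeasure_empty:
  assumes "0 < \<delta>"
  shows "hausdorff_premeasure s \<delta> {} = 0"
proof -
  have "hausdorff_premeasure s \<delta> {} \<le> (\<Sum>i::nat. hausdorff_gauge s ({}::'a set))"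
    unfolding hausdorff_premeasure_def
    by (rule INF_lower2[where i="\<lambda>_. {}"]) (use assms in \<open>auto simp: diameter_empty\<close>)
  then show ?thesis by simp
qed

lemma hausdorff_premeasure_countably_subadditive:
  fixes A :: "nat \<Rightarrow> 'a::metric_space set"
  shows "hausdorff_premeasure s \<delta> (\<Union>i. A i) \<le> (\<Sum>i. hausdorff_premeasure s \<delta> (A i))"
proof (rule ennreal_le_epsilon)
  fix e :: real
  assume fin: "(\<Sum>i. hausdorff_premeasure s \<delta> (A i)) < top" and e: "0 < e"
  let ?C = "\<lambda>i. {U :: nat \<Rightarrow> 'a set. (\<forall>j. bounded (U j) \<and> diameter (U j) \<le> \<delta>) \<and> A i \<subseteq> (\<Union>j. U j)}"
  have "\<exists>U\<in>?C i. (\<Sum>j. hausdorff_gauge s (U j)) \<le> hausdorff_premeasure s \<delta> (A i) + ennreal (e * (1/2)^Suc i)" (is "\<exists>U\<in>_. ?P i U") for i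
  proof -
    have "hausdorff_premeasure s \<delta> (A i) \<noteq> top"
      using fin ennreal_suminf_lessD less_top by blast
    then have "hausdorff_premeasure s \<delta> (A i) < hausdorff_premeasure s \<delta> (A i) + ennreal (e * (1/2)^Suc i)"
      using e ennreal_add_left_cancel_less[of "hausdorff_premeasure s \<delta> (A i)" 0 "ennreal (e * (1/2)^Suc i)"]
      by (simp add: less_top)
    then obtain U where "U \<in> ?C i"
      "(\<Sum>j. hausdorff_gauge s (U j)) < hausdorff_premeasure s \<delta> (A i) + ennreal (e * (1/2)^Suc i)"
      unfolding hausdorff_premeasure_def INF_less_iff by blast
    then show ?thesis by (auto intro: less_imp_le)
  qed
  then have "\<forall>i. \<exists>U. U \<in> ?C i \<and> ?P i U" by (simp only: Bex_def simp_thms)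
  from choice[OF this] obtain U where U: "\<And>i. U i \<in> ?C i" "\<And>i. ?P i (U i)" by blast
  define V where "V k = (case prod_decode k of (i, j) \<Rightarrow> U i j)" for k
  have V: "V \<in> {U :: nat \<Rightarrow> 'a set. (\<forall>j. bounded (U j) \<and> diameter (U j) \<le> \<delta>) \<and> (\<Union>i. A i) \<subseteq> (\<Union>j. U j)}"
  proof (clarsimp, intro conjI allI)
    show "bounded (V i)" "diameter (V i) \<le> \<delta>" for i
      using U(1) by (auto simp: V_def split: prod.split)
    show "(\<Union>i. A i) \<subseteq> (\<Union>j. V j)"
    proof
      fix x assume "x \<in> (\<Union>i. A i)"
      then obtain i j where "x \<in> U i j" using U(1) by blast
      then have "x \<in> V (prod_encode (i, j))" by (simp add: V_def)
      then show "x \<in> (\<Union>j. V j)" by blast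
    qed
  qed
  have "hausdorff_premeasure s \<delta> (\<Union>i. A i) \<le> (\<Sum>k. hausdorff_gauge s (V k))"
    unfolding hausdorff_premeasure_def by (rule INF_lower[OF V])
  also have "\<dots> = (\<Sum>k. (\<lambda>(i, j). hausdorff_gauge s (U i j)) (prod_decode k))"
    by (simp add: V_def split_beta)
  also have "\<dots> = (\<Sum>i. \<Sum>j. hausdorff_gauge s (U i j))"
    using suminf_ennreal_2dimen[of "\<lambda>i. \<Sum>j. hausdorff_gauge s (U i j)" "\<lambda>(i, j). hausdorff_gauge s (U i j)"]
    by (simp add: comp_def)
  also have "\<dots> \<le> (\<Sum>i. hausdorff_premeasure s \<delta> (A i) + ennreal (e * (1/2)^Suc i))"
    by (intro suminf_le U(2)) auto
  also have "\<dots> = (\<Sum>i. hausdorff_premeasure s \<delta> (A i)) + (\<Sum>i. ennreal (e * (1/2)^Suc i))"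
    by (rule suminf_add[symmetric]) auto
  also have "(\<Sum>i. ennreal (e * (1/2)^Suc i)) = ennreal e"
    using e sums_mult[OF power_half_series, of e]
    by (intro suminf_ennreal_eq) auto
  finally show "hausdorff_premeasure s \<delta> (\<Union>i. A i) \<le> (\<Sum>i. hausdorff_premeasure s \<delta> (A i)) + ennreal e" .
qed

lemma outer_measure_space_hausdorff:
  "outer_measure_space UNIV (hausdorff_outer s :: 'a::metric_space set \<Rightarrow> ennreal)"
  unfolding outer_measure_space_def
proof (intro conjI)
  show "positive UNIV (hausdorff_outer s :: 'a set \<Rightarrow> ennreal)"
    by (simp add: positive_def hausdorff_outer_def hausdorff_premeasure_empty)
  show "increasing UNIV (hausdorff_outer s :: 'a set \<Rightarrow> ennreal)"
    unfolding increasing_def hausdorff_outer_def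
    by (auto intro!: SUP_mono' hausdorff_premeasure_mono)
  show "countably_subadditive UNIV (hausdorff_outer s :: 'a set \<Rightarrow> ennreal)"
    unfolding countably_subadditive_def
  proof (intro allI impI)
    fix A :: "nat \<Rightarrow> 'a set"
    show "hausdorff_outer s (\<Union>i. A i) \<le> (\<Sum>i. hausdorff_outer s (A i))"
      unfolding hausdorff_outer_def[of s "\<Union>i. A i"]
    proof (rule SUP_least)
      fix \<delta> :: real assume \<delta>: "\<delta> \<in> {0<..}"
      show "hausdorff_premeasure s \<delta> (\<Union>i. A i) \<le> (\<Sum>i. hausdorff_outer s (A i))"
        by (rule order_trans[OF hausdorff_premeasure_countably_subadditive suminf_le])
           (use \<delta> in \<open>auto simp: hausdorff_outer_def intro: SUP_upper\<close>)
    qed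
  qed
qed

lemma hausdorff_outer_mono:
  fixes A B :: "'a::metric_space set"
  shows "A \<subseteq> B \<Longrightarrow> hausdorff_outer s A \<le> hausdorff_outer s B"
  using outer_measure_space_hausdorff[where 'a='a and s=s]
  by (simp add: outer_measure_space_def increasing_def)

lemma hausdorff_outer_empty [simp]: "hausdorff_outer s ({} :: 'a::metric_space set) = 0"
  using outer_measure_space_hausdorff[where 'a='a and s=s]
  by (simp add: outer_measure_space_def positive_def)

lemma hausdorff_outer_Un_le:
  fixes A B :: "'a::metric_space set"
  shows "hausdorff_outer s (A \<union> B) \<le> hausdorff_outer s A + hausdorff_outer s B"
proof -
  interpret sigma_algebra UNIV "UNIV :: 'a set set"
    using sigma_algebra_Pow[of "UNIV :: 'a set"] by simp
  have "subadditive UNIV (hausdorff_outer s :: 'a set \<Rightarrow> ennreal)"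
    using outer_measure_space_hausdorff[where 'a='a and s=s]
      countably_subadditive_subadditive[of "hausdorff_outer s"]
    by (simp add: outer_measure_space_def)
  then have "hausdorff_outer s (A \<union> (B - A)) \<le> hausdorff_outer s A + hausdorff_outer s (B - A)"
    by (rule subadditiveD) auto
  also have "\<dots> \<le> hausdorff_outer s A + hausdorff_outer s B"
    by (intro add_left_mono hausdorff_outer_mono) auto
  finally show ?thesis by simp
qed

lemma hausdorff_outer_UN_le:
  fixes A :: "nat \<Rightarrow> 'a::metric_space set"
  shows "hausdorff_outer s (\<Union>i. A i) \<le> (\<Sum>i. hausdorff_outer s (A i))"
proof -
  have le: "hausdorff_outer s (\<Union>i. A i) \<le> (\<Sum>i. hausdorff_outer s (disjointed A i))"
    using outer_measure_space_hausdorff[where 'a='a and s=s] disjoint_family_disjointed[of A]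
    unfolding outer_measure_space_def countably_subadditive_def UN_disjointed_eq[of A, symmetric]
    by simp
  also have "\<dots> \<le> (\<Sum>i. hausdorff_outer s (A i))"
    by (intro suminf_le hausdorff_outer_mono disjointed_subset) auto
  finally show ?thesis .
qed

lemma hausdorff_outer_separated:
  fixes A B :: "'a::metric_space set"
  assumes d: "0 < d" and sep: "\<And>x y. x \<in> A \<Longrightarrow> y \<in> B \<Longrightarrow> d \<le> dist x y"
  shows "hausdorff_outer s A + hausdorff_outer s B \<le> hausdorff_outer s (A \<union> B)"
proof -
  have small: "hausdorff_premeasure s \<delta> A + hausdorff_premeasure s \<delta> B \<le> hausdorff_premeasure s \<delta> (A \<union> B)"
    if \<delta>: "0 < \<delta>" "\<delta> < d" for \<delta>
    unfolding hausdorff_premeasure_def[of s \<delta> "A \<union> B"]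
  proof (rule INF_greatest)
    fix U :: "nat \<Rightarrow> 'a set"
    assume "U \<in> {U. (\<forall>i. bounded (U i) \<and> diameter (U i) \<le> \<delta>) \<and> A \<union> B \<subseteq> (\<Union>i. U i)}"
    then have U: "\<And>i. bounded (U i)" "\<And>i. diameter (U i) \<le> \<delta>" "A \<union> B \<subseteq> (\<Union>i. U i)" by auto
    define V where "V X i = (if U i \<inter> X = {} then {} else U i)" for X i
    have le: "hausdorff_premeasure s \<delta> X \<le> (\<Sum>i. hausdorff_gauge s (V X i))" if X: "X \<subseteq> A \<union> B" for X
      unfolding hausdorff_premeasure_def
    proof (rule INF_lower, clarsimp, intro conjI allI)
      show "bounded (V X i)" "diameter (V X i) \<le> \<delta>" for i
        using U \<delta> by (auto simp: V_def diameter_empty)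
      show "X \<subseteq> (\<Union>i. V X i)"
      proof
        fix x assume x: "x \<in> X"
        then obtain i where "x \<in> U i" using U(3) X by blast
        with x have "x \<in> V X i" by (auto simp: V_def)
        then show "x \<in> (\<Union>i. V X i)" by blast
      qed
    qed
    have "hausdorff_premeasure s \<delta> A + hausdorff_premeasure s \<delta> B
        \<le> (\<Sum>i. hausdorff_gauge s (V A i)) + (\<Sum>i. hausdorff_gauge s (V B i))"
      by (intro add_mono le) auto
    also have "\<dots> = (\<Sum>i. hausdorff_gauge s (V A i) + hausdorff_gauge s (V B i))"
      by (rule suminf_add) auto
    also have "\<dots> \<le> (\<Sum>i. hausdorff_gauge s (U i))"
    proof (intro suminf_le)
      fix i
      have "U i \<inter> A = {} \<or> U i \<inter> B = {}"
      proof (rule ccontr)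
        assume "\<not> ?thesis"
        then obtain x y where "x \<in> U i" "x \<in> A" "y \<in> U i" "y \<in> B" by blast
        then have "d \<le> diameter (U i)"
          using sep[of x y] diameter_bounded_bound[OF U(1)[of i]] by force
        with U(2)[of i] \<delta> show False by simp
      qed
      then show "hausdorff_gauge s (V A i) + hausdorff_gauge s (V B i) \<le> hausdorff_gauge s (U i)"
        by (auto simp: V_def)
    qed auto
    finally show "hausdorff_premeasure s \<delta> A + hausdorff_premeasure s \<delta> B \<le> (\<Sum>i. hausdorff_gauge s (U i))" .
  qed
  have "hausdorff_premeasure s \<delta> A + hausdorff_premeasure s \<epsilon> B \<le> hausdorff_outer s (A \<union> B)"
    if "0 < \<delta>" "0 < \<epsilon>" for \<delta> \<epsilon>
  proof -
    define m where "m = min (min \<delta> \<epsilon>) (d / 2)"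
    have m: "0 < m" "m < d" "m \<le> \<delta>" "m \<le> \<epsilon>" using that d by (auto simp: m_def min_def)
    have "hausdorff_premeasure s \<delta> A + hausdorff_premeasure s \<epsilon> B \<le> hausdorff_premeasure s m A + hausdorff_premeasure s m B"
      by (intro add_mono hausdorff_premeasure_antimono m)
    also have "\<dots> \<le> hausdorff_premeasure s m (A \<union> B)" by (rule small[OF m(1,2)])
    also have "\<dots> \<le> hausdorff_outer s (A \<union> B)"
      unfolding hausdorff_outer_def by (rule SUP_upper) (use m in auto)
    finally show ?thesis .
  qed
  then have "(SUP \<delta>\<in>{0<..}. hausdorff_premeasure s \<delta> A + hausdorff_premeasure s \<epsilon> B) \<le> hausdorff_outer s (A \<union> B)"
    if "0 < \<epsilon>" for \<epsilon> using that by (intro SUP_least) auto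
  then have "hausdorff_outer s A + hausdorff_premeasure s \<epsilon> B \<le> hausdorff_outer s (A \<union> B)"
    if "0 < \<epsilon>" for \<epsilon>
    using that unfolding hausdorff_outer_def[of s A] by (subst ennreal_SUP_add_left[symmetric]) auto
  then have "(SUP \<epsilon>\<in>{0<..}. hausdorff_outer s A + hausdorff_premeasure s \<epsilon> B) \<le> hausdorff_outer s (A \<union> B)"
    by (intro SUP_least) auto
  then show ?thesis
    unfolding hausdorff_outer_def[of s B] by (simp add: ennreal_SUP_add_right)
qed

lemma ennreal_suminf_tail_tendsto_0:
  fixes f :: "nat \<Rightarrow> ennreal"
  assumes "(\<Sum>k. f k) < top"
  shows "(\<lambda>k. \<Sum>j. f (j + k)) \<longlonglongrightarrow> 0"
proof -
  have tail: "(\<Sum>j. f (j + k)) = (\<Sum>j. f j) - (\<Sum>j<k. f j)" for k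
  proof -
    have "(\<Sum>j. f j) = (\<Sum>j. f (j + k)) + (\<Sum>j<k. f j)"
      by (rule suminf_offset) auto
    moreover have "(\<Sum>j<k. f j) \<noteq> top"
      using assms sum_le_suminf[of f "{..<k}"] by (metis finite_lessThan leD summableI zero_le)
    ultimately show ?thesis by (simp add: ennreal_add_diff_cancel_right)
  qed
  have "(\<lambda>k. \<Sum>j<k. f j) \<longlonglongrightarrow> (\<Sum>j. f j)"
    by (rule summable_LIMSEQ) auto
  then have "(\<lambda>k. (\<Sum>j. f j) - (\<Sum>j<k. f j)) \<longlonglongrightarrow> (\<Sum>j. f j) - (\<Sum>j. f j)"
    using assms by (intro tendsto_diff_ennreal tendsto_const) auto
  then show ?thesis
    using assms by (simp add: tail)
qed

lemma hausdorff_outer_caratheodory: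
  fixes C X :: "'a::metric_space set"
  assumes "closed C"
  shows "hausdorff_outer s (X \<inter> C) + hausdorff_outer s (X - C) \<le> hausdorff_outer s X"
proof (cases "C = {} \<or> hausdorff_outer s X = top")
  case True
  then show ?thesis by auto
next
  case False
  let ?H = "hausdorff_outer s :: 'a set \<Rightarrow> ennreal"
  have ne: "C \<noteq> {}" and fin: "?H X < top" using False by (auto simp: less_top)
  define r where "r k = 1 / real (Suc k)" for k
  have r_pos: "0 < r k" for k by (simp add: r_def)
  have r_less: "r n < r m" if "m < n" for m n using that by (simp add: r_def field_simps)
  define F where "F k = {x \<in> X. r k \<le> infdist x C}" for k
  define R where "R k = {x \<in> X. r (Suc k) \<le> infdist x C \<and> infdist x C < r k}" for k
  have sepdist: "infdist x C - infdist y C \<le> dist x y" for x y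
    using infdist_triangle[of x C y] by simp
  have R_sep: "?H A + ?H (R n) \<le> ?H (A \<union> R n)"
    if A: "A \<subseteq> {x. r m \<le> infdist x C}" and mn: "m < n" for A m n
  proof (rule hausdorff_outer_separated[of "r m - r n"])
    show "0 < r m - r n" using r_less[OF mn] by simp
    fix x y assume "x \<in> A" "y \<in> R n"
    then show "r m - r n \<le> dist x y" using A sepdist[of x y] by (auto simp: R_def)
  qed
  have R_sum: "(\<Sum>k<N. ?H (R (2 * k + a))) \<le> ?H X" for N a
  proof -
    have "(\<Sum>k<N. ?H (R (2 * k + a))) \<le> ?H (\<Union>k<N. R (2 * k + a))"
    proof (induction N)
      case (Suc N)
      have "(\<Sum>k<Suc N. ?H (R (2 * k + a))) \<le> ?H (\<Union>k<N. R (2 * k + a)) + ?H (R (2 * N + a))"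
        using Suc by (auto intro: add_mono)
      also have "\<dots> \<le> ?H ((\<Union>k<N. R (2 * k + a)) \<union> R (2 * N + a))"
      proof (cases "N = 0")
        case False
        show ?thesis
        proof (rule R_sep[of _ "2 * N + a - 1"])
          show "2 * N + a - 1 < 2 * N + a" using False by simp
          have "r (2 * N + a - 1) \<le> r (Suc (2 * k + a))" if "k < N" for k
            using r_less[of "Suc (2 * k + a)" "2 * N + a - 1"] that
            by (cases "Suc (2 * k + a) = 2 * N + a - 1") (auto simp: less_imp_le)
          then show "(\<Union>k<N. R (2 * k + a)) \<subseteq> {x. r (2 * N + a - 1) \<le> infdist x C}"
            by (auto simp: R_def intro: order_trans)
        qed
      qed simp
      also have "(\<Union>k<N. R (2 * k + a)) \<union> R (2 * N + a) = (\<Union>k<Suc N. R (2 * k + a))"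
        by (auto simp: lessThan_Suc)
      finally show ?case .
    qed simp
    also have "\<dots> \<le> ?H X" by (rule hausdorff_outer_mono) (auto simp: R_def)
    finally show ?thesis .
  qed
  have "(\<Sum>k<N. ?H (R k)) \<le> ?H X + ?H X" for N
  proof -
    have "(\<Sum>k<N. ?H (R k)) \<le> (\<Sum>k<2 * N. ?H (R k))"
      by (rule sum_mono2) auto
    also have "\<dots> = (\<Sum>k<N. ?H (R (2 * k + 0))) + (\<Sum>k<N. ?H (R (2 * k + 1)))"
      by (induction N) (auto simp: ac_simps)
    also have "\<dots> \<le> ?H X + ?H X" by (intro add_mono R_sum)
    finally show ?thesis .
  qed
  then have "(\<Sum>k. ?H (R k)) \<le> ?H X + ?H X" by (intro suminf_le_const) auto
  also have "\<dots> < top" using fin by (simp add: ennreal_add_less_top)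
  finally have "(\<Sum>k. ?H (R k)) < top" .
  then have tail: "(\<lambda>k. \<Sum>j. ?H (R (j + k))) \<longlonglongrightarrow> 0"
    by (rule ennreal_suminf_tail_tendsto_0)
  have main: "?H (X \<inter> C) + ?H (X - C) \<le> ?H X + (\<Sum>j. ?H (R (j + k)))" for k
  proof -
    have "X - C \<subseteq> F k \<union> (\<Union>j. R (j + k))"
    proof
      fix x assume x: "x \<in> X - C"
      then have pos: "0 < infdist x C"
        using assms ne by (simp add: infdist_pos_not_in_closed)
      show "x \<in> F k \<union> (\<Union>j. R (j + k))"
      proof (cases "r k \<le> infdist x C")
        case False
        obtain N where N: "r N < infdist x C"
          using reals_Archimedean[OF pos] by (auto simp: r_def inverse_eq_divide)
        define M where "M = (LEAST m. r m \<le> infdist x C)"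
        have M: "r M \<le> infdist x C" unfolding M_def by (rule LeastI[of _ N]) (use N in simp)
        have "k < M"
        proof (rule ccontr)
          assume "\<not> k < M"
          then have "r k \<le> r M" using r_less[of M k] by (cases "M = k") auto
          with False M show False by simp
        qed
        then obtain j where j: "M = Suc (j + k)" by (metis add.commute less_imp_Suc_add)
        have "\<not> r (j + k) \<le> infdist x C"
          using not_less_Least[of "j + k" "\<lambda>m. r m \<le> infdist x C"] j M_def by auto
        then have "x \<in> R (j + k)" using x M j by (auto simp: R_def)
        then show ?thesis by blast
      qed (use x in \<open>auto simp: F_def\<close>)
    qed
    then have "?H (X - C) \<le> ?H (F k) + ?H (\<Union>j. R (j + k))"
      by (rule order_trans[OF hausdorff_outer_mono hausdorff_outer_Un_le])
    also have "\<dots> \<le> ?H (F k) + (\<Sum>j. ?H (R (j + k)))"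
      by (intro add_left_mono hausdorff_outer_UN_le)
    finally have "?H (X \<inter> C) + ?H (X - C) \<le> (?H (X \<inter> C) + ?H (F k)) + (\<Sum>j. ?H (R (j + k)))"
      by (simp add: add_left_mono add.assoc)
    also have "?H (X \<inter> C) + ?H (F k) \<le> ?H ((X \<inter> C) \<union> F k)"
    proof (rule hausdorff_outer_separated[OF r_pos[of k]])
      fix x y assume "x \<in> X \<inter> C" "y \<in> F k"
      then show "r k \<le> dist x y"
        using infdist_le[of x C y] by (auto simp: F_def dist_commute)
    qed
    also have "?H ((X \<inter> C) \<union> F k) \<le> ?H X" by (rule hausdorff_outer_mono) (auto simp: F_def)
    finally show ?thesis by (simp add: add_right_mono)
  qed
  have "(\<lambda>k. ?H X + (\<Sum>j. ?H (R (j + k)))) \<longlonglongrightarrow> ?H X + 0"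
    by (intro tendsto_add tendsto_const tail)
  then show ?thesis
    by (intro LIMSEQ_le_const[where X="\<lambda>k. ?H X + (\<Sum>j. ?H (R (j + k)))"]) (use main in auto)
qed

lemma measure_space_hausdorff:
  "measure_space UNIV (sets borel) (hausdorff_outer s :: 'a::metric_space set \<Rightarrow> ennreal)"
proof -
  interpret sigma_algebra UNIV "UNIV :: 'a set set"
    using sigma_algebra_Pow[of "UNIV :: 'a set"] by simp
  let ?L = "lambda_system UNIV UNIV (hausdorff_outer s :: 'a set \<Rightarrow> ennreal)"
  have ms: "measure_space UNIV ?L (hausdorff_outer s)"
    by (rule caratheodory_lemma[OF outer_measure_space_hausdorff])
  have "C \<in> ?L" if C: "closed C" for C
    unfolding lambda_system_eq
  proof clarsimp
    fix X
    show "hausdorff_outer s (X \<inter> C) + hausdorff_outer s (X - C) = hausdorff_outer s X"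
    proof (rule antisym)
      show "hausdorff_outer s X \<le> hausdorff_outer s (X \<inter> C) + hausdorff_outer s (X - C)"
        using hausdorff_outer_Un_le[of s "X \<inter> C" "X - C"] by (simp add: Int_Diff_Un)
    qed (rule hausdorff_outer_caratheodory[OF C])
  qed
  then have "sigma_sets UNIV (Collect closed) \<subseteq> ?L"
    using ms by (intro sigma_algebra.sigma_sets_subset) (auto simp: measure_space_def)
  then have "sets borel \<subseteq> ?L"
    by (simp add: borel_eq_closed)
  then show ?thesis
    using ms sets.sigma_algebra_axioms[of "borel :: 'a measure"]
    by (auto simp: measure_space_def positive_def countably_additive_def)
qed

lemma emeasure_hausdorff_measure:
  fixes A :: "'a::metric_space set"
  assumes "A \<in> sets borel"
  shows "emeasure (hausdorff_measure s) A = hausdorff_outer s A"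
  using measure_space_hausdorff[where 'a='a and s=s] assms
  unfolding hausdorff_measure_def
  by (subst emeasure_measure_of[of _ UNIV "sets borel" "hausdorff_outer s"])
     (auto simp: measure_space_def sets.sigma_sets_eq[of borel, simplified])

section \<open>Gaussian surface area measures of convex bodies\<close>

definition convex_body :: "'a::euclidean_space set \<Rightarrow> bool" where
  "convex_body K \<longleftrightarrow> compact K \<and> convex K \<and> interior K \<noteq> {}"

definition o_symmetric :: "'a::real_vector set \<Rightarrow> bool" where
  "o_symmetric K \<longleftrightarrow> K = uminus ` K"

definition outer_unit_normal :: "'a::euclidean_space set \<Rightarrow> 'a \<Rightarrow> 'a \<Rightarrow> bool" where
  "outer_unit_normal K x v \<longleftrightarrow> norm v = 1 \<and> (\<forall>y\<in>K. v \<bullet> y \<le> v \<bullet> x)"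

(* Only meaningful at boundary points with exactly one outer unit normal; the other boundary
   points belong to no preimage. *)
definition gauss_map :: "'a::euclidean_space set \<Rightarrow> 'a \<Rightarrow> 'a" where
  "gauss_map K x = (THE v. outer_unit_normal K x v)"

definition gauss_preimage :: "'a::euclidean_space set \<Rightarrow> 'a set \<Rightarrow> 'a set" where
  "gauss_preimage K \<eta> =
     {x \<in> frontier K. (\<exists>!v. outer_unit_normal K x v) \<and> gauss_map K x \<in> \<eta>}"

abbreviation sphere_borel :: "'a::euclidean_space measure" where
  "sphere_borel \<equiv> restrict_space borel (sphere 0 1)"

(* In the ambient space of dimension DIM('a) = n + 1 the Hausdorff measure is n-dimensional. *)
definition lp_gaussian_surface_area_measure :: "real \<Rightarrow> 'a::euclidean_space set \<Rightarrow> 'a measure" where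
  "lp_gaussian_surface_area_measure p K =
     measure_of (sphere 0 1) (sets sphere_borel)
       (\<lambda>\<eta>. ennreal (1 / sqrt (2 * pi) ^ DIM('a)) *
          (\<integral>\<^sup>+x\<in>gauss_preimage K \<eta>.
             ennreal (exp (- (norm x)\<^sup>2 / 2) * (x \<bullet> gauss_map K x) powr (1 - p))
           \<partial>hausdorff_measure (DIM('a) - 1)))"

definition strict_subspace_concentration :: "'a::euclidean_space measure \<Rightarrow> bool" where
  "strict_subspace_concentration \<mu> \<longleftrightarrow>
     (\<forall>\<xi>. subspace \<xi> \<and> 0 < dim \<xi> \<and> dim \<xi> < DIM('a) \<longrightarrow>
        measure \<mu> (\<xi> \<inter> sphere 0 1) < 1 / real DIM('a) * measure \<mu> (sphere 0 1) * real (dim \<xi>))"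

lemma gauss_map_eq:
  assumes "\<exists>!v. outer_unit_normal K x v" "outer_unit_normal K x v"
  shows "gauss_map K x = v"
  unfolding gauss_map_def using assms by (simp add: the1_equality)

lemma outer_unit_normal_gauss_map:
  assumes "\<exists>!v. outer_unit_normal K x v"
  shows "outer_unit_normal K x (gauss_map K x)"
  unfolding gauss_map_def using assms by (rule theI')

lemma compact_normal_bundle:
  fixes K :: "'a::euclidean_space set"
  assumes "compact K"
  shows "compact {(x, v). x \<in> frontier K \<and> outer_unit_normal K x v}"
proof -
  have "{(x, v). x \<in> frontier K \<and> outer_unit_normal K x v}
      = (frontier K \<times> sphere 0 1) \<inter> (\<Inter>y\<in>K. {z. snd z \<bullet> y \<le> snd z \<bullet> fst z})"
    by (auto simp: outer_unit_normal_def)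
  moreover have "closed (\<Inter>y\<in>K. {z::'a \<times> 'a. snd z \<bullet> y \<le> snd z \<bullet> fst z})"
    by (intro closed_INT ballI closed_Collect_le continuous_intros)
  ultimately show ?thesis
    using assms by (auto intro!: compact_Int_closed compact_Times compact_frontier)
qed

lemma borel_regular_points:
  fixes K :: "'a::euclidean_space set"
  assumes "compact K"
  shows "{x \<in> frontier K. \<exists>!v. outer_unit_normal K x v} \<in> sets borel"
proof -
  define G where "G = {(x, v). x \<in> frontier K \<and> outer_unit_normal K x v}"
  have G: "compact G" unfolding G_def by (rule compact_normal_bundle[OF assms])
  define B where "B k = (\<lambda>(p, q). fst p) ` ((G \<times> G) \<inter> {(p, q). fst p = fst q \<and> 1 / real (Suc k) \<le> dist (snd p) (snd q)})" for k
  have "compact (B k)" for k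
    unfolding B_def split_beta
    by (intro compact_continuous_image compact_Int_closed compact_Times G continuous_intros
          closed_Collect_conj closed_Collect_eq closed_Collect_le)
  then have B: "B k \<in> sets borel" for k by (simp add: borel_compact)
  have "{x \<in> frontier K. \<exists>!v. outer_unit_normal K x v} = fst ` G - (\<Union>k. B k)"
  proof (intro equalityI subsetI)
    fix x assume x: "x \<in> {x \<in> frontier K. \<exists>!v. outer_unit_normal K x v}"
    then obtain v where v: "outer_unit_normal K x v" by blast
    have "x \<in> fst ` G" using x v by (auto simp: G_def image_iff)
    moreover have "x \<notin> B k" for k
    proof
      assume "x \<in> B k"
      then obtain v w where "outer_unit_normal K x v" "outer_unit_normal K x w" "1 / real (Suc k) \<le> dist v w"
        by (auto simp: B_def G_def)
      moreover from this have "v = w" using x by blast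
      ultimately show False by simp
    qed
    ultimately show "x \<in> fst ` G - (\<Union>k. B k)" by blast
  next
    fix x assume x: "x \<in> fst ` G - (\<Union>k. B k)"
    then obtain v where v: "x \<in> frontier K" "outer_unit_normal K x v" by (auto simp: G_def)
    have "w = v" if w: "outer_unit_normal K x w" for w
    proof (rule ccontr)
      assume "w \<noteq> v"
      then obtain k where "inverse (real (Suc k)) < dist w v" using reals_Archimedean by (metis zero_less_dist_iff)
      then have "x \<in> B k"
        unfolding B_def using v w
        by (intro image_eqI[where x="((x, w), (x, v))"]) (auto simp: G_def inverse_eq_divide)
      with x show False by blast
    qed
    with v show "x \<in> {x \<in> frontier K. \<exists>!v. outer_unit_normal K x v}" by blast
  qed
  moreover have "fst ` G \<in> sets borel"
    by (intro borel_compact compact_continuous_image G continuous_intros)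
  ultimately show ?thesis using B by auto
qed

lemma continuous_on_gauss_map:
  fixes K :: "'a::euclidean_space set"
  assumes "compact K"
  shows "continuous_on {x \<in> frontier K. \<exists>!v. outer_unit_normal K x v} (gauss_map K)"
    (is "continuous_on ?R _")
proof -
  define G where "G = {(x, v). x \<in> frontier K \<and> outer_unit_normal K x v}"
  have "closed G"
    unfolding G_def using compact_normal_bundle[OF assms] by (rule compact_imp_closed)
  moreover have "(\<lambda>x. (x, gauss_map K x)) ` ?R = (?R \<times> sphere 0 1) \<inter> G"
  proof (intro equalityI subsetI)
    fix z assume "z \<in> (\<lambda>x. (x, gauss_map K x)) ` ?R"
    then obtain x where x: "x \<in> ?R" "z = (x, gauss_map K x)" by blast
    with outer_unit_normal_gauss_map[of K x] have "outer_unit_normal K x (gauss_map K x)" by blast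
    moreover from this have "norm (gauss_map K x) = 1" by (simp add: outer_unit_normal_def)
    ultimately show "z \<in> (?R \<times> sphere 0 1) \<inter> G" using x by (simp add: G_def)
  next
    fix z assume z: "z \<in> (?R \<times> sphere 0 1) \<inter> G"
    then have "snd z = gauss_map K (fst z)"
      by (intro gauss_map_eq[symmetric]) (force simp: G_def)+
    then show "z \<in> (\<lambda>x. (x, gauss_map K x)) ` ?R"
      using z by (intro image_eqI[where x="fst z"]) (auto simp: prod_eq_iff)
  qed
  ultimately have "closedin (top_of_set (?R \<times> sphere 0 1)) ((\<lambda>x. (x, gauss_map K x)) ` ?R)"
    by (auto simp: closedin_closed)
  moreover have "gauss_map K \<in> ?R \<rightarrow> sphere 0 1"
    using outer_unit_normal_gauss_map[of K] by (auto simp: outer_unit_normal_def)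
  ultimately show ?thesis
    by (simp add: continuous_closed_graph_eq[OF compact_sphere])
qed

lemma emeasure_lp_gaussian_surface_area_measure:
  fixes K :: "'a::euclidean_space set"
  assumes K: "compact K" and \<eta>: "\<eta> \<in> sets sphere_borel"
  shows "emeasure (lp_gaussian_surface_area_measure p K) \<eta> =
     ennreal (1 / sqrt (2 * pi) ^ DIM('a)) *
          (\<integral>\<^sup>+x\<in>gauss_preimage K \<eta>.
             ennreal (exp (- (norm x)\<^sup>2 / 2) * (x \<bullet> gauss_map K x) powr (1 - p))
           \<partial>hausdorff_measure (DIM('a) - 1))"
proof -
  define R where "R = {x \<in> frontier K. \<exists>!v. outer_unit_normal K x v}"
  define e :: 'a where "e = (SOME b. b \<in> Basis)"
  define g where "g x = (if x \<in> R then gauss_map K x else e)" for x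
  define c where "c = ennreal (1 / sqrt (2 * pi) ^ DIM('a))"
  define F where "F \<eta> = c * (\<integral>\<^sup>+x\<in>gauss_preimage K \<eta>.
             ennreal (exp (- (norm x)\<^sup>2 / 2) * (x \<bullet> gauss_map K x) powr (1 - p))
           \<partial>hausdorff_measure (DIM('a) - 1))" for \<eta>
  have R: "R \<in> sets borel" unfolding R_def by (rule borel_regular_points[OF K])
  have e: "norm e = 1" unfolding e_def by (rule norm_Basis, rule SOME_Basis)
  have g_borel [measurable]: "g \<in> borel_measurable borel"
  proof -
    have "continuous_on R (gauss_map K)" unfolding R_def by (rule continuous_on_gauss_map[OF K])
    then show ?thesis
      unfolding g_def[abs_def]
      by (intro borel_measurable_continuous_on_if R continuous_on_const)
  qed
  have g_sphere: "g x \<in> sphere 0 1" for x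
    using outer_unit_normal_gauss_map[of K x] e by (auto simp: g_def R_def outer_unit_normal_def)
  have g [measurable]: "g \<in> borel \<rightarrow>\<^sub>M sphere_borel"
    using g_sphere by (intro measurable_restrict_space2) auto
  define f where "f x = c * (ennreal (exp (- (norm x)\<^sup>2 / 2) * (x \<bullet> g x) powr (1 - p)) * indicator R x)" for x
  have f [measurable]: "f \<in> borel_measurable borel"
    unfolding f_def using R by measurable
  define D where "D = distr (density (hausdorff_measure (DIM('a) - 1)) f) sphere_borel g"
  have D: "emeasure D A = F A" if A: "A \<in> sets sphere_borel" for A
  proof -
    have "emeasure D A = emeasure (density (hausdorff_measure (DIM('a) - 1)) f) (g -` A)"
      unfolding D_def using A by (subst emeasure_distr) auto
    also have "\<dots> = (\<integral>\<^sup>+x. f x * indicator (g -` A) x \<partial>hausdorff_measure (DIM('a) - 1))"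
      using measurable_sets[OF g A] by (intro emeasure_density) auto
    also have "\<dots> = (\<integral>\<^sup>+x. c * (ennreal (exp (- (norm x)\<^sup>2 / 2) * (x \<bullet> g x) powr (1 - p)) * indicator (R \<inter> g -` A) x) \<partial>hausdorff_measure (DIM('a) - 1))"
      by (intro nn_integral_cong) (auto simp: f_def indicator_def)
    also have "\<dots> = c * (\<integral>\<^sup>+x. ennreal (exp (- (norm x)\<^sup>2 / 2) * (x \<bullet> g x) powr (1 - p)) * indicator (R \<inter> g -` A) x \<partial>hausdorff_measure (DIM('a) - 1))"
      using measurable_sets[OF g A] R by (intro nn_integral_cmult) auto
    also have "\<dots> = F A"
      unfolding F_def
      by (intro arg_cong[where f="(*) c"] nn_integral_cong)
         (auto simp: gauss_preimage_def R_def g_def indicator_def)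
    finally show ?thesis .
  qed
  have "lp_gaussian_surface_area_measure p K = measure_of (sphere 0 1) (sets sphere_borel) F"
    unfolding lp_gaussian_surface_area_measure_def F_def c_def ..
  also have "\<dots> = measure_of (sphere 0 1) (sets sphere_borel) (emeasure D)"
  proof (rule measure_of_eq)
    show "sets sphere_borel \<subseteq> Pow (sphere 0 1 :: 'a set)"
      using sets.space_closed[of "sphere_borel :: 'a measure"] by (simp add: space_restrict_space)
    fix X :: "'a set"
    assume "X \<in> sigma_sets (sphere 0 1) (sets sphere_borel)"
    then have "X \<in> sets sphere_borel"
      using sets.sigma_sets_eq[of "sphere_borel :: 'a measure"] by (simp add: space_restrict_space)
    then show "F X = emeasure D X" by (rule D[symmetric])
  qed
  also have "\<dots> = measure_of (space D) (sets D) (emeasure D)"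
    by (simp add: D_def space_restrict_space)
  also have "\<dots> = D" by (rule measure_of_of_measure)
  finally show ?thesis
    using D[OF \<eta>] by (simp add: F_def c_def)
qed

lemma space_lp_gaussian_surface_area_measure [simp]:
  "space (lp_gaussian_surface_area_measure p K) = sphere 0 1"
  by (simp add: lp_gaussian_surface_area_measure_def space_measure_of_conv)

lemma sets_lp_gaussian_surface_area_measure [simp, measurable_cong]:
  fixes K :: "'a::euclidean_space set"
  shows "sets (lp_gaussian_surface_area_measure p K) = sets sphere_borel"
  using sets.sigma_sets_eq[of "sphere_borel :: 'a measure"] sets.space_closed[of "sphere_borel :: 'a measure"]
  by (simp add: lp_gaussian_surface_area_measure_def space_restrict_space)

end

theory Submission
  imports Defs "HOL-Probability.Distributions" "HOL-Complex_Analysis.Great_Picard"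
begin

text \<open>
  The body is found by maximising Gaussian volume. For a positive continuous function \<open>g\<close> on the unit sphere let
  \<open>wulff g\<close> be the convex body cut out by the half-spaces \<open>x \<bullet> v \<le> g v\<close>. Among the even \<open>g\<close> with
  \<open>\<integral> ln g d\<mu> \<le> 0\<close> there is one for which the Gaussian volume of \<open>wulff g\<close> is maximal
  (\<open>gaussian_maximiser_exists\<close>). Along a maximising sequence the volume stays away from \<open>0\<close>, while a thin
  slab has small Gaussian volume, so the support functions stay above some \<open>\<delta> > 0\<close>. If a body in the
  sequence contains \<open>x\<close>, then its support function at \<open>u\<close> is at least \<open>max \<delta> \<bar>x \<bullet> u\<bar>\<close>; since the
  concentration inequality keeps part of \<open>\<mu>\<close> off every hyperplane, the constraint on \<open>\<integral> ln g d\<mu>\<close> bounds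
  \<open>norm x\<close>. The support functions are then uniformly Lipschitz and a subsequence converges uniformly.

  Let \<open>h\<close> be the support function of the maximiser \<open>K\<close>, let \<open>N\<close> be its gauge, and let
  \<open>radial z = z / N z\<close>. For even \<open>f\<close> with \<open>\<integral> f d\<mu> = 0\<close> the functions \<open>h exp (t f)\<close> are competitors, so
  the derivative of the Gaussian volume of their Wulff shapes vanishes at \<open>t = 0\<close>. In polar coordinates
  adapted to \<open>K\<close> this derivative is a positive multiple of the integral of
  \<open>f (\<nu> (radial z)) exp (- norm (radial z) ^ 2 / 2)\<close> over \<open>K\<close>, because the gauge of the perturbed body is
  differentiable in \<open>t\<close> wherever the outer normal \<open>\<nu>\<close> is unique, with logarithmic derivative \<open>- f \<circ> \<nu>\<close>
  (\<open>first_variation_nonpos\<close>). Irregular boundary points correspond to kinks of the convex function \<open>N\<close> in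
  some basis direction; there are only countably many of these on each line in that direction, so they form a
  null set (\<open>AE_regular\<close>). So \<open>\<mu>\<close> is proportional to the image
  under \<open>\<nu> \<circ> radial\<close> of volume on \<open>K\<close> with that Gaussian weight.

  It remains to recognise this image as a multiple of the Gaussian surface area measure. On regular boundary
  points, \<open>x \<bullet> \<nu> x\<close> times surface measure is a constant multiple of the volume of the cone over a set
  (\<open>weighted_surface_eq_cone\<close>). Near a regular point the boundary is a graph over its tangent plane with small
  Lipschitz constant, and a thin shell of the cone is, up to a volume preserving shear, nearly isometric to a
  right prism over the projection; the two measures therefore agree locally up to factors close to \<open>1\<close>, and a
  countable cover makes the comparison global. On hyperplanes, translation invariance makes Hausdorff measure a
  finite positive multiple of Lebesgue measure, and reflections show that the multiple does not depend on the
  hyperplane (\<open>hausdorff_outer_hyperplane\<close>). Its value is absorbed into the constant of the theorem.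
\<close>

section \<open>Hausdorff measure under Lipschitz maps\<close>

text \<open>Comparing two maps on a common parameter set, rather than one map and its domain, covers Lipschitz
  images, inverses of expanding maps and surface parametrisations at once.\<close>

lemma hausdorff_outer_Lipschitz_compare:
  fixes \<phi> :: "'x \<Rightarrow> 'a::metric_space" and \<psi> :: "'x \<Rightarrow> 'b::metric_space"
  assumes L: "0 < L"
    and lip: "\<And>p q. p \<in> X \<Longrightarrow> q \<in> X \<Longrightarrow> dist (\<psi> p) (\<psi> q) \<le> L * dist (\<phi> p) (\<phi> q)"
  shows "hausdorff_outer s (\<psi> ` X) \<le> ennreal (L ^ s) * hausdorff_outer s (\<phi> ` X)"
proof -
  define V where "V U = \<psi> ` {p \<in> X. \<phi> p \<in> U}" for U
  have diam: "bounded (V U)" "diameter (V U) \<le> L * diameter U" if "bounded U" for U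
  proof -
    have d: "dist x y \<le> L * diameter U" if "x \<in> V U" "y \<in> V U" for x y
    proof -
      from that obtain p q where pq: "p \<in> X" "q \<in> X" "\<phi> p \<in> U" "\<phi> q \<in> U" "x = \<psi> p" "y = \<psi> q"
        by (auto simp: V_def)
      have "dist x y \<le> L * dist (\<phi> p) (\<phi> q)" using lip pq by auto
      also have "\<dots> \<le> L * diameter U"
        using L diameter_bounded_bound[OF \<open>bounded U\<close> pq(3,4)] by simp
      finally show ?thesis .
    qed
    show "bounded (V U)"
      unfolding bounded_two_points by (meson d)
    have "0 \<le> L * diameter U" using L diameter_ge_0[OF that] by simp
    then show "diameter (V U) \<le> L * diameter U"
      unfolding diameter_def[of "V U"] by (auto intro!: cSUP_least d)
  qed
  have gauge: "hausdorff_gauge s (V U) \<le> ennreal (L ^ s) * hausdorff_gauge s U" if "bounded U" for U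
  proof (cases "V U = {}")
    case False
    then have U: "U \<noteq> {}" by (auto simp: V_def)
    have "0 \<le> diameter (V U)" using diam(1)[OF that] by (rule diameter_ge_0)
    then have "unit_ball_vol (real s) * (diameter (V U) / 2) ^ s
        \<le> unit_ball_vol (real s) * (L * (diameter U / 2)) ^ s"
      using diam(2)[OF that] by (intro mult_left_mono power_mono) auto
    also have "\<dots> = L ^ s * (unit_ball_vol (real s) * (diameter U / 2) ^ s)"
      by (simp only: power_mult_distrib mult_ac)
    finally have "ennreal (unit_ball_vol (real s) * (diameter (V U) / 2) ^ s)
        \<le> ennreal (L ^ s * (unit_ball_vol (real s) * (diameter U / 2) ^ s))"
      by (rule ennreal_leI)
    then show ?thesis
      using False U L diameter_ge_0[OF that]
      by (simp add: hausdorff_gauge_def ennreal_mult)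
  qed simp
  \<comment> \<open>a cover of \<open>\<phi> ` X\<close> is transported to a cover of \<open>\<psi> ` X\<close> by \<open>V\<close>\<close>
  have pre: "hausdorff_premeasure s (L * \<delta>) (\<psi> ` X) \<le> ennreal (L ^ s) * hausdorff_premeasure s \<delta> (\<phi> ` X)" for \<delta>
  proof -
    have "ennreal (1 / L ^ s) * hausdorff_premeasure s (L * \<delta>) (\<psi> ` X) \<le> hausdorff_premeasure s \<delta> (\<phi> ` X)"
      unfolding hausdorff_premeasure_def[of s \<delta>]
    proof (rule INF_greatest)
      fix U :: "nat \<Rightarrow> 'a set"
      assume "U \<in> {U. (\<forall>i. bounded (U i) \<and> diameter (U i) \<le> \<delta>) \<and> \<phi> ` X \<subseteq> (\<Union>i. U i)}"
      then have U: "\<And>i. bounded (U i)" "\<And>i. diameter (U i) \<le> \<delta>" "\<phi> ` X \<subseteq> (\<Union>i. U i)" by auto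
      have "hausdorff_premeasure s (L * \<delta>) (\<psi> ` X) \<le> (\<Sum>i. hausdorff_gauge s (V (U i)))"
        unfolding hausdorff_premeasure_def
      proof (rule INF_lower, clarsimp, intro conjI allI)
        show "bounded (V (U i))" for i by (rule diam[OF U(1)])
        show "diameter (V (U i)) \<le> L * \<delta>" for i
          using order_trans[OF diam(2)[OF U(1)] mult_left_mono[OF U(2)]] L by simp
        show "\<psi> ` X \<subseteq> (\<Union>i. V (U i))" using U(3) by (fastforce simp: V_def)
      qed
      also have "\<dots> \<le> (\<Sum>i. ennreal (L ^ s) * hausdorff_gauge s (U i))"
        by (intro suminf_le gauge U) auto
      finally have "ennreal (1 / L ^ s) * hausdorff_premeasure s (L * \<delta>) (\<psi> ` X)
          \<le> ennreal (1 / L ^ s) * (ennreal (L ^ s) * (\<Sum>i. hausdorff_gauge s (U i)))"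
        by (intro mult_left_mono) auto
      also have "\<dots> = (\<Sum>i. hausdorff_gauge s (U i))"
        using L by (simp add: mult.assoc[symmetric] ennreal_mult[symmetric])
      finally show "ennreal (1 / L ^ s) * hausdorff_premeasure s (L * \<delta>) (\<psi> ` X)
          \<le> (\<Sum>i. hausdorff_gauge s (U i))" .
    qed
    then have "ennreal (L ^ s) * (ennreal (1 / L ^ s) * hausdorff_premeasure s (L * \<delta>) (\<psi> ` X))
        \<le> ennreal (L ^ s) * hausdorff_premeasure s \<delta> (\<phi> ` X)"
      by (intro mult_left_mono) auto
    then show ?thesis
      using L by (simp add: mult.assoc[symmetric] ennreal_mult[symmetric])
  qed
  show ?thesis
    unfolding hausdorff_outer_def[of s "\<psi> ` X"]
  proof (rule SUP_least)
    fix \<delta> :: real assume \<delta>: "\<delta> \<in> {0<..}"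
    have "hausdorff_premeasure s \<delta> (\<psi> ` X) \<le> ennreal (L ^ s) * hausdorff_premeasure s (\<delta> / L) (\<phi> ` X)"
      using pre[of "\<delta> / L"] L by simp
    also have "\<dots> \<le> ennreal (L ^ s) * hausdorff_outer s (\<phi> ` X)"
      using \<delta> L unfolding hausdorff_outer_def by (intro mult_left_mono SUP_upper) auto
    finally show "hausdorff_premeasure s \<delta> (\<psi> ` X) \<le> ennreal (L ^ s) * hausdorff_outer s (\<phi> ` X)" .
  qed
qed

lemma hausdorff_outer_isometric_image:
  fixes f :: "'a::metric_space \<Rightarrow> 'b::metric_space"
  assumes "\<And>x y. x \<in> A \<Longrightarrow> y \<in> A \<Longrightarrow> dist (f x) (f y) = dist x y"
  shows "hausdorff_outer s (f ` A) = hausdorff_outer s A"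
  using hausdorff_outer_Lipschitz_compare[of 1 A f "\<lambda>x. x" s] hausdorff_outer_Lipschitz_compare[of 1 A "\<lambda>x. x" f s]
  by (auto intro!: antisym simp: assms)

section \<open>Translation invariant measures and linear maps\<close>

lemma sigma_finite_measure_if_finite_on_cballs:
  fixes M :: "'a::real_normed_vector measure"
  assumes sets: "sets M = sets borel" and fin: "\<And>k::nat. emeasure M (cball 0 (real k)) < \<infinity>"
  shows "sigma_finite_measure M"
proof
  let ?A = "range (\<lambda>k::nat. cball (0::'a) (real k))"
  have "space M = UNIV" using sets_eq_imp_space_eq[OF sets] by simp
  moreover have "\<Union>?A = UNIV" using real_arch_simple by (auto simp: dist_norm)
  moreover have "?A \<subseteq> sets M" by (auto simp: sets)
  moreover have "\<forall>a\<in>?A. emeasure M a \<noteq> \<infinity>" using fin by (auto simp: less_top[symmetric])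
  ultimately show "\<exists>A. countable A \<and> A \<subseteq> sets M \<and> \<Union>A = space M \<and> (\<forall>a\<in>A. emeasure M a \<noteq> \<infinity>)"
    by (intro exI[of _ ?A]) auto
qed

lemma emeasure_lborel_translate:
  fixes A :: "'a::euclidean_space set"
  assumes [measurable]: "A \<in> sets borel"
  shows "emeasure lborel {y. x + y \<in> A} = emeasure lborel A"
proof -
  have "emeasure lborel A = emeasure (distr lborel borel ((+) x)) A"
    by (simp add: lborel_distr_plus)
  also have "\<dots> = emeasure lborel {y. x + y \<in> A}"
    by (subst emeasure_distr) (auto simp: vimage_def)
  finally show ?thesis by simp
qed

text \<open>Integrate the indicator of \<open>x \<in> A\<close>, \<open>y - x \<in> cball 0 1\<close> against \<open>M \<otimes> lborel\<close>. Integrating over \<open>y\<close>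
  first gives the left-hand side; substituting \<open>x + y\<close> for \<open>x\<close> before exchanging the integrals gives the
  right-hand side, as the ball is symmetric.\<close>

lemma translation_invariant_measure_proportional:
  fixes M :: "'a::euclidean_space measure"
  assumes sf: "sigma_finite_measure M" and sets[measurable_cong]: "sets M = sets borel"
    and inv: "\<And>x A. A \<in> sets borel \<Longrightarrow> emeasure M {y. x + y \<in> A} = emeasure M A"
    and A[measurable]: "A \<in> sets borel"
  shows "emeasure M A * emeasure lborel (cball 0 1 :: 'a set) = emeasure M (cball 0 1) * emeasure lborel A"
proof -
  interpret M: sigma_finite_measure M by (rule sf)
  interpret P: pair_sigma_finite M "lborel :: 'a measure" ..
  have sp: "space M = UNIV" using sets_eq_imp_space_eq[OF sets] by simp
  define B where "B = cball (0::'a) 1"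
  have B[measurable]: "B \<in> sets borel" and B_minus: "-x \<in> B \<longleftrightarrow> x \<in> B" for x by (auto simp: B_def)
  have emM: "(\<integral>\<^sup>+x. indicator S x \<partial>M) = emeasure M S" if "S \<in> sets borel" for S
    using that by (simp add: sets)
  have "emeasure M A * emeasure lborel B = (\<integral>\<^sup>+x. indicator A x * emeasure lborel B \<partial>M)"
    using B A by (subst nn_integral_multc) (simp_all add: emM sets)
  also have "\<dots> = (\<integral>\<^sup>+x. (\<integral>\<^sup>+y. indicator A x * indicator B (y - x) \<partial>lborel) \<partial>M)"
  proof (rule nn_integral_cong)
    fix x
    have "(\<integral>\<^sup>+y. indicator B (y - x) \<partial>lborel) = (\<integral>\<^sup>+y. indicator {y. -x + y \<in> B} y \<partial>lborel)"
      by (intro nn_integral_cong) (auto simp: indicator_def algebra_simps)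
    also have "\<dots> = emeasure lborel {y. -x + y \<in> B}"
      by (intro nn_integral_indicator) measurable
    also have "\<dots> = emeasure lborel B"
      by (intro emeasure_lborel_translate) auto
    finally have "(\<integral>\<^sup>+y. indicator B (y - x) \<partial>lborel) = emeasure lborel B" .
    moreover have "(\<integral>\<^sup>+y. indicator A x * indicator B (y - x) \<partial>lborel) = indicator A x * (\<integral>\<^sup>+y. indicator B (y - x) \<partial>lborel)"
      by (rule nn_integral_cmult) measurable
    ultimately show "indicator A x * emeasure lborel B = (\<integral>\<^sup>+y. indicator A x * indicator B (y - x) \<partial>lborel)"
      by simp
  qed
  also have "\<dots> = (\<integral>\<^sup>+y. (\<integral>\<^sup>+x. indicator A x * indicator B (y - x) \<partial>M) \<partial>lborel)"
    by (rule P.Fubini'[symmetric]) measurable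
  also have "\<dots> = (\<integral>\<^sup>+y. (\<integral>\<^sup>+x. indicator B x * indicator A (y + x) \<partial>M) \<partial>lborel)"
  proof (rule nn_integral_cong)
    fix y
    have S: "{x. x \<in> A \<and> y - x \<in> B} \<in> sets borel" by measurable
    have T: "{x. x \<in> B \<and> y + x \<in> A} \<in> sets borel" by measurable
    have "(\<integral>\<^sup>+x. indicator A x * indicator B (y - x) \<partial>M) = (\<integral>\<^sup>+x. indicator {x. x \<in> A \<and> y - x \<in> B} x \<partial>M)"
      by (intro nn_integral_cong) (auto simp: indicator_def)
    also have "\<dots> = emeasure M {x. y + x \<in> {x. x \<in> A \<and> y - x \<in> B}}"
      using S by (simp only: emM inv)
    also have "{x. y + x \<in> {x. x \<in> A \<and> y - x \<in> B}} = {x. x \<in> B \<and> y + x \<in> A}"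
      using B_minus by auto
    also have "emeasure M \<dots> = (\<integral>\<^sup>+x. indicator {x. x \<in> B \<and> y + x \<in> A} x \<partial>M)"
      using T by (simp only: emM)
    also have "\<dots> = (\<integral>\<^sup>+x. indicator B x * indicator A (y + x) \<partial>M)"
      by (intro nn_integral_cong) (auto simp: indicator_def)
    finally show "(\<integral>\<^sup>+x. indicator A x * indicator B (y - x) \<partial>M) = (\<integral>\<^sup>+x. indicator B x * indicator A (y + x) \<partial>M)" .
  qed
  also have "\<dots> = (\<integral>\<^sup>+x. (\<integral>\<^sup>+y. indicator B x * indicator A (y + x) \<partial>lborel) \<partial>M)"
    by (rule P.Fubini') measurable
  also have "\<dots> = (\<integral>\<^sup>+x. indicator B x * emeasure lborel A \<partial>M)"
  proof (rule nn_integral_cong)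
    fix x
    have "(\<integral>\<^sup>+y. indicator A (y + x) \<partial>lborel) = (\<integral>\<^sup>+y. indicator {y. x + y \<in> A} y \<partial>lborel)"
      by (intro nn_integral_cong) (auto simp: indicator_def algebra_simps)
    also have "\<dots> = emeasure lborel {y. x + y \<in> A}"
      by (intro nn_integral_indicator) measurable
    also have "\<dots> = emeasure lborel A"
      by (intro emeasure_lborel_translate) auto
    finally have "(\<integral>\<^sup>+y. indicator A (y + x) \<partial>lborel) = emeasure lborel A" .
    moreover have "(\<integral>\<^sup>+y. indicator B x * indicator A (y + x) \<partial>lborel) = indicator B x * (\<integral>\<^sup>+y. indicator A (y + x) \<partial>lborel)"
      by (rule nn_integral_cmult) measurable
    ultimately show "(\<integral>\<^sup>+y. indicator B x * indicator A (y + x) \<partial>lborel) = indicator B x * emeasure lborel A"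
      by simp
  qed
  also have "\<dots> = emeasure M B * emeasure lborel A"
    using B A by (subst nn_integral_multc) (simp_all add: emM sets)
  finally show ?thesis by (simp only: B_def)
qed

lemma emeasure_lborel_cball_pos_finite:
  assumes "0 < r"
  shows "0 < emeasure lborel (cball (x::'a::euclidean_space) r)" "emeasure lborel (cball (x::'a::euclidean_space) r) < \<infinity>"
  using assms by (auto simp: emeasure_cball emeasure_lborel_cbox_finite intro!: emeasure_bounded_finite)

lemma translation_invariant_measure_scale:
  fixes M :: "'a::euclidean_space measure"
  assumes sf: "sigma_finite_measure M" and sets: "sets M = sets borel"
    and inv: "\<And>x A. A \<in> sets borel \<Longrightarrow> emeasure M {y. x + y \<in> A} = emeasure M A"
    and fin: "emeasure M (cball 0 1) < \<infinity>"
  obtains c :: real where "0 \<le> c" "\<And>A. A \<in> sets borel \<Longrightarrow> emeasure M A = ennreal c * emeasure lborel A"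
proof -
  define m where "m = enn2real (emeasure M (cball 0 1))"
  define v where "v = enn2real (emeasure lborel (cball (0::'a) 1))"
  have m: "emeasure M (cball 0 1) = ennreal m" "0 \<le> m" using fin by (auto simp: m_def less_top)
  have v: "emeasure lborel (cball (0::'a) 1) = ennreal v" "0 < v"
    using emeasure_lborel_cball_pos_finite[of 1 "0::'a"]
    by (auto simp: v_def less_top enn2real_positive_iff)
  show thesis
  proof (rule that[of "m / v"])
    show "0 \<le> m / v" using m v by simp
    fix A :: "'a set" assume "A \<in> sets borel"
    then have eq: "emeasure M A * ennreal v = ennreal m * emeasure lborel A"
      using translation_invariant_measure_proportional[OF sf sets inv] by (simp add: m v)
    have "emeasure M A = emeasure M A * ennreal v * ennreal (1 / v)"
      using v by (simp add: mult.assoc ennreal_mult[symmetric])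
    also have "\<dots> = ennreal (m / v) * emeasure lborel A"
      unfolding eq using v m by (simp add: ennreal_mult divide_inverse mult_ac)
    finally show "emeasure M A = ennreal (m / v) * emeasure lborel A" .
  qed
qed

lemma borel_measurable_linear:
  fixes T :: "'a::euclidean_space \<Rightarrow> 'b::euclidean_space"
  assumes "linear T"
  shows "T \<in> borel_measurable borel"
  using assms by (intro borel_measurable_continuous_onI linear_continuous_on linear_conv_bounded_linear[THEN iffD1])

text \<open>The set function on the left is again translation invariant. The determinant enters only as the
  unspecified factor \<open>c\<close>, which is identified below for maps that are conjugate to their own inverse.\<close>

lemma linear_vimage_emeasure_lborel:
  fixes T :: "'a::euclidean_space \<Rightarrow> 'a"
  assumes T: "linear T" "inj T"
  obtains c :: real where "0 \<le> c"
    "\<And>A. A \<in> sets borel \<Longrightarrow> emeasure lborel {x. T x \<in> A} = ennreal c * emeasure lborel A"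
proof -
  have [measurable]: "T \<in> borel_measurable borel"
    by (rule borel_measurable_linear[OF T(1)])
  have em: "emeasure (distr lborel borel T) A = emeasure lborel {x. T x \<in> A}" if "A \<in> sets borel" for A
    using that by (subst emeasure_distr) (auto simp: vimage_def)
  obtain B where B: "0 < B" "\<And>x. B * norm x \<le> norm (T x)"
    using linear_inj_bounded_below_pos[OF T] by blast
  have fin: "emeasure (distr lborel borel T) (cball 0 r) < \<infinity>" for r
  proof -
    have "norm x \<le> r / B" if "norm (T x) \<le> r" for x
    proof -
      have "B * norm x \<le> r" using B(2)[of x] that by linarith
      then show ?thesis using B(1) by (simp add: pos_le_divide_eq mult.commute)
    qed
    then have "bounded {x. T x \<in> cball 0 r}" by (auto simp: bounded_iff)
    then have "emeasure lborel {x. T x \<in> cball 0 r} < \<infinity>" by (rule emeasure_bounded_finite)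
    then show ?thesis by (simp add: em)
  qed
  have inv: "emeasure (distr lborel borel T) {y. x + y \<in> A} = emeasure (distr lborel borel T) A"
    if [measurable]: "A \<in> sets borel" for x A
  proof -
    have "surj T" using linear_injective_imp_surjective[OF T] by simp
    then obtain z where z: "x = T z" by blast
    have "{y. T y \<in> {y. x + y \<in> A}} = {y. z + y \<in> {y. T y \<in> A}}"
      by (simp add: z linear_add[OF T(1)])
    moreover have "emeasure lborel {y. z + y \<in> {y. T y \<in> A}} = emeasure lborel {y. T y \<in> A}"
      by (rule emeasure_lborel_translate) measurable
    ultimately show ?thesis by (simp add: em)
  qed
  have sf: "sigma_finite_measure (distr lborel borel T)"
    by (rule sigma_finite_measure_if_finite_on_cballs) (use fin in auto)
  show thesis
  proof (rule translation_invariant_measure_scale[OF sf _ inv fin])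
    fix c :: real assume c: "0 \<le> c" "\<And>A. A \<in> sets borel \<Longrightarrow> emeasure (distr lborel borel T) A = ennreal c * emeasure lborel A"
    show thesis
    proof (rule that[OF c(1)])
      show "emeasure lborel {x. T x \<in> A} = ennreal c * emeasure lborel A" if "A \<in> sets borel" for A
        using c(2)[OF that] em[OF that] by simp
    qed
  qed auto
qed

lemma ennreal_square_fix_imp_1:
  assumes "0 \<le> c" "ennreal c * (ennreal c * v) = v" "0 < v" "v < \<infinity>"
  shows "c = 1"
proof -
  obtain w where w: "v = ennreal w" "0 < w" using assms(3,4)
    by (metis ennreal_eq_0_iff ennreal_enn2real infinity_ennreal_def leI not_gr_zero)
  have "c * (c * w) = w"
    using assms(1,2) w by (simp add: ennreal_mult[symmetric])
  then have "c * c = 1" using w(2) by simp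
  then show ?thesis using assms(1) by (metis mult_le_one mult_mono nle_le power2_eq_square power2_eq_1_iff not_one_le_zero neg_0_le_iff_le)
qed

text \<open>Applying \<open>R\<close> twice multiplies volume by the square of its factor, which is therefore \<open>1\<close>.\<close>

lemma linear_involution_emeasure_lborel:
  fixes R :: "'a::euclidean_space \<Rightarrow> 'a"
  assumes R: "linear R" "\<And>x. R (R x) = x" and A: "A \<in> sets borel"
  shows "emeasure lborel {x. R x \<in> A} = emeasure lborel A"
proof -
  have "inj R" by (rule inj_on_inverseI[of _ R]) (simp add: R)
  then obtain c where c: "0 \<le> c" "\<And>A. A \<in> sets borel \<Longrightarrow> emeasure lborel {x. R x \<in> A} = ennreal c * emeasure lborel A"
    using linear_vimage_emeasure_lborel[OF R(1)] by blast
  have [measurable]: "R \<in> borel_measurable borel"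
    by (rule borel_measurable_linear[OF R(1)])
  have B[measurable]: "cball (0::'a) 1 \<in> sets borel" by simp
  have "{x. R x \<in> cball 0 1} \<in> sets borel" by measurable
  from c(2)[OF this] c(2)[OF B]
  have "ennreal c * (ennreal c * emeasure lborel (cball (0::'a) 1)) = emeasure lborel (cball (0::'a) 1)"
    unfolding mem_Collect_eq R by (simp only: Collect_mem_eq)
  then have "c = 1"
    using ennreal_square_fix_imp_1[OF c(1)] emeasure_lborel_cball_pos_finite[of 1 "0::'a"] by simp
  then show ?thesis using c(2)[OF A] by simp
qed

text \<open>The reflection in the hyperplane orthogonal to \<open>v\<close>; as division by \<open>0\<close> yields \<open>0\<close>, \<open>reflect 0\<close> is the
  identity.\<close>

definition reflect :: "'a::euclidean_space \<Rightarrow> 'a \<Rightarrow> 'a" where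
  "reflect v x = x - (2 * (x \<bullet> v) / (v \<bullet> v)) *\<^sub>R v"

lemma linear_reflect: "linear (reflect v)"
  by (rule linearI) (simp_all add: reflect_def algebra_simps inner_simps add_divide_distrib scaleR_add_left)

lemma reflect_reflect [simp]: "reflect v (reflect v x) = x"
  by (cases "v = 0") (simp_all add: reflect_def inner_simps algebra_simps)

lemma inner_reflect_reflect [simp]: "reflect v x \<bullet> reflect v y = x \<bullet> y"
  by (cases "v = 0") (simp_all add: reflect_def inner_simps algebra_simps inner_commute)

lemma norm_reflect [simp]: "norm (reflect v x) = norm x"
  by (simp add: norm_eq_sqrt_inner)

lemma dist_reflect [simp]: "dist (reflect v x) (reflect v y) = dist x y"
  using linear_diff[OF linear_reflect, of v x y] norm_reflect[of v "x - y"] by (simp add: dist_norm)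

lemma reflect_swap:
  assumes "norm a = norm b"
  shows "reflect (a - b) a = b"
proof (cases "a = b")
  case False
  have "a \<bullet> a = b \<bullet> b" using assms by (simp add: norm_eq)
  then have "2 * (a \<bullet> (a - b)) = (a - b) \<bullet> (a - b)" by (simp add: inner_simps inner_commute)
  then have "2 * (a \<bullet> (a - b)) / ((a - b) \<bullet> (a - b)) = 1" using False by (simp only: divide_self inner_eq_zero_iff right_minus_eq simp_thms)
  then have "reflect (a - b) a = a - 1 *\<^sub>R (a - b)" unfolding reflect_def by (simp only:)
  then show ?thesis by simp
qed (simp add: reflect_def)

lemma measurable_reflect [measurable]: "reflect v \<in> borel_measurable borel"
  by (rule borel_measurable_linear[OF linear_reflect])

lemma emeasure_lborel_reflect:
  assumes "A \<in> sets borel"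
  shows "emeasure lborel {x. reflect v x \<in> A} = emeasure lborel A"
  using assms by (intro linear_involution_emeasure_lborel linear_reflect) auto

text \<open>Conjugation with the reflection in \<open>v\<close> turns the shear into its inverse, so the volume factor equals
  its own reciprocal.\<close>

lemma emeasure_lborel_shear:
  fixes u v :: "'a::euclidean_space"
  assumes uv: "u \<bullet> v = 0" and A: "A \<in> sets borel"
  shows "emeasure lborel {x. x + (x \<bullet> v) *\<^sub>R u \<in> A} = emeasure lborel A"
proof (cases "v = 0")
  case False
  define T where "T x = x + (x \<bullet> v) *\<^sub>R u" for x
  define T' where "T' x = x - (x \<bullet> v) *\<^sub>R u" for x
  have T: "linear T" unfolding T_def
    by (rule linearI) (simp_all add: algebra_simps inner_simps)
  have TT': "T (T' x) = x" "T' (T x) = x" for x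
    by (simp_all add: T_def T'_def inner_simps uv)
  have conj: "reflect v (T (reflect v x)) = T' x" for x
    using False uv by (simp add: T_def T'_def reflect_def inner_simps algebra_simps)
  have "inj T" by (rule inj_on_inverseI[of _ T']) (simp add: TT')
  then obtain c where c: "0 \<le> c" "\<And>A. A \<in> sets borel \<Longrightarrow> emeasure lborel {x. T x \<in> A} = ennreal c * emeasure lborel A"
    using linear_vimage_emeasure_lborel[OF T] by blast
  have [measurable]: "T \<in> borel_measurable borel"
    by (rule borel_measurable_linear[OF T])
  let ?B = "cball 0 1 :: 'a set"
  have B0[measurable]: "?B \<in> sets borel" by simp
  have B1: "{x. T x \<in> ?B} \<in> sets borel" by measurable
  have B2: "{x. reflect v x \<in> {x. T x \<in> ?B}} \<in> sets borel" by measurable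
  have B3: "{x. T x \<in> {x. reflect v x \<in> {x. T x \<in> ?B}}} \<in> sets borel" by measurable
  have "emeasure lborel ?B = emeasure lborel {x. T (T' x) \<in> ?B}" by (simp only: TT' Collect_mem_eq)
  also have "{x. T (T' x) \<in> ?B} = {x. reflect v x \<in> {x. T x \<in> {x. reflect v x \<in> {x. T x \<in> ?B}}}}"
    by (simp add: conj)
  also have "emeasure lborel \<dots> = emeasure lborel {x. T x \<in> {x. reflect v x \<in> {x. T x \<in> ?B}}}"
    by (rule emeasure_lborel_reflect[OF B3])
  also have "\<dots> = ennreal c * (ennreal c * emeasure lborel ?B)"
    unfolding c(2)[OF B2] emeasure_lborel_reflect[OF B1] c(2)[OF B0] ..
  finally have "ennreal c * (ennreal c * emeasure lborel ?B) = emeasure lborel ?B" by (rule sym)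
  then have "c = 1"
    using ennreal_square_fix_imp_1[OF c(1)] emeasure_lborel_cball_pos_finite[of 1 "0::'a"] by simp
  then show ?thesis using c(2)[OF A] by (simp add: T_def)
qed simp

section \<open>Hausdorff measure of cubes, of the whole space and of hyperplanes\<close>

lemma hausdorff_premeasure_finite_cover:
  assumes J: "finite J" and U: "\<And>j. j \<in> J \<Longrightarrow> bounded (U j) \<and> diameter (U j) \<le> \<delta>" and \<delta>: "0 \<le> \<delta>"
    and cov: "A \<subseteq> (\<Union>j\<in>J. U j)"
  shows "hausdorff_premeasure s \<delta> A \<le> (\<Sum>j\<in>J. hausdorff_gauge s (U j))"
proof -
  obtain e where e: "bij_betw e {..<card J} J" using ex_bij_betw_nat_finite[OF J] by (auto simp: lessThan_atLeast0)
  define V where "V i = (if i < card J then U (e i) else {})" for i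
  have eJ: "e i \<in> J" if "i < card J" for i using e that by (auto simp: bij_betw_def)
  have "hausdorff_premeasure s \<delta> A \<le> (\<Sum>i. hausdorff_gauge s (V i))"
    unfolding hausdorff_premeasure_def
  proof (rule INF_lower, clarsimp, intro conjI allI)
    show "bounded (V i)" "diameter (V i) \<le> \<delta>" for i
      using U[OF eJ] \<delta> by (auto simp: V_def)
    show "A \<subseteq> (\<Union>i. V i)"
    proof
      fix x assume "x \<in> A"
      then obtain j where j: "j \<in> J" "x \<in> U j" using cov by blast
      then have "j \<in> e ` {..<card J}" using bij_betw_imp_surj_on[OF e] by simp
      then obtain i where "i < card J" "j = e i" by auto
      then show "x \<in> (\<Union>i. V i)" using j by (auto simp: V_def intro!: exI[of _ i])
    qed
  qed
  also have "\<dots> = (\<Sum>i<card J. hausdorff_gauge s (V i))"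
    by (intro suminf_finite) (auto simp: V_def)
  also have "\<dots> = (\<Sum>i<card J. hausdorff_gauge s (U (e i)))"
    by (intro sum.cong) (auto simp: V_def)
  also have "\<dots> = (\<Sum>j\<in>J. hausdorff_gauge s (U j))"
    by (rule sum.reindex_bij_betw[OF e])
  finally show ?thesis .
qed

definition unit_cube_on :: "'a::euclidean_space set \<Rightarrow> 'a set" where
  "unit_cube_on I = {x. (\<forall>b\<in>I. 0 \<le> x \<bullet> b \<and> x \<bullet> b \<le> 1) \<and> (\<forall>b\<in>Basis - I. x \<bullet> b = 0)}"

text \<open>Cutting the cube into \<open>k ^ card I\<close> cells of diameter at most \<open>DIM('a) / k\<close> gives covers whose total
  gauge is bounded independently of \<open>k\<close>.\<close>

lemma hausdorff_outer_unit_cube_finite: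
  fixes I :: "'a::euclidean_space set"
  assumes I: "I \<subseteq> Basis"
  shows "hausdorff_outer (card I) (unit_cube_on I) < \<infinity>"
proof -
  let ?m = "card I" and ?D = "real DIM('a)"
  have fI: "finite I" using I finite_Basis finite_subset by blast
  define C where "C = unit_ball_vol (real ?m) * (?D / 2) ^ ?m"
  have C0: "0 \<le> C" by (simp add: C_def)
  have grid: "hausdorff_premeasure ?m (?D / real k) (unit_cube_on I) \<le> ennreal C" if k: "0 < k" for k :: nat
  proof -
    define J where "J = PiE I (\<lambda>_. {..<k})"
    define U where "U f = {x \<in> unit_cube_on I. \<forall>b\<in>I. real (f b) / k \<le> x \<bullet> b \<and> x \<bullet> b \<le> (real (f b) + 1) / k}" for f
    have J: "finite J" "card J = k ^ ?m"
      unfolding J_def using fI by (auto simp: finite_PiE card_PiE)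
    have d: "dist x y \<le> ?D / k" if "x \<in> U f" "y \<in> U f" for x y f
    proof -
      have "\<bar>(x - y) \<bullet> b\<bar> \<le> 1 / k" if b: "b \<in> Basis" for b
      proof (cases "b \<in> I")
        case True
        have "real (f b) / k \<le> x \<bullet> b" "x \<bullet> b \<le> (real (f b) + 1) / k" "real (f b) / k \<le> y \<bullet> b" "y \<bullet> b \<le> (real (f b) + 1) / k"
          using \<open>x \<in> U f\<close> \<open>y \<in> U f\<close> True by (auto simp: U_def)
        then show ?thesis unfolding inner_diff_left add_divide_distrib by linarith
      next
        case False
        then show ?thesis using \<open>x \<in> U f\<close> \<open>y \<in> U f\<close> b by (simp add: U_def unit_cube_on_def inner_diff_left)
      qed
      then have "(\<Sum>b\<in>Basis. \<bar>(x - y) \<bullet> b\<bar>) \<le> (\<Sum>b\<in>(Basis::'a set). 1 / k)" by (intro sum_mono)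
      then have "norm (x - y) \<le> (\<Sum>b\<in>(Basis::'a set). 1 / k)"
        using norm_le_l1[of "x - y"] by linarith
      then show ?thesis by (simp add: dist_norm)
    qed
    have bd: "bounded (U f)" for f
      unfolding bounded_two_points using d[of _ f] by blast
    have diam: "diameter (U f) \<le> ?D / k" for f
      by (intro diameter_le) (use d in \<open>auto simp: dist_norm[symmetric]\<close>)
    have "hausdorff_premeasure ?m (?D / real k) (unit_cube_on I) \<le> (\<Sum>f\<in>J. hausdorff_gauge ?m (U f))"
    proof (rule hausdorff_premeasure_finite_cover[OF J(1)])
      show "unit_cube_on I \<subseteq> (\<Union>f\<in>J. U f)"
      proof
        fix x assume x: "x \<in> unit_cube_on I"
        define f where "f = restrict (\<lambda>b. min (k - 1) (nat \<lfloor>x \<bullet> b * k\<rfloor>)) I"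
        have "f \<in> J" using k by (auto simp: f_def J_def)
        moreover have "real (f b) / k \<le> x \<bullet> b \<and> x \<bullet> b \<le> (real (f b) + 1) / k" if b: "b \<in> I" for b
        proof -
          have xb: "0 \<le> x \<bullet> b" "x \<bullet> b \<le> 1" using x b by (auto simp: unit_cube_on_def)
          have fl: "real (nat \<lfloor>x \<bullet> b * k\<rfloor>) \<le> x \<bullet> b * k" "x \<bullet> b * k < real (nat \<lfloor>x \<bullet> b * k\<rfloor>) + 1"
            using xb k by (auto simp: of_nat_nat)
          have fb: "f b = min (k - 1) (nat \<lfloor>x \<bullet> b * k\<rfloor>)" using b by (simp add: f_def)
          have "real (f b) \<le> x \<bullet> b * k" using fl(1) fb by linarith
          moreover have "x \<bullet> b * k \<le> real (f b) + 1"
          proof (cases "nat \<lfloor>x \<bullet> b * k\<rfloor> \<le> k - 1")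
            case True then show ?thesis using fl(2) fb by simp
          next
            case False
            then have "real (f b) + 1 = k" using fb k by (simp add: of_nat_diff)
            moreover have "x \<bullet> b * k \<le> 1 * real k" using xb by (intro mult_right_mono) auto
            ultimately show ?thesis by simp
          qed
          ultimately show ?thesis using k by (simp add: divide_le_eq le_divide_eq)
        qed
        ultimately show "x \<in> (\<Union>f\<in>J. U f)" using x by (auto simp: U_def)
      qed
    qed (use bd diam in auto)
    also have "\<dots> \<le> (\<Sum>f\<in>J. ennreal (unit_ball_vol (real ?m) * (?D / k / 2) ^ ?m))"
    proof (rule sum_mono)
      fix f
      have "(diameter (U f) / 2) ^ ?m \<le> (?D / k / 2) ^ ?m"
        using diam[of f] diameter_ge_0[OF bd[of f]] by (intro power_mono) auto
      then show "hausdorff_gauge ?m (U f) \<le> ennreal (unit_ball_vol (real ?m) * (?D / k / 2) ^ ?m)"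
        by (auto simp: hausdorff_gauge_def intro!: ennreal_leI mult_left_mono)
    qed
    also have "\<dots> = ennreal (real (k ^ ?m) * (unit_ball_vol (real ?m) * (?D / k / 2) ^ ?m))"
      using J(2) by (simp add: ennreal_of_nat_eq_real_of_nat ennreal_mult[symmetric])
    also have "real (k ^ ?m) * (unit_ball_vol (real ?m) * (?D / k / 2) ^ ?m) = C"
      using k by (simp add: C_def power_divide)
    finally show ?thesis .
  qed
  have "hausdorff_outer ?m (unit_cube_on I) \<le> ennreal C"
    unfolding hausdorff_outer_def
  proof (rule SUP_least)
    fix \<delta> :: real assume "\<delta> \<in> {0<..}"
    then have "0 < \<delta>" by simp
    then obtain k :: nat where k: "?D / \<delta> < real k" using reals_Archimedean2 by blast
    have "0 < ?D / \<delta>" using \<open>0 < \<delta>\<close> by simp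
    then have k0: "0 < k" using k by (metis of_nat_0_less_iff order_less_trans)
    then have "?D / real k \<le> \<delta>" using k \<open>0 < \<delta>\<close> by (simp add: field_simps)
    then show "hausdorff_premeasure ?m \<delta> (unit_cube_on I) \<le> ennreal C"
      using hausdorff_premeasure_antimono grid[OF k0] order_trans by blast
  qed
  then show ?thesis using ennreal_less_top[of C] by (simp add: le_less_trans)
qed

text \<open>Hausdorff measure is not too small: a set of diameter \<open>d \<le> 1\<close>, thickened by \<open>1\<close> in the directions
  outside \<open>I\<close>, fits into a box with sides \<open>2 * d\<close> along \<open>I\<close> and \<open>3\<close> across, whose volume is a multiple of the
  gauge of the set.\<close>

lemma emeasure_thickening_le_hausdorff_outer:
  fixes I :: "'a::euclidean_space set"
  assumes I: "I \<subseteq> Basis" and W: "W \<in> sets borel"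
    and thick: "\<And>y. y \<in> W \<Longrightarrow> \<exists>x\<in>A. (\<forall>b\<in>I. y \<bullet> b = x \<bullet> b) \<and> (\<forall>b\<in>Basis - I. 0 \<le> y \<bullet> b - x \<bullet> b \<and> y \<bullet> b - x \<bullet> b \<le> 1)"
  shows "emeasure lborel W \<le>
    ennreal (4 ^ card I * 3 ^ (DIM('a) - card I) / unit_ball_vol (real (card I))) * hausdorff_outer (card I) A"
proof -
  let ?m = "card I"
  define C where "C = 4 ^ ?m * 3 ^ (DIM('a) - ?m) / unit_ball_vol (real ?m)"
  have C0: "0 < C" by (simp add: C_def)
  have "ennreal (1 / C) * emeasure lborel W \<le> hausdorff_premeasure ?m 1 A"
    unfolding hausdorff_premeasure_def
  proof (rule INF_greatest)
    fix U :: "nat \<Rightarrow> 'a set"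
    assume "U \<in> {U. (\<forall>i. bounded (U i) \<and> diameter (U i) \<le> 1) \<and> A \<subseteq> (\<Union>i. U i)}"
    then have U: "\<And>i. bounded (U i)" "\<And>i. diameter (U i) \<le> 1" "A \<subseteq> (\<Union>i. U i)" by auto
    define c where "c i = (SOME x. x \<in> U i)" for i
    define d where "d i = diameter (U i)" for i
    have d0: "0 \<le> d i" for i unfolding d_def by (rule diameter_ge_0[OF U(1)])
    define lo where "lo i = (\<Sum>b\<in>Basis. (c i \<bullet> b - (if b \<in> I then d i else 1)) *\<^sub>R b)" for i
    define hi where "hi i = (\<Sum>b\<in>Basis. (c i \<bullet> b + (if b \<in> I then d i else 2)) *\<^sub>R b)" for i
    define V where "V i = (if U i = {} then {} else cbox (lo i) (hi i))" for i
    have vol: "emeasure lborel (V i) = ennreal C * hausdorff_gauge ?m (U i)" for i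
    proof (cases "U i = {}")
      case False
      have "emeasure lborel (cbox (lo i) (hi i)) = ennreal (\<Prod>b\<in>Basis. (hi i - lo i) \<bullet> b)"
        using d0[of i] by (intro emeasure_lborel_cbox) (auto simp: lo_def hi_def)
      also have "(\<Prod>b\<in>Basis. (hi i - lo i) \<bullet> b) = (\<Prod>b\<in>(Basis::'a set). if b \<in> I then 2 * d i else 3)"
        by (intro prod.cong) (auto simp: lo_def hi_def inner_diff_left)
      also have "\<dots> = (2 * d i) ^ ?m * 3 ^ (DIM('a) - ?m)"
        using I by (simp add: prod.If_cases Int_absorb1 Diff_eq[symmetric] card_Diff_subset finite_subset[OF I])
      also have "\<dots> = C * (unit_ball_vol (real ?m) * (d i / 2) ^ ?m)"
      proof -
        have "(4::real) ^ ?m = 2 ^ ?m * 2 ^ ?m" by (simp add: power_mult_distrib[symmetric])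
        moreover have "unit_ball_vol (real ?m) \<noteq> 0" using unit_ball_vol_pos[of "real ?m"] by (simp add: less_le)
        ultimately show ?thesis by (simp add: C_def power_divide power_mult_distrib)
      qed
      finally show ?thesis
        using False C0 d0[of i] by (simp add: V_def hausdorff_gauge_def d_def ennreal_mult)
    qed (simp add: V_def)
    have "W \<subseteq> (\<Union>i. V i)"
    proof
      fix y assume "y \<in> W"
      from thick[OF this] obtain x where x: "x \<in> A" "\<And>b. b \<in> I \<Longrightarrow> y \<bullet> b = x \<bullet> b"
        "\<And>b. b \<in> Basis - I \<Longrightarrow> 0 \<le> y \<bullet> b - x \<bullet> b \<and> y \<bullet> b - x \<bullet> b \<le> 1" by blast
      then obtain i where i: "x \<in> U i" using U(3) by blast
      then have ci: "c i \<in> U i" unfolding c_def by (rule someI)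
      have xd: "\<bar>x \<bullet> b - c i \<bullet> b\<bar> \<le> d i" if "b \<in> Basis" for b
        using Basis_le_norm[OF that, of "x - c i"] diameter_bounded_bound[OF U(1) i ci]
        by (simp add: d_def dist_norm inner_diff_left)
      have "d i \<le> 1" using U(2) by (simp add: d_def)
      have "y \<in> cbox (lo i) (hi i)"
        unfolding mem_box
      proof
        fix b :: 'a assume b: "b \<in> Basis"
        show "lo i \<bullet> b \<le> y \<bullet> b \<and> y \<bullet> b \<le> hi i \<bullet> b"
          using xd[OF b] x(2)[of b] x(3)[of b] b \<open>d i \<le> 1\<close> by (auto simp: lo_def hi_def split: if_splits)
      qed
      then show "y \<in> (\<Union>i. V i)" using i by (auto simp: V_def intro!: exI[of _ i])
    qed
    then have "emeasure lborel W \<le> emeasure lborel (\<Union>i. V i)"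
      by (intro emeasure_mono) (auto simp: V_def)
    also have "\<dots> \<le> (\<Sum>i. emeasure lborel (V i))"
      by (intro emeasure_subadditive_countably) (auto simp: V_def)
    also have "\<dots> = ennreal C * (\<Sum>i. hausdorff_gauge ?m (U i))"
      by (simp add: vol)
    finally have "ennreal (1 / C) * emeasure lborel W \<le> ennreal (1 / C) * (ennreal C * (\<Sum>i. hausdorff_gauge ?m (U i)))"
      by (intro mult_left_mono) auto
    also have "\<dots> = (\<Sum>i. hausdorff_gauge ?m (U i))"
      using C0 by (simp add: mult.assoc[symmetric] ennreal_mult[symmetric])
    finally show "ennreal (1 / C) * emeasure lborel W \<le> (\<Sum>i. hausdorff_gauge ?m (U i))" .
  qed
  also have "\<dots> \<le> hausdorff_outer ?m A"
    unfolding hausdorff_outer_def by (rule SUP_upper) auto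
  finally have "ennreal C * (ennreal (1 / C) * emeasure lborel W) \<le> ennreal C * hausdorff_outer ?m A"
    by (intro mult_left_mono) auto
  then show ?thesis
    using C0 by (simp add: C_def[symmetric] mult.assoc[symmetric] ennreal_mult[symmetric])
qed

lemma hausdorff_outer_bounded_finite:
  fixes I :: "'a::euclidean_space set"
  assumes I: "I \<subseteq> Basis"
  shows "hausdorff_outer (card I) ({x. \<forall>b\<in>Basis - I. x \<bullet> b = 0} \<inter> cball 0 (real k)) < \<infinity>"
proof -
  define r where "r = real k + 1"
  have r: "0 < r" by (simp add: r_def)
  \<comment> \<open>\<open>f\<close> maps the unit cube onto the cube with side \<open>2 * r\<close> centred at the origin\<close>
  define v where "v = (\<Sum>b\<in>I. b)"
  have vb: "v \<bullet> b = (if b \<in> I then 1 else 0)" if "b \<in> Basis" for b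
  proof -
    have "v \<bullet> b = (\<Sum>i\<in>I. i \<bullet> b)" by (simp add: v_def inner_sum_left)
    also have "\<dots> = (\<Sum>i\<in>I. if i = b then 1 else 0)"
      using I that by (intro sum.cong) (auto simp: inner_Basis)
    also have "\<dots> = (if b \<in> I then 1 else 0)"
      using finite_subset[OF I] by simp
    finally show ?thesis .
  qed
  define f where "f x = (2 * r) *\<^sub>R x - r *\<^sub>R v" for x :: 'a
  have sub: "{x. \<forall>b\<in>Basis - I. x \<bullet> b = 0} \<inter> cball 0 (real k) \<subseteq> f ` unit_cube_on I"
  proof
    fix x :: 'a assume x: "x \<in> {x. \<forall>b\<in>Basis - I. x \<bullet> b = 0} \<inter> cball 0 (real k)"
    define z where "z = (1 / (2 * r)) *\<^sub>R (x + r *\<^sub>R v)"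
    have "x = f z" using r by (simp add: f_def z_def)
    moreover have "z \<in> unit_cube_on I"
      unfolding unit_cube_on_def
    proof (intro CollectI conjI ballI)
      fix b assume b: "b \<in> I"
      then have bB: "b \<in> Basis" using I by blast
      have "\<bar>x \<bullet> b\<bar> \<le> r" using Basis_le_norm[OF bB, of x] x by (simp add: r_def)
      then show "0 \<le> z \<bullet> b" "z \<bullet> b \<le> 1" using r b vb[OF bB] by (auto simp: z_def inner_simps field_simps)
    next
      fix b assume b: "b \<in> Basis - I"
      then show "z \<bullet> b = 0" using vb[of b] x by (simp add: z_def inner_simps)
    qed
    ultimately show "x \<in> f ` unit_cube_on I" by blast
  qed
  have "hausdorff_outer (card I) (f ` unit_cube_on I) \<le> ennreal ((2 * r) ^ card I) * hausdorff_outer (card I) ((\<lambda>x. x) ` unit_cube_on I)"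
  proof (rule hausdorff_outer_Lipschitz_compare)
    fix p q
    have "f p - f q = (2 * r) *\<^sub>R (p - q)" by (simp add: f_def algebra_simps)
    then show "dist (f p) (f q) \<le> 2 * r * dist p q" using r by (simp add: dist_norm)
  qed (use r in simp)
  also have "\<dots> < \<infinity>"
    using hausdorff_outer_unit_cube_finite[OF I] by (simp add: ennreal_mult_less_top)
  finally show ?thesis using hausdorff_outer_mono[OF sub] le_less_trans by blast
qed

text \<open>Translation invariance leaves only a factor undetermined; the two preceding bounds on cubes and
  thickenings make it finite and positive.\<close>

lemma hausdorff_outer_full_dimension:
  obtains k where "0 < k"
    "\<And>A :: 'a::euclidean_space set. A \<in> sets borel \<Longrightarrow> hausdorff_outer DIM('a) A = ennreal k * emeasure lborel A"
proof -
  let ?M = "hausdorff_measure DIM('a) :: 'a measure"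
  have em: "emeasure ?M A = hausdorff_outer DIM('a) A" if "A \<in> sets borel" for A
    by (rule emeasure_hausdorff_measure[OF that])
  have fin: "emeasure ?M (cball 0 (real k)) < \<infinity>" for k :: nat
    using hausdorff_outer_bounded_finite[of "Basis :: 'a set" k] by (simp add: em)
  have inv: "emeasure ?M {y. x + y \<in> A} = emeasure ?M A" if [measurable]: "A \<in> sets borel" for x A
  proof -
    have "{y. x + y \<in> A} = (\<lambda>y. y - x) ` A" by force
    moreover have "{y. x + y \<in> A} \<in> sets borel" by measurable
    ultimately show ?thesis
      using hausdorff_outer_isometric_image[of A "\<lambda>y. y - x" "DIM('a)"] that
      by (simp add: em dist_norm)
  qed
  show thesis
  proof (rule translation_invariant_measure_scale[of ?M])
    show "sigma_finite_measure ?M" by (rule sigma_finite_measure_if_finite_on_cballs) (use fin in auto)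
    show "emeasure ?M (cball 0 1) < \<infinity>" using fin[of 1] by simp
    fix c :: real assume c: "0 \<le> c" "\<And>A. A \<in> sets borel \<Longrightarrow> emeasure ?M A = ennreal c * emeasure lborel A"
    have "c \<noteq> 0"
    proof
      assume "c = 0"
      then have "hausdorff_outer DIM('a) (cball (0::'a) 1) = 0" using c(2)[of "cball 0 1"] by (simp add: em)
      moreover have "emeasure lborel (cball (0::'a) 1) \<le>
          ennreal (4 ^ DIM('a) * 3 ^ (DIM('a) - DIM('a)) / unit_ball_vol (real DIM('a))) * hausdorff_outer DIM('a) (cball (0::'a) 1)"
        by (rule emeasure_thickening_le_hausdorff_outer) auto
      ultimately show False
        using emeasure_lborel_cball_pos_finite[of 1 "0::'a"] by simp
    qed
    then show thesis using c em by (intro that[of c]) auto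
  qed (use inv in auto)
qed

text \<open>Volume is a multiple of Hausdorff measure, so it inherits the sharp Lipschitz bound.\<close>

lemma emeasure_lborel_Lipschitz_compare:
  fixes \<phi> \<psi> :: "'x \<Rightarrow> 'a::euclidean_space"
  assumes "0 < L" and "\<And>p q. p \<in> X \<Longrightarrow> q \<in> X \<Longrightarrow> dist (\<psi> p) (\<psi> q) \<le> L * dist (\<phi> p) (\<phi> q)"
    and "\<phi> ` X \<in> sets borel" "\<psi> ` X \<in> sets borel"
  shows "emeasure lborel (\<psi> ` X) \<le> ennreal (L ^ DIM('a)) * emeasure lborel (\<phi> ` X)"
proof -
  obtain k where k: "0 < k" "\<And>A :: 'a set. A \<in> sets borel \<Longrightarrow> hausdorff_outer DIM('a) A = ennreal k * emeasure lborel A"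
    using hausdorff_outer_full_dimension by blast
  have "ennreal k * emeasure lborel (\<psi> ` X) \<le> ennreal (L ^ DIM('a)) * (ennreal k * emeasure lborel (\<phi> ` X))"
    using hausdorff_outer_Lipschitz_compare[of L X \<psi> \<phi> "DIM('a)", OF assms(1,2)] k(2) assms(3,4) by simp
  then have "ennreal (1 / k) * (ennreal k * emeasure lborel (\<psi> ` X)) \<le> ennreal (1 / k) * (ennreal (L ^ DIM('a)) * (ennreal k * emeasure lborel (\<phi> ` X)))"
    by (rule mult_left_mono) simp
  moreover have "ennreal (1 / k) * (ennreal k * z) = z" for z
    using k(1) by (simp add: mult.assoc[symmetric] ennreal_mult[symmetric])
  ultimately show ?thesis by (simp add: mult.left_commute)
qed

definition prism :: "'a::euclidean_space \<Rightarrow> 'a set \<Rightarrow> real \<Rightarrow> 'a set" where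
  "prism v F d = {y. y - (y \<bullet> v) *\<^sub>R v \<in> F \<and> 0 \<le> y \<bullet> v \<and> y \<bullet> v < d}"

lemma borel_prism [measurable]:
  assumes [measurable]: "F \<in> sets borel"
  shows "prism v F d \<in> sets borel"
  unfolding prism_def by measurable

text \<open>Over a fixed base, the volume above a Borel set of heights is a translation invariant measure on the
  line.\<close>

lemma emeasure_prism_height:
  fixes v :: "'a::euclidean_space"
  assumes v: "norm v = 1" and F[measurable]: "F \<in> sets borel" and bd: "bounded F" and d: "0 \<le> d"
  shows "emeasure lborel (prism v F d) = ennreal d * emeasure lborel (prism v F 1)"
proof -
  define G where "G = {y. y - (y \<bullet> v) *\<^sub>R v \<in> F}"
  have G[measurable]: "G \<in> sets borel" unfolding G_def by measurable
  define M where "M = distr (density lborel (indicator G)) borel (\<lambda>y. y \<bullet> v)"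
  have em: "emeasure M A = emeasure lborel {y \<in> G. y \<bullet> v \<in> A}" if [measurable]: "A \<in> sets borel" for A
  proof -
    have "emeasure M A = emeasure (density lborel (indicator G)) {y. y \<bullet> v \<in> A}"
      unfolding M_def using that by (subst emeasure_distr) (auto simp: vimage_def)
    also have "\<dots> = (\<integral>\<^sup>+y. indicator G y * indicator {y. y \<bullet> v \<in> A} y \<partial>lborel)"
      by (rule emeasure_density) measurable
    also have "\<dots> = (\<integral>\<^sup>+y. indicator {y \<in> G. y \<bullet> v \<in> A} y \<partial>lborel)"
      by (intro nn_integral_cong) (auto simp: indicator_def)
    also have "\<dots> = emeasure lborel {y \<in> G. y \<bullet> v \<in> A}"
      by (rule nn_integral_indicator) measurable
    finally show ?thesis .
  qed
  obtain B where B: "\<And>x. x \<in> F \<Longrightarrow> norm x \<le> B" using bd by (auto simp: bounded_iff)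
  have fin: "emeasure M (cball 0 r) < \<infinity>" for r
  proof -
    have "norm y \<le> B + r" if "y \<in> G" "\<bar>y \<bullet> v\<bar> \<le> r" for y
    proof -
      have "norm y \<le> norm (y - (y \<bullet> v) *\<^sub>R v) + norm ((y \<bullet> v) *\<^sub>R v)"
        by (metis diff_add_cancel norm_triangle_ineq)
      also have "\<dots> \<le> B + r" using B[of "y - (y \<bullet> v) *\<^sub>R v"] that v by (simp add: G_def)
      finally show ?thesis .
    qed
    then have "bounded {y \<in> G. y \<bullet> v \<in> cball 0 r}" by (auto simp: bounded_iff)
    then have "emeasure lborel {y \<in> G. y \<bullet> v \<in> cball 0 r} < \<infinity>" by (rule emeasure_bounded_finite)
    then show ?thesis using em[of "cball 0 r"] by simp
  qed
  have inv: "emeasure M {y. x + y \<in> A} = emeasure M A" if [measurable]: "A \<in> sets borel" for x A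
  proof -
    have S: "{y \<in> G. y \<bullet> v \<in> A} \<in> sets borel" by measurable
    have "v \<bullet> v = 1" using v by (simp add: norm_eq_1)
    then have "{y \<in> G. y \<bullet> v \<in> {y. x + y \<in> A}} = {y. x *\<^sub>R v + y \<in> {y \<in> G. y \<bullet> v \<in> A}}"
      by (auto simp: G_def inner_simps algebra_simps)
    moreover have "{y. x + y \<in> A} \<in> sets borel" by measurable
    ultimately show ?thesis
      using emeasure_lborel_translate[OF S, of "x *\<^sub>R v"] by (simp only: em that)
  qed
  have sf: "sigma_finite_measure M"
    by (rule sigma_finite_measure_if_finite_on_cballs) (use fin in \<open>auto simp: M_def\<close>)
  obtain c where c: "0 \<le> c" "\<And>A. A \<in> sets borel \<Longrightarrow> emeasure M A = ennreal c * emeasure lborel A"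
    using translation_invariant_measure_scale[OF sf _ inv fin[of 1]] by (auto simp: M_def)
  have pr: "emeasure lborel (prism v F t) = ennreal c * ennreal t" if "0 \<le> t" for t
  proof -
    have "prism v F t = {y \<in> G. y \<bullet> v \<in> {0..<t}}" by (auto simp: prism_def G_def)
    then have "emeasure lborel (prism v F t) = emeasure M {0..<t}" using em[of "{0..<t}"] by simp
    then show ?thesis using c(2)[of "{0..<t}"] that by simp
  qed
  show ?thesis using pr[OF d] pr[of 1] by (simp add: mult.commute)
qed

text \<open>The uniqueness argument for translation invariant measures, with translations restricted to the
  hyperplane: the indicator of \<open>x \<in> F\<close>, \<open>y - x \<in> G\<close>, where \<open>G\<close> is the prism over the unit disc, is integrated
  in both orders, and for fixed \<open>y\<close> the isometry \<open>x \<mapsto> \<pi> y - x\<close> of the hyperplane is used, \<open>\<pi>\<close> being the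
  orthogonal projection.\<close>

lemma hausdorff_outer_hyperplane_proportional:
  fixes v :: "'a::euclidean_space"
  assumes v: "norm v = 1" and F[measurable]: "F \<in> sets borel" and FP: "F \<subseteq> {x. x \<bullet> v = 0}"
    and fin: "\<And>k::nat. hausdorff_outer s ({x. x \<bullet> v = 0} \<inter> cball 0 (real k)) < \<infinity>"
  shows "hausdorff_outer s F * emeasure lborel (prism v ({x. x \<bullet> v = 0} \<inter> cball 0 1) 1)
       = hausdorff_outer s ({x. x \<bullet> v = 0} \<inter> cball 0 1) * emeasure lborel (prism v F 1)"
proof -
  have vv: "v \<bullet> v = 1" using v by (simp add: norm_eq_1)
  define P where "P = {x. x \<bullet> v = 0}"
  define B where "B = P \<inter> cball 0 1"
  define G where "G = prism v B 1"
  define \<pi> where "\<pi> y = y - (y \<bullet> v) *\<^sub>R v" for y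
  have P[measurable]: "P \<in> sets borel" unfolding P_def by measurable
  have [measurable]: "B \<in> sets borel" unfolding B_def by simp
  have [measurable]: "G \<in> sets borel" unfolding G_def by measurable
  have [measurable]: "\<pi> \<in> borel_measurable borel" unfolding \<pi>_def by measurable
  have \<pi>P: "\<pi> y \<in> P" for y using vv by (simp add: \<pi>_def P_def inner_simps)
  define N where "N = density (hausdorff_measure s :: 'a measure) (indicator P)"
  have setsN[measurable_cong]: "sets N = sets borel" by (simp add: N_def)
  have em: "emeasure N A = hausdorff_outer s (P \<inter> A)" if [measurable]: "A \<in> sets borel" for A
  proof -
    have "emeasure N A = (\<integral>\<^sup>+y. indicator P y * indicator A y \<partial>hausdorff_measure s)"
      unfolding N_def by (rule emeasure_density) auto
    also have "\<dots> = (\<integral>\<^sup>+y. indicator (P \<inter> A) y \<partial>hausdorff_measure s)"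
      by (intro nn_integral_cong) (auto simp: indicator_def)
    also have "\<dots> = hausdorff_outer s (P \<inter> A)" by (simp add: emeasure_hausdorff_measure)
    finally show ?thesis .
  qed
  have AEP: "AE x in N. x \<in> P" unfolding N_def by (subst AE_density) (auto simp: indicator_def)
  have flip: "emeasure N {x. p - x \<in> A} = emeasure N A" if [measurable]: "A \<in> sets borel" and p: "p \<in> P" for p A
  proof -
    have "P \<inter> {x. p - x \<in> A} = (\<lambda>x. p - x) ` (P \<inter> A)"
    proof (intro equalityI subsetI)
      fix x assume "x \<in> P \<inter> {x. p - x \<in> A}"
      then show "x \<in> (\<lambda>x. p - x) ` (P \<inter> A)"
        using p by (intro image_eqI[of _ _ "p - x"]) (auto simp: P_def inner_simps)
    qed (use p in \<open>auto simp: P_def inner_simps\<close>)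
    moreover have "{x. p - x \<in> A} \<in> sets borel" by measurable
    moreover have "hausdorff_outer s ((\<lambda>x. p - x) ` (P \<inter> A)) = hausdorff_outer s (P \<inter> A)"
      by (rule hausdorff_outer_isometric_image) (simp add: dist_norm norm_minus_commute)
    ultimately show ?thesis by (simp only: em that)
  qed
  have sf: "sigma_finite_measure N"
    by (rule sigma_finite_measure_if_finite_on_cballs) (use fin in \<open>auto simp: setsN em P_def\<close>)
  interpret N: sigma_finite_measure N by (rule sf)
  interpret Q: pair_sigma_finite N "lborel :: 'a measure" ..
  have emN: "(\<integral>\<^sup>+x. indicator S x \<partial>N) = emeasure N S" if "S \<in> sets borel" for S
    using that by (simp add: setsN)
  have "emeasure N F * emeasure lborel G = (\<integral>\<^sup>+x. indicator F x * emeasure lborel G \<partial>N)"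
    by (subst nn_integral_multc) (simp_all add: emN)
  also have "\<dots> = (\<integral>\<^sup>+x. (\<integral>\<^sup>+y. indicator F x * indicator G (y - x) \<partial>lborel) \<partial>N)"
  proof (rule nn_integral_cong)
    fix x
    have "(\<integral>\<^sup>+y. indicator G (y - x) \<partial>lborel) = (\<integral>\<^sup>+y. indicator {y. -x + y \<in> G} y \<partial>lborel)"
      by (intro nn_integral_cong) (auto simp: indicator_def algebra_simps)
    also have "\<dots> = emeasure lborel {y. -x + y \<in> G}"
      by (intro nn_integral_indicator) measurable
    also have "\<dots> = emeasure lborel G"
      by (intro emeasure_lborel_translate) auto
    finally have "(\<integral>\<^sup>+y. indicator G (y - x) \<partial>lborel) = emeasure lborel G" .
    moreover have "(\<integral>\<^sup>+y. indicator F x * indicator G (y - x) \<partial>lborel) = indicator F x * (\<integral>\<^sup>+y. indicator G (y - x) \<partial>lborel)"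
      by (rule nn_integral_cmult) measurable
    ultimately show "indicator F x * emeasure lborel G = (\<integral>\<^sup>+y. indicator F x * indicator G (y - x) \<partial>lborel)"
      by simp
  qed
  also have "\<dots> = (\<integral>\<^sup>+y. (\<integral>\<^sup>+x. indicator F x * indicator G (y - x) \<partial>N) \<partial>lborel)"
    by (rule Q.Fubini'[symmetric]) measurable
  also have "\<dots> = (\<integral>\<^sup>+y. (\<integral>\<^sup>+x. indicator F (\<pi> y - x) * indicator G (y - \<pi> y + x) \<partial>N) \<partial>lborel)"
  proof (rule nn_integral_cong)
    fix y
    have S: "{x. x \<in> F \<and> y - x \<in> G} \<in> sets borel" by measurable
    have T: "{x. \<pi> y - x \<in> {x. x \<in> F \<and> y - x \<in> G}} \<in> sets borel" by measurable
    have "(\<integral>\<^sup>+x. indicator F x * indicator G (y - x) \<partial>N) = (\<integral>\<^sup>+x. indicator {x. x \<in> F \<and> y - x \<in> G} x \<partial>N)"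
      by (intro nn_integral_cong) (auto simp: indicator_def)
    also have "\<dots> = emeasure N {x. \<pi> y - x \<in> {x. x \<in> F \<and> y - x \<in> G}}"
      using S by (simp only: emN flip[OF _ \<pi>P])
    also have "\<dots> = (\<integral>\<^sup>+x. indicator {x. \<pi> y - x \<in> {x. x \<in> F \<and> y - x \<in> G}} x \<partial>N)"
      using T by (simp only: emN)
    also have "\<dots> = (\<integral>\<^sup>+x. indicator F (\<pi> y - x) * indicator G (y - \<pi> y + x) \<partial>N)"
      by (intro nn_integral_cong) (auto simp: indicator_def algebra_simps)
    finally show "(\<integral>\<^sup>+x. indicator F x * indicator G (y - x) \<partial>N) = (\<integral>\<^sup>+x. indicator F (\<pi> y - x) * indicator G (y - \<pi> y + x) \<partial>N)" .
  qed
  also have "\<dots> = (\<integral>\<^sup>+x. (\<integral>\<^sup>+y. indicator F (\<pi> y - x) * indicator G (y - \<pi> y + x) \<partial>lborel) \<partial>N)"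
    by (rule Q.Fubini') measurable
  also have "\<dots> = (\<integral>\<^sup>+x. indicator B x * emeasure lborel (prism v F 1) \<partial>N)"
  proof (rule nn_integral_cong_AE, rule AE_mp[OF AEP], rule AE_I2, rule impI)
    fix x assume x: "x \<in> P"
    have G: "y - \<pi> y + x \<in> G \<longleftrightarrow> x \<in> B \<and> 0 \<le> y \<bullet> v \<and> y \<bullet> v < 1" for y
      using x vv by (simp add: G_def prism_def \<pi>_def P_def inner_simps)
    have S: "prism v F 1 \<in> sets borel" by measurable
    have "(\<integral>\<^sup>+y. indicator F (\<pi> y - x) * indicator G (y - \<pi> y + x) \<partial>lborel)
        = (\<integral>\<^sup>+y. indicator B x * indicator {y. - x + y \<in> prism v F 1} y \<partial>lborel)"
    proof (rule nn_integral_cong)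
      fix y
      have "- x + y \<in> prism v F 1 \<longleftrightarrow> \<pi> y - x \<in> F \<and> 0 \<le> y \<bullet> v \<and> y \<bullet> v < 1"
        using x by (simp add: prism_def \<pi>_def P_def inner_simps algebra_simps)
      then show "indicator F (\<pi> y - x) * indicator G (y - \<pi> y + x)
        = (indicator B x * indicator {y. - x + y \<in> prism v F 1} y :: ennreal)"
        using G[of y] by (auto simp: indicator_def)
    qed
    also have "\<dots> = indicator B x * (\<integral>\<^sup>+y. indicator {y. - x + y \<in> prism v F 1} y \<partial>lborel)"
      by (rule nn_integral_cmult) measurable
    also have "(\<integral>\<^sup>+y. indicator {y. - x + y \<in> prism v F 1} y \<partial>lborel) = emeasure lborel {y. - x + y \<in> prism v F 1}"
      by (rule nn_integral_indicator) measurable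
    also have "\<dots> = emeasure lborel (prism v F 1)" by (rule emeasure_lborel_translate[OF S])
    finally show "(\<integral>\<^sup>+y. indicator F (\<pi> y - x) * indicator G (y - \<pi> y + x) \<partial>lborel)
      = indicator B x * emeasure lborel (prism v F 1)" .
  qed
  also have "\<dots> = emeasure N B * emeasure lborel (prism v F 1)"
    by (subst nn_integral_multc) (simp_all add: emN)
  also have "emeasure N F = hausdorff_outer s F" using FP by (simp add: em P_def Int_absorb1)
  also have "emeasure N B = hausdorff_outer s B" by (simp add: em B_def)
  finally show ?thesis by (simp only: G_def B_def P_def)
qed

text \<open>The factor of the preceding lemma is the quotient of the two measures of the unit disc. It is finite
  and positive for a coordinate hyperplane, and reflections transport it to all others.\<close>

lemma hausdorff_outer_hyperplane:
  obtains k where "0 < k"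
    "\<And>v F :: 'a::euclidean_space set. norm v = 1 \<Longrightarrow> F \<in> sets borel \<Longrightarrow> F \<subseteq> {x. x \<bullet> v = 0} \<Longrightarrow>
       hausdorff_outer (DIM('a) - 1) F = ennreal k * emeasure lborel (prism v F 1)"
proof -
  obtain b :: 'a where b: "b \<in> Basis" using nonempty_Basis by blast
  let ?n = "DIM('a) - 1"
  define I where "I = Basis - {b}"
  have I: "I \<subseteq> Basis" "card I = ?n" using b by (auto simp: I_def)
  define P where "P v = {x. x \<bullet> v = 0}" for v :: 'a
  have Pb: "{x. \<forall>c\<in>Basis - I. x \<bullet> c = 0} = P b" using b by (auto simp: I_def P_def)
  have Pborel[measurable]: "P v \<in> sets borel" for v unfolding P_def by measurable
  have norm_b: "norm b = 1" using b by simp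
  have finb: "hausdorff_outer ?n (P b \<inter> cball 0 (real k)) < \<infinity>" for k :: nat
    using hausdorff_outer_bounded_finite[OF I(1), of k] by (simp only: Pb I(2))
  \<comment> \<open>the reflection exchanging \<open>b\<close> and \<open>v\<close> carries one hyperplane to the other\<close>
  have P_reflect: "reflect (b - v) ` (P b \<inter> cball 0 r) = P v \<inter> cball 0 r"
    and reflect_P: "{x. reflect (b - v) x \<in> prism b (P b \<inter> cball 0 r) 1} = prism v (P v \<inter> cball 0 r) 1"
    if v: "norm v = 1" for v r
  proof -
    let ?R = "reflect (b - v)"
    have Rb: "?R b = v" using reflect_swap[of b v] v norm_b by simp
    then have Rv: "?R v = b" by (metis reflect_reflect)
    have ip: "?R x \<bullet> b = x \<bullet> v" for x using inner_reflect_reflect[of "b - v" x v] by (simp add: Rv)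
    have ip': "?R x \<bullet> v = x \<bullet> b" for x using inner_reflect_reflect[of "b - v" x b] by (simp add: Rb)
    show "?R ` (P b \<inter> cball 0 r) = P v \<inter> cball 0 r"
    proof (intro equalityI subsetI)
      fix x assume "x \<in> P v \<inter> cball 0 r"
      then show "x \<in> ?R ` (P b \<inter> cball 0 r)"
        by (intro image_eqI[of _ _ "?R x"]) (auto simp: P_def ip)
    qed (auto simp: P_def ip')
    have "?R x - (?R x \<bullet> b) *\<^sub>R b = ?R (x - (x \<bullet> v) *\<^sub>R v)" for x
      by (simp add: ip linear_diff[OF linear_reflect] linear_scale[OF linear_reflect] Rv)
    then show "{x. ?R x \<in> prism b (P b \<inter> cball 0 r) 1} = prism v (P v \<inter> cball 0 r) 1"
      by (simp add: prism_def ip P_def)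
  qed
  have same: "hausdorff_outer ?n (P v \<inter> cball 0 r) = hausdorff_outer ?n (P b \<inter> cball 0 r)"
    "emeasure lborel (prism v (P v \<inter> cball 0 r) 1) = emeasure lborel (prism b (P b \<inter> cball 0 r) 1)"
    if v: "norm v = 1" for v r
  proof -
    show "hausdorff_outer ?n (P v \<inter> cball 0 r) = hausdorff_outer ?n (P b \<inter> cball 0 r)"
      unfolding P_reflect[OF v, symmetric] by (rule hausdorff_outer_isometric_image) simp
    have "prism b (P b \<inter> cball 0 r) 1 \<in> sets borel" by measurable auto
    then show "emeasure lborel (prism v (P v \<inter> cball 0 r) 1) = emeasure lborel (prism b (P b \<inter> cball 0 r) 1)"
      unfolding reflect_P[OF v, symmetric] by (rule emeasure_lborel_reflect)
  qed
  define H where "H = enn2real (hausdorff_outer ?n (P b \<inter> cball 0 1))"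
  define V where "V = enn2real (emeasure lborel (prism b (P b \<inter> cball 0 1) 1))"
  have H: "hausdorff_outer ?n (P b \<inter> cball 0 1) = ennreal H" "0 \<le> H"
    using finb[of 1] by (auto simp: H_def less_top)
  have prism_bounded: "bounded (prism b (P b \<inter> cball 0 1) 1)"
  proof -
    have "norm y \<le> 2" if y: "y \<in> prism b (P b \<inter> cball 0 1) 1" for y
    proof -
      have "norm y \<le> norm (y - (y \<bullet> b) *\<^sub>R b) + norm ((y \<bullet> b) *\<^sub>R b)"
        by (metis diff_add_cancel norm_triangle_ineq)
      then show ?thesis using y norm_b by (simp add: prism_def)
    qed
    then show ?thesis by (auto simp: bounded_iff)
  qed
  have V: "emeasure lborel (prism b (P b \<inter> cball 0 1) 1) = ennreal V" "0 \<le> V"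
    using emeasure_bounded_finite[OF prism_bounded] by (auto simp: V_def less_top)
  have "ball (b /\<^sub>R 2) (1/2) \<subseteq> prism b (P b \<inter> cball 0 1) 1"
  proof
    fix y assume y: "y \<in> ball (b /\<^sub>R 2) (1/2)"
    have bb: "b \<bullet> b = 1" using b by (simp add: inner_Basis)
    have n: "norm (y - b /\<^sub>R 2) < 1/2" using y by (simp add: dist_norm norm_minus_commute)
    have "\<bar>(y - b /\<^sub>R 2) \<bullet> b\<bar> < 1/2" using Basis_le_norm[OF b, of "y - b /\<^sub>R 2"] n by linarith
    then have "\<bar>y \<bullet> b - 1/2\<bar> < 1/2" by (simp add: inner_diff_left bb)
    then have yb: "0 < y \<bullet> b" "y \<bullet> b < 1" by linarith+
    have "y - (y \<bullet> b) *\<^sub>R b = (y - b /\<^sub>R 2) - (y \<bullet> b - 1/2) *\<^sub>R b" by (simp add: algebra_simps)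
    also have "norm \<dots> \<le> norm (y - b /\<^sub>R 2) + norm ((y \<bullet> b - 1/2) *\<^sub>R b)" by (rule norm_triangle_ineq4)
    also have "\<dots> \<le> 1" using n \<open>\<bar>y \<bullet> b - 1/2\<bar> < 1/2\<close> norm_b by simp
    finally show "y \<in> prism b (P b \<inter> cball 0 1) 1"
      using yb bb by (simp add: prism_def P_def inner_diff_left)
  qed
  then have "emeasure lborel (ball (b /\<^sub>R 2) (1/2)) \<le> ennreal V"
    unfolding V(1)[symmetric] by (intro emeasure_mono) auto
  moreover have "0 < emeasure lborel (ball (b /\<^sub>R 2) (1/2))"
    by (simp add: emeasure_ball)
  ultimately have V0: "0 < V" using V(2) by (metis ennreal_0 le_less leD)
  have "ennreal V \<le> ennreal (4 ^ card I * 3 ^ (DIM('a) - card I) / unit_ball_vol (real (card I))) * hausdorff_outer (card I) (P b \<inter> cball 0 1)"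
    unfolding V(1)[symmetric]
  proof (rule emeasure_thickening_le_hausdorff_outer[OF I(1)])
    fix y assume y: "y \<in> prism b (P b \<inter> cball 0 1) 1"
    show "\<exists>x\<in>P b \<inter> cball 0 1. (\<forall>b\<in>I. y \<bullet> b = x \<bullet> b) \<and> (\<forall>b\<in>Basis - I. 0 \<le> y \<bullet> b - x \<bullet> b \<and> y \<bullet> b - x \<bullet> b \<le> 1)"
    proof (intro bexI[of _ "y - (y \<bullet> b) *\<^sub>R b"] conjI ballI)
      show "y - (y \<bullet> b) *\<^sub>R b \<in> P b \<inter> cball 0 1" using y by (simp add: prism_def)
      show "y \<bullet> c = (y - (y \<bullet> b) *\<^sub>R b) \<bullet> c" if "c \<in> I" for c
        using that b by (auto simp: I_def inner_diff_left inner_Basis)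
      fix c assume "c \<in> Basis - I"
      then have "c = b" by (auto simp: I_def)
      then show "0 \<le> y \<bullet> c - (y - (y \<bullet> b) *\<^sub>R b) \<bullet> c" "y \<bullet> c - (y - (y \<bullet> b) *\<^sub>R b) \<bullet> c \<le> 1"
        using y b by (simp_all add: prism_def inner_diff_left inner_Basis)
    qed
  qed auto
  moreover have "hausdorff_outer (card I) (P b \<inter> cball 0 1) = ennreal H" using H(1) by (simp only: I(2))
  ultimately have "H \<noteq> 0" using V0 by auto
  then have H0: "0 < H" using H(2) by simp
  show thesis
  proof (rule that[of "H / V"])
    fix v :: 'a and F :: "'a set"
    assume v: "norm v = 1" and F: "F \<in> sets borel" and FP: "F \<subseteq> {x. x \<bullet> v = 0}"
    have fin: "hausdorff_outer ?n ({x. x \<bullet> v = 0} \<inter> cball 0 (real k)) < \<infinity>" for k :: nat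
      using finb[of k] same(1)[OF v, of "real k"] by (simp only: P_def)
    have eq: "hausdorff_outer ?n F * ennreal V = ennreal H * emeasure lborel (prism v F 1)"
      using hausdorff_outer_hyperplane_proportional[OF v F FP fin, folded P_def]
      by (simp only: same[OF v] H(1) V(1))
    have "hausdorff_outer ?n F = hausdorff_outer ?n F * ennreal V * ennreal (1 / V)"
      using V0 by (simp add: mult.assoc ennreal_mult[symmetric])
    also have "\<dots> = ennreal H * emeasure lborel (prism v F 1) * ennreal (1 / V)"
      unfolding eq ..
    also have "\<dots> = (ennreal H * ennreal (1 / V)) * emeasure lborel (prism v F 1)"
      by (simp only: mult_ac)
    also have "ennreal H * ennreal (1 / V) = ennreal (H / V)"
      using V0 H0 by (simp add: ennreal_mult[symmetric])
    finally show "hausdorff_outer ?n F = ennreal (H / V) * emeasure lborel (prism v F 1)" .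
  qed (use H0 V0 in simp)
qed

section \<open>Wulff shapes, gauges and support functions\<close>

definition positive_on_sphere :: "('a::euclidean_space \<Rightarrow> real) \<Rightarrow> bool" where
  "positive_on_sphere g \<longleftrightarrow> continuous_on (sphere 0 1) g \<and> (\<forall>v\<in>sphere 0 1. 0 < g v)"

definition wulff :: "('a::euclidean_space \<Rightarrow> real) \<Rightarrow> 'a set" where
  "wulff g = {x. \<forall>v\<in>sphere 0 1. x \<bullet> v \<le> g v}"

text \<open>The Minkowski functional of the Wulff shape, written as a maximum over the constraints so that the
  maximising \<open>v\<close> are available as normals.\<close>

definition wulff_gauge :: "('a::euclidean_space \<Rightarrow> real) \<Rightarrow> 'a \<Rightarrow> real" where
  "wulff_gauge g y = (SUP v\<in>sphere 0 1. y \<bullet> v / g v)"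

lemma sphere_nonempty: "sphere (0::'a::euclidean_space) 1 \<noteq> {}"
  by simp

lemma wulff_gauge_upper:
  assumes g: "positive_on_sphere g" and v: "v \<in> sphere 0 1"
  shows "y \<bullet> v / g v \<le> wulff_gauge g y"
proof -
  have "continuous_on (sphere 0 1) (\<lambda>v. y \<bullet> v / g v)"
    using g by (intro continuous_intros) (auto simp: positive_on_sphere_def)
  then have "bdd_above ((\<lambda>v. y \<bullet> v / g v) ` sphere 0 1)"
    by (intro bounded_imp_bdd_above compact_imp_bounded compact_continuous_image) auto
  then show ?thesis unfolding wulff_gauge_def using v by (rule cSUP_upper2) simp
qed

lemma wulff_gauge_attained:
  assumes g: "positive_on_sphere g"
  obtains v where "v \<in> sphere 0 1" "wulff_gauge g y = y \<bullet> v / g v"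
proof -
  have "continuous_on (sphere 0 1) (\<lambda>v. y \<bullet> v / g v)"
    using g by (intro continuous_intros) (auto simp: positive_on_sphere_def)
  then obtain v where v: "v \<in> sphere 0 1" "\<forall>w\<in>sphere 0 1. y \<bullet> w / g w \<le> y \<bullet> v / g v"
    using continuous_attains_sup[OF compact_sphere sphere_nonempty] by blast
  have "wulff_gauge g y \<le> y \<bullet> v / g v"
    unfolding wulff_gauge_def using v by (intro cSUP_least sphere_nonempty) auto
  then show thesis using that v(1) wulff_gauge_upper[OF g v(1), of y] by (meson order_antisym)
qed

lemma wulff_gauge_scale:
  assumes g: "positive_on_sphere g" and t: "0 \<le> t"
  shows "wulff_gauge g (t *\<^sub>R y) = t * wulff_gauge g y"
proof -
  obtain v where v: "v \<in> sphere 0 1" "wulff_gauge g y = y \<bullet> v / g v" using wulff_gauge_attained[OF g] .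
  obtain w where w: "w \<in> sphere 0 1" "wulff_gauge g (t *\<^sub>R y) = (t *\<^sub>R y) \<bullet> w / g w" using wulff_gauge_attained[OF g] .
  have "t * (y \<bullet> w / g w) \<le> t * wulff_gauge g y"
    using wulff_gauge_upper[OF g w(1), of y] t by (rule mult_left_mono)
  moreover have "t * (y \<bullet> v / g v) \<le> wulff_gauge g (t *\<^sub>R y)"
    using wulff_gauge_upper[OF g v(1), of "t *\<^sub>R y"] by simp
  ultimately show ?thesis using v w by simp
qed

lemma wulff_gauge_triangle:
  assumes g: "positive_on_sphere g"
  shows "wulff_gauge g (x + y) \<le> wulff_gauge g x + wulff_gauge g y"
proof -
  obtain v where v: "v \<in> sphere 0 1" "wulff_gauge g (x + y) = (x + y) \<bullet> v / g v" using wulff_gauge_attained[OF g] .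
  show ?thesis using wulff_gauge_upper[OF g v(1), of x] wulff_gauge_upper[OF g v(1), of y] v(2)
    by (simp add: inner_add_left add_divide_distrib)
qed

lemma mem_wulff_iff_gauge_le_1:
  assumes g: "positive_on_sphere g"
  shows "y \<in> wulff g \<longleftrightarrow> wulff_gauge g y \<le> 1"
proof
  assume y: "y \<in> wulff g"
  obtain v where v: "v \<in> sphere 0 1" "wulff_gauge g y = y \<bullet> v / g v" using wulff_gauge_attained[OF g] .
  then show "wulff_gauge g y \<le> 1" using y g by (auto simp: wulff_def positive_on_sphere_def)
next
  assume y: "wulff_gauge g y \<le> 1"
  have "y \<bullet> v \<le> g v" if "v \<in> sphere 0 1" for v
    using wulff_gauge_upper[OF g that, of y] y g that
    by (smt (verit) divide_le_eq_1_pos positive_on_sphere_def)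
  then show "y \<in> wulff g" by (simp add: wulff_def)
qed

lemma positive_on_sphere_bounds:
  assumes g: "positive_on_sphere g"
  obtains m M where "0 < m" "m \<le> M" "\<And>v. v \<in> sphere 0 1 \<Longrightarrow> m \<le> g v \<and> g v \<le> M"
proof -
  have c: "continuous_on (sphere 0 1) g" using g by (simp add: positive_on_sphere_def)
  obtain v where v: "v \<in> sphere 0 1" "\<forall>w\<in>sphere 0 1. g w \<le> g v"
    using continuous_attains_sup[OF compact_sphere sphere_nonempty c] by blast
  obtain w where w: "w \<in> sphere 0 1" "\<forall>v\<in>sphere 0 1. g w \<le> g v"
    using continuous_attains_inf[OF compact_sphere sphere_nonempty c] by blast
  show thesis using that[of "g w" "g v"] v w g by (auto simp: positive_on_sphere_def)
qed

lemma wulff_gauge_le_norm: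
  assumes g: "positive_on_sphere g" and m: "0 < m" "\<And>v. v \<in> sphere 0 1 \<Longrightarrow> m \<le> g v"
  shows "wulff_gauge g y \<le> norm y / m"
proof -
  obtain v where v: "v \<in> sphere 0 1" "wulff_gauge g y = y \<bullet> v / g v" using wulff_gauge_attained[OF g] .
  have "y \<bullet> v \<le> norm y" using norm_cauchy_schwarz[of y v] v(1) by simp
  then show ?thesis unfolding v(2) using m(1) m(2)[OF v(1)] by (intro frac_le) auto
qed

lemma norm_le_wulff_gauge:
  assumes g: "positive_on_sphere g" and M: "\<And>v. v \<in> sphere 0 1 \<Longrightarrow> g v \<le> M"
  shows "norm y \<le> M * wulff_gauge g y"
proof (cases "y = 0")
  case True
  obtain v where v: "v \<in> sphere 0 1" "wulff_gauge g y = y \<bullet> v / g v" using wulff_gauge_attained[OF g] .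
  then show ?thesis using True by simp
next
  case False
  define v where "v = y /\<^sub>R norm y"
  have v: "v \<in> sphere 0 1" using False by (simp add: v_def)
  have yv: "y \<bullet> v = norm y" using False by (simp add: v_def dot_square_norm power2_eq_square)
  have gv: "0 < g v" using g v by (simp add: positive_on_sphere_def)
  have le: "norm y / g v \<le> wulff_gauge g y" using wulff_gauge_upper[OF g v, of y] yv by simp
  then have "0 \<le> wulff_gauge g y" using gv by (smt (verit) divide_nonneg_pos norm_ge_zero)
  have "norm y \<le> g v * wulff_gauge g y" using le gv by (simp add: pos_divide_le_eq mult.commute)
  also have "\<dots> \<le> M * wulff_gauge g y" using M[OF v] \<open>0 \<le> wulff_gauge g y\<close> by (rule mult_right_mono)
  finally show ?thesis .
qed

lemma wulff_gauge_pos: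
  assumes g: "positive_on_sphere g" and "y \<noteq> 0"
  shows "0 < wulff_gauge g y"
proof -
  obtain m M where mM: "0 < m" "m \<le> M" "\<And>v. v \<in> sphere 0 1 \<Longrightarrow> m \<le> g v \<and> g v \<le> M"
    using positive_on_sphere_bounds[OF g] by blast
  have "0 < M * wulff_gauge g y" using norm_le_wulff_gauge[OF g, of M y] mM assms(2)
    by (smt (verit) zero_less_norm_iff)
  then show ?thesis using mM by (simp add: zero_less_mult_iff)
qed

lemma wulff_gauge_zero [simp]: "positive_on_sphere g \<Longrightarrow> wulff_gauge g 0 = 0"
  using wulff_gauge_scale[of g 0 0] by simp

lemma continuous_on_wulff_gauge:
  assumes g: "positive_on_sphere g"
  shows "continuous_on A (wulff_gauge g)"
proof -
  obtain m M where mM: "0 < m" "m \<le> M" "\<And>v. v \<in> sphere 0 1 \<Longrightarrow> m \<le> g v \<and> g v \<le> M"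
    using positive_on_sphere_bounds[OF g] by blast
  have le: "wulff_gauge g x - wulff_gauge g y \<le> (1 / m) * dist x y" for x y
    using wulff_gauge_triangle[OF g, of "x - y" y] wulff_gauge_le_norm[OF g mM(1), of "x - y"] mM(3)
    by (simp add: dist_norm)
  have "(1 / m)-lipschitz_on A (wulff_gauge g)"
  proof (rule lipschitz_onI)
    show "dist (wulff_gauge g x) (wulff_gauge g y) \<le> 1 / m * dist x y" for x y
      using le[of x y] le[of y x] by (simp add: dist_real_def abs_le_iff dist_commute)
  qed (use mM(1) in simp)
  then show ?thesis by (rule lipschitz_on_continuous_on)
qed

lemma borel_measurable_wulff_gauge:
  assumes "positive_on_sphere g"
  shows "wulff_gauge g \<in> borel_measurable borel"
  by (intro borel_measurable_continuous_onI continuous_on_wulff_gauge assms)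

lemma wulff_body:
  assumes g: "positive_on_sphere g"
  shows "compact (wulff g)" "convex (wulff g)" "0 \<in> interior (wulff g)"
proof -
  obtain m M where mM: "0 < m" "m \<le> M" "\<And>v. v \<in> sphere 0 1 \<Longrightarrow> m \<le> g v \<and> g v \<le> M"
    using positive_on_sphere_bounds[OF g] by blast
  have w: "wulff g = (\<Inter>v\<in>sphere 0 1. {x. v \<bullet> x \<le> g v})" by (auto simp: wulff_def inner_commute)
  have "closed (wulff g)" unfolding w by (intro closed_INT ballI closed_halfspace_le)
  moreover have "bounded (wulff g)"
  proof -
    have "norm y \<le> M" if "y \<in> wulff g" for y
    proof -
      have "norm y \<le> M * wulff_gauge g y" using norm_le_wulff_gauge[OF g] mM(3) by blast
      also have "\<dots> \<le> M * 1" using that mM by (intro mult_left_mono) (auto simp: mem_wulff_iff_gauge_le_1[OF g])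
      finally show ?thesis by simp
    qed
    then show ?thesis by (auto simp: bounded_iff)
  qed
  ultimately show "compact (wulff g)" by (simp add: compact_eq_bounded_closed)
  show "convex (wulff g)" unfolding w by (intro convex_INT ballI convex_halfspace_le)
  have "ball 0 m \<subseteq> wulff g"
  proof
    fix y :: 'a assume "y \<in> ball 0 m"
    then have "norm y / m < 1" using mM(1) by simp
    then have "wulff_gauge g y \<le> 1" using wulff_gauge_le_norm[OF g mM(1), of y] mM(3) by fastforce
    then show "y \<in> wulff g" by (simp add: mem_wulff_iff_gauge_le_1[OF g])
  qed
  then show "0 \<in> interior (wulff g)" using mM(1) by (meson centre_in_ball interiorI open_ball)
qed

definition support_fun :: "'a::euclidean_space set \<Rightarrow> 'a \<Rightarrow> real" where
  "support_fun K v = (SUP x\<in>K. x \<bullet> v)"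

lemma support_fun_upper:
  assumes "compact K" "x \<in> K"
  shows "x \<bullet> v \<le> support_fun K v"
proof -
  have "bdd_above ((\<lambda>x. x \<bullet> v) ` K)"
    using assms(1) by (intro bounded_imp_bdd_above compact_imp_bounded compact_continuous_image continuous_intros) auto
  then show ?thesis unfolding support_fun_def using assms(2) by (rule cSUP_upper2) simp
qed

lemma support_fun_attained:
  assumes "compact K" "K \<noteq> {}"
  obtains x where "x \<in> K" "support_fun K v = x \<bullet> v"
proof -
  have "continuous_on K (\<lambda>x. x \<bullet> v)" by (intro continuous_intros)
  then obtain x where x: "x \<in> K" "\<forall>y\<in>K. y \<bullet> v \<le> x \<bullet> v"
    using continuous_attains_sup[OF assms] by blast
  have "support_fun K v \<le> x \<bullet> v" unfolding support_fun_def using x assms(2) by (intro cSUP_least) auto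
  then show thesis using that x(1) support_fun_upper[OF assms(1) x(1), of v] by (meson order_antisym)
qed

lemma support_fun_Lipschitz:
  assumes K: "compact K" "K \<noteq> {}" and R: "\<And>x. x \<in> K \<Longrightarrow> norm x \<le> R"
  shows "\<bar>support_fun K v - support_fun K w\<bar> \<le> R * norm (v - w)"
proof -
  have "support_fun K v - support_fun K w \<le> R * norm (v - w)" for v w
  proof -
    obtain x where x: "x \<in> K" "support_fun K v = x \<bullet> v" using support_fun_attained[OF K] .
    have "support_fun K v - support_fun K w \<le> x \<bullet> (v - w)"
      using support_fun_upper[OF K(1) x(1), of w] x(2) by (simp add: inner_diff_right)
    also have "\<dots> \<le> norm x * norm (v - w)" by (rule norm_cauchy_schwarz)
    also have "\<dots> \<le> R * norm (v - w)" using R[OF x(1)] by (rule mult_right_mono) simp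
    finally show ?thesis .
  qed
  from this[of v w] this[of w v] show ?thesis by (simp add: abs_le_iff norm_minus_commute)
qed

lemma continuous_on_support_fun:
  assumes K: "compact K" "K \<noteq> {}"
  shows "continuous_on A (support_fun K)"
proof -
  obtain R where R: "\<And>x. x \<in> K \<Longrightarrow> norm x \<le> R" using compact_imp_bounded[OF K(1)] by (auto simp: bounded_iff)
  have "R-lipschitz_on A (support_fun K)"
  proof (rule lipschitz_onI)
    show "0 \<le> R" using R K(2) by (meson all_not_in_conv norm_ge_zero order_trans)
  qed (use support_fun_Lipschitz[OF K R] in \<open>auto simp: dist_norm\<close>)
  then show ?thesis by (rule lipschitz_on_continuous_on)
qed

lemma support_fun_wulff:
  assumes g: "positive_on_sphere g"
  shows "positive_on_sphere (support_fun (wulff g))"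
    and "\<And>v. v \<in> sphere 0 1 \<Longrightarrow> support_fun (wulff g) v \<le> g v"
    and "wulff (support_fun (wulff g)) = wulff g"
proof -
  have K: "compact (wulff g)" "wulff g \<noteq> {}" "0 \<in> interior (wulff g)"
    using wulff_body[OF g] interior_subset by blast+
  show le: "support_fun (wulff g) v \<le> g v" if "v \<in> sphere 0 1" for v
  proof -
    obtain x where "x \<in> wulff g" "support_fun (wulff g) v = x \<bullet> v" using support_fun_attained[OF K(1,2)] .
    then show ?thesis using that by (simp add: wulff_def)
  qed
  have pos: "0 < support_fun (wulff g) v" if v: "v \<in> sphere 0 1" for v
  proof -
    obtain e where e: "0 < e" "cball 0 e \<subseteq> wulff g" using K(3) mem_interior_cball by blast
    have "e *\<^sub>R v \<in> wulff g" using e v by auto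
    from support_fun_upper[OF K(1) this, of v] show ?thesis using e(1) v by (simp add: dot_square_norm)
  qed
  show "positive_on_sphere (support_fun (wulff g))"
    using pos continuous_on_support_fun[OF K(1,2)] by (simp add: positive_on_sphere_def)
  show "wulff (support_fun (wulff g)) = wulff g"
  proof (intro equalityI subsetI)
    fix x assume x: "x \<in> wulff (support_fun (wulff g))"
    show "x \<in> wulff g" unfolding wulff_def
    proof (intro CollectI ballI)
      fix v :: 'a assume v: "v \<in> sphere 0 1"
      then have "x \<bullet> v \<le> support_fun (wulff g) v" using x by (simp add: wulff_def)
      then show "x \<bullet> v \<le> g v" using le[OF v] by linarith
    qed
  next
    fix x assume x: "x \<in> wulff g"
    show "x \<in> wulff (support_fun (wulff g))" unfolding wulff_def[of "support_fun (wulff g)"]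
      using support_fun_upper[OF K(1) x] by blast
  qed
qed

text \<open>All constraints are active, so \<open>h\<close> is the support function of its Wulff shape. This makes the
  maximisers in the gauge at a boundary point exactly its outer unit normals.\<close>

locale supported_wulff =
  fixes h :: "'a::euclidean_space \<Rightarrow> real"
  assumes pos: "positive_on_sphere h"
    and touching: "\<And>v. v \<in> sphere 0 1 \<Longrightarrow> \<exists>x\<in>wulff h. x \<bullet> v = h v"
begin

abbreviation K where "K \<equiv> wulff h"
abbreviation N where "N \<equiv> wulff_gauge h"
abbreviation \<nu> where "\<nu> \<equiv> gauss_map K"

definition radial :: "'a \<Rightarrow> 'a" where "radial y = y /\<^sub>R N y"

definition regular :: "'a set" where "regular = {x \<in> frontier K. \<exists>!v. outer_unit_normal K x v}"

lemmas N_upper = wulff_gauge_upper[OF pos]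
lemmas N_scale = wulff_gauge_scale[OF pos]
lemmas N_pos = wulff_gauge_pos[OF pos]
lemmas mem_K = mem_wulff_iff_gauge_le_1[OF pos]
lemmas continuous_N = continuous_on_wulff_gauge[OF pos]
lemmas N_measurable [measurable] = borel_measurable_wulff_gauge[OF pos]
lemmas compact_K = wulff_body(1)[OF pos]

lemma h_pos: "v \<in> sphere 0 1 \<Longrightarrow> 0 < h v"
  using pos by (simp add: positive_on_sphere_def)

lemma N_nonneg: "0 \<le> N y"
  using N_pos[of y] pos by (cases "y = 0") auto

lemma frontier_K: "frontier K = {y. N y = 1}"
proof -
  have "open {y. N y < 1}"
    using continuous_N[of UNIV] by (intro open_Collect_less continuous_intros)
  then have "{y. N y < 1} \<subseteq> interior K"
    by (intro interior_maximal) (auto simp: mem_K)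
  moreover have "N y < 1" if y: "y \<in> interior K" for y
  proof (cases "y = 0")
    case False
    obtain e where e: "0 < e" "cball y e \<subseteq> K" using y mem_interior_cball by blast
    define t where "t = 1 + e / norm y"
    have "t *\<^sub>R y - y = (e / norm y) *\<^sub>R y" by (simp add: t_def algebra_simps)
    then have "dist y (t *\<^sub>R y) = e" using e False by (simp add: dist_norm norm_minus_commute[of y])
    then have "t *\<^sub>R y \<in> cball y e" by simp
    then have "N (t *\<^sub>R y) \<le> 1" using e mem_K by blast
    moreover have "1 < t" using e False by (simp add: t_def)
    ultimately have "t * N y \<le> 1" using N_scale[of t y] by simp
    moreover have "1 * N y < t * N y" using \<open>1 < t\<close> N_pos[OF False] by (rule mult_strict_right_mono)
    ultimately show ?thesis by simp
  qed (use pos in simp)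
  ultimately have "interior K = {y. N y < 1}" by blast
  moreover have "closure K = K" using compact_K by (simp add: compact_imp_closed)
  ultimately show ?thesis by (auto simp: frontier_def mem_K)
qed

lemma outer_unit_normal_iff:
  assumes "N x \<le> 1"
  shows "outer_unit_normal K x v \<longleftrightarrow> v \<in> sphere 0 1 \<and> x \<bullet> v = h v"
proof
  assume o: "outer_unit_normal K x v"
  then have v: "v \<in> sphere 0 1" by (simp add: outer_unit_normal_def)
  obtain y where "y \<in> K" "y \<bullet> v = h v" using touching[OF v] by blast
  then have "h v \<le> x \<bullet> v" using o by (auto simp: outer_unit_normal_def inner_commute)
  moreover have "x \<bullet> v \<le> h v" using assms v mem_K[of x] by (simp add: wulff_def)
  ultimately show "v \<in> sphere 0 1 \<and> x \<bullet> v = h v" using v by simp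
next
  assume "v \<in> sphere 0 1 \<and> x \<bullet> v = h v"
  then show "outer_unit_normal K x v" by (auto simp: outer_unit_normal_def wulff_def inner_commute)
qed

lemma ex_outer_unit_normal:
  assumes "N x = 1"
  obtains v where "outer_unit_normal K x v"
proof -
  obtain v where v: "v \<in> sphere 0 1" "N x = x \<bullet> v / h v" using wulff_gauge_attained[OF pos] .
  then have "x \<bullet> v = h v" using assms h_pos[OF v(1)] by (simp add: field_simps)
  then show thesis using that[of v] v(1) outer_unit_normal_iff[of x v] assms by simp
qed

lemma N_radial: "y \<noteq> 0 \<Longrightarrow> N (radial y) = 1"
  using N_pos[of y] by (simp add: radial_def N_scale)

lemma radial_nonzero: "y \<noteq> 0 \<Longrightarrow> radial y \<noteq> 0"
  using N_pos[of y] by (simp add: radial_def)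

lemma scale_radial: "N y *\<^sub>R radial y = y"
  using N_pos[of y] by (cases "y = 0") (auto simp: radial_def)

lemma radial_scale: "0 < t \<Longrightarrow> radial (t *\<^sub>R y) = radial y"
  by (simp add: radial_def N_scale)

lemma radial_boundary: "N x = 1 \<Longrightarrow> radial x = x"
  by (simp add: radial_def)

lemma radial_measurable [measurable]: "radial \<in> borel_measurable borel"
  unfolding radial_def by measurable

lemma regular_borel [measurable]: "regular \<in> sets borel"
  unfolding regular_def by (rule borel_regular_points[OF compact_K])

lemma regular_D:
  assumes "x \<in> regular"
  shows "N x = 1" "outer_unit_normal K x (\<nu> x)" "norm (\<nu> x) = 1" "x \<bullet> \<nu> x = h (\<nu> x)" "0 < x \<bullet> \<nu> x"
    "\<And>v. outer_unit_normal K x v \<Longrightarrow> v = \<nu> x"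
proof -
  show N: "N x = 1" using assms by (simp add: regular_def frontier_K)
  show o: "outer_unit_normal K x (\<nu> x)" using assms outer_unit_normal_gauss_map[of K x] by (simp add: regular_def)
  then show "norm (\<nu> x) = 1" by (simp add: outer_unit_normal_def)
  then show "x \<bullet> \<nu> x = h (\<nu> x)" "0 < x \<bullet> \<nu> x"
    using outer_unit_normal_iff[of x "\<nu> x"] o N h_pos[of "\<nu> x"] by auto
  show "v = \<nu> x" if "outer_unit_normal K x v" for v
    using gauss_map_eq[of K x v] assms that by (simp add: regular_def)
qed

text \<open>The normal bundle is compact, so its part with normals away from \<open>\<nu> x\<close> projects to a compact
  set that misses the regular point \<open>x\<close>.\<close>

lemma normals_near_regular_point:
  assumes x0: "x0 \<in> regular" and e: "0 < e"
  obtains r where "0 < r" "\<And>x v. N x = 1 \<Longrightarrow> dist x0 x < r \<Longrightarrow> outer_unit_normal K x v \<Longrightarrow> norm (v - \<nu> x0) < e"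
proof -
  define G where "G = {(x, v). x \<in> frontier K \<and> outer_unit_normal K x v} \<inter> {z. e \<le> norm (snd z - \<nu> x0)}"
  have "compact G" unfolding G_def
    by (intro compact_Int_closed compact_normal_bundle compact_K closed_Collect_le continuous_intros)
  then have "compact (fst ` G)" by (intro compact_continuous_image continuous_intros)
  moreover have "x0 \<notin> fst ` G"
  proof
    assume "x0 \<in> fst ` G"
    then obtain v where "outer_unit_normal K x0 v" "e \<le> norm (v - \<nu> x0)" by (auto simp: G_def)
    then show False using regular_D(6)[OF x0, of v] e by simp
  qed
  ultimately have "open (- fst ` G)" "x0 \<in> - fst ` G" by (auto simp: compact_imp_closed)
  then obtain r where r: "0 < r" "ball x0 r \<subseteq> - fst ` G" using open_contains_ball by blast
  show thesis
  proof (rule that[OF r(1)])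
    fix x v assume x: "N x = 1" "dist x0 x < r" "outer_unit_normal K x v"
    then have "x \<notin> fst ` G" using r(2) by auto
    then have "(x, v) \<notin> G" by force
    then show "norm (v - \<nu> x0) < e" using x by (simp add: G_def frontier_K)
  qed
qed

text \<open>The outer normals at \<open>x\<close> and \<open>y\<close> are both close to \<open>\<nu> x0\<close>, and each of them bounds the difference
  from one side.\<close>

lemma flat_near_regular_point:
  assumes x0: "x0 \<in> regular" and e: "0 < e"
  obtains r where "0 < r"
    "\<And>x y. N x = 1 \<Longrightarrow> N y = 1 \<Longrightarrow> dist x0 x < r \<Longrightarrow> dist x0 y < r \<Longrightarrow> \<bar>(x - y) \<bullet> \<nu> x0\<bar> \<le> e * norm (x - y)"
proof -
  obtain r where r: "0 < r" "\<And>x v. N x = 1 \<Longrightarrow> dist x0 x < r \<Longrightarrow> outer_unit_normal K x v \<Longrightarrow> norm (v - \<nu> x0) < e"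
    using normals_near_regular_point[OF x0 e] by blast
  have le: "(x - y) \<bullet> \<nu> x0 \<le> e * norm (x - y)" if xy: "N x = 1" "N y = 1" "dist x0 y < r" for x y
  proof -
    obtain v where v: "outer_unit_normal K y v" using ex_outer_unit_normal[OF xy(2)] .
    have "x \<in> K" using xy(1) by (simp add: mem_K)
    then have "(x - y) \<bullet> v \<le> 0" using v by (auto simp: outer_unit_normal_def inner_diff_right inner_commute[of _ v])
    then have "(x - y) \<bullet> \<nu> x0 \<le> (x - y) \<bullet> (\<nu> x0 - v)" by (simp add: inner_diff_right)
    also have "\<dots> \<le> norm (x - y) * norm (\<nu> x0 - v)" by (rule norm_cauchy_schwarz)
    also have "\<dots> \<le> norm (x - y) * e"
      using r(2)[OF xy(2,3) v] by (intro mult_left_mono) (auto simp: norm_minus_commute)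
    finally show ?thesis by (simp add: mult.commute)
  qed
  show thesis
  proof (rule that[OF r(1)])
    fix x y assume "N x = 1" "N y = 1" "dist x0 x < r" "dist x0 y < r"
    then show "\<bar>(x - y) \<bullet> \<nu> x0\<bar> \<le> e * norm (x - y)"
      using le[of x y] le[of y x] by (simp add: abs_le_iff norm_minus_commute inner_diff_left)
  qed
qed

end

section \<open>Surface measure as cone measure\<close>

lemma nn_integral_lborel_scale:
  fixes f :: "'a::euclidean_space \<Rightarrow> ennreal"
  assumes c: "0 < c" and [measurable]: "f \<in> borel_measurable borel"
  shows "(\<integral>\<^sup>+x. f x \<partial>lborel) = ennreal (c ^ DIM('a)) * (\<integral>\<^sup>+x. f (c *\<^sub>R x) \<partial>lborel)"
proof -
  have "(\<integral>\<^sup>+x. f x \<partial>lborel) = (\<integral>\<^sup>+x. f x \<partial>density (distr lborel borel (\<lambda>x. 0 + c *\<^sub>R x)) (\<lambda>_. \<bar>c\<bar>^DIM('a)))"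
    using lborel_affine[of c "0::'a"] c by simp
  also have "\<dots> = (\<integral>\<^sup>+x. ennreal (c ^ DIM('a)) * f x \<partial>distr lborel borel (\<lambda>x. 0 + c *\<^sub>R x))"
    using c by (subst nn_integral_density) auto
  also have "\<dots> = ennreal (c ^ DIM('a)) * (\<integral>\<^sup>+x. f x \<partial>distr lborel borel (\<lambda>x. 0 + c *\<^sub>R x))"
    by (rule nn_integral_cmult) simp
  also have "(\<integral>\<^sup>+x. f x \<partial>distr lborel borel (\<lambda>x. 0 + c *\<^sub>R x)) = (\<integral>\<^sup>+x. f (c *\<^sub>R x) \<partial>lborel)"
    by (subst nn_integral_distr) auto
  finally show ?thesis .
qed

lemma emeasure_lborel_scale:
  fixes A :: "'a::euclidean_space set"
  assumes c: "0 < c" and [measurable]: "A \<in> sets borel"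
  shows "emeasure lborel A = ennreal (c ^ DIM('a)) * emeasure lborel {x. c *\<^sub>R x \<in> A}"
proof -
  have S: "{x. c *\<^sub>R x \<in> A} \<in> sets borel" by measurable
  have "emeasure lborel A = (\<integral>\<^sup>+x. indicator A x \<partial>lborel)" by simp
  also have "\<dots> = ennreal (c ^ DIM('a)) * (\<integral>\<^sup>+x. indicator A (c *\<^sub>R x) \<partial>lborel)"
    by (rule nn_integral_lborel_scale[OF c]) measurable
  also have "(\<integral>\<^sup>+x. indicator A (c *\<^sub>R x) \<partial>lborel) = (\<integral>\<^sup>+x. indicator {x. c *\<^sub>R x \<in> A} x \<partial>lborel)"
    by (intro nn_integral_cong) (simp add: indicator_def)
  finally show ?thesis using S by simp
qed

text \<open>The inverse of an injective continuous map on a compact set is continuous, so the image is a Borel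
  preimage.\<close>

lemma borel_image_compact_inj:
  fixes f :: "'a::euclidean_space \<Rightarrow> 'b::euclidean_space"
  assumes "compact C" "continuous_on C f" "inj_on f C" and E: "E \<subseteq> C" "E \<in> sets borel"
  shows "f ` E \<in> sets borel"
proof (cases "E = {}")
  case False
  define g where "g = inv_into C f"
  have g: "g (f x) = x" if "x \<in> C" for x using assms(3) that by (simp add: g_def)
  have "continuous_on (f ` C) g"
    by (rule continuous_on_inv[OF assms(2,1)]) (use g in auto)
  moreover have "f ` C \<in> sets borel" by (intro borel_compact compact_continuous_image assms)
  ultimately have m: "(\<lambda>y. if y \<in> f ` C then g y else 0) \<in> borel_measurable borel"
    by (intro borel_measurable_continuous_on_if continuous_on_const)
  have "f ` E = f ` C \<inter> ((\<lambda>y. if y \<in> f ` C then g y else 0) -` E \<inter> space borel)"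
    using E(1) g by (auto 0 3 intro!: image_eqI)
  also have "\<dots> \<in> sets borel"
    using measurable_sets[OF m E(2)] \<open>f ` C \<in> sets borel\<close> by auto
  finally show ?thesis .
qed simp

lemma bernoulli_power_bounds:
  fixes t L :: real
  assumes "1 \<le> t" "t ^ n \<le> L"
  shows "real n * (t - 1) \<le> t ^ n - 1" "t ^ n - 1 \<le> L * (real n * (t - 1))"
proof -
  have eq: "t ^ n - 1 = (t - 1) * (\<Sum>i<n. t ^ i)" by (rule power_diff_1_eq)
  have "(\<Sum>i<n. 1) \<le> (\<Sum>i<n. t ^ i)" using assms(1) by (intro sum_mono one_le_power)
  then have "(t - 1) * real n \<le> (t - 1) * (\<Sum>i<n. t ^ i)" using assms(1) by (intro mult_left_mono) auto
  then show "real n * (t - 1) \<le> t ^ n - 1" using eq by (simp add: mult.commute)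
  have "t ^ i \<le> L" if "i < n" for i
    using power_increasing[of i n t] that assms by linarith
  then have "(\<Sum>i<n. t ^ i) \<le> (\<Sum>i<n. L)" by (intro sum_mono) auto
  then have "(t - 1) * (\<Sum>i<n. t ^ i) \<le> (t - 1) * (real n * L)" using assms(1) by (intro mult_left_mono) auto
  then show "t ^ n - 1 \<le> L * (real n * (t - 1))" using eq by (simp add: mult_ac)
qed

context supported_wulff begin

text \<open>The cone over a set of boundary points, without its apex and its base.\<close>

definition open_cone :: "'a set \<Rightarrow> 'a set" where
  "open_cone E = {y. 0 < N y \<and> N y < 1 \<and> radial y \<in> E}"

text \<open>The points \<open>s x\<close> with \<open>x \<in> E\<close>, \<open>1 \<le> s < t\<close>. For \<open>t\<close> close to \<open>1\<close> they stay near the boundary, unlike the cone; its volume determines that of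
  the cone by homogeneity.\<close>

definition shell :: "'a set \<Rightarrow> real \<Rightarrow> 'a set" where
  "shell E t = {y. 1 \<le> N y \<and> N y < t \<and> radial y \<in> E}"

lemma borel_open_cone [measurable]:
  assumes [measurable]: "E \<in> sets borel"
  shows "open_cone E \<in> sets borel"
  unfolding open_cone_def by measurable

lemma borel_shell [measurable]:
  assumes [measurable]: "E \<in> sets borel"
  shows "shell E t \<in> sets borel"
  unfolding shell_def by measurable

lemma emeasure_open_cone_finite: "emeasure lborel (open_cone E) < \<infinity>"
proof -
  have "open_cone E \<subseteq> K" by (auto simp: open_cone_def mem_K)
  then show ?thesis using bounded_subset[OF compact_imp_bounded[OF compact_K]] emeasure_bounded_finite by blast
qed

lemma emeasure_shell:
  assumes [measurable]: "E \<in> sets borel" and t: "1 \<le> t"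
  shows "emeasure lborel (shell E t) = ennreal (t ^ DIM('a) - 1) * emeasure lborel (open_cone E)"
proof -
  define B where "B = {y. 0 < N y \<and> N y < t \<and> radial y \<in> E}"
  have [measurable]: "B \<in> sets borel" unfolding B_def by measurable
  have "{x. t *\<^sub>R x \<in> B} = open_cone E"
    using t by (auto simp: B_def open_cone_def N_scale radial_scale zero_less_mult_iff)
  then have "emeasure lborel B = ennreal (t ^ DIM('a)) * emeasure lborel (open_cone E)"
    using emeasure_lborel_scale[of t B] t by simp
  moreover have "emeasure lborel B = emeasure lborel (open_cone E) + emeasure lborel (shell E t)"
  proof -
    have "B = open_cone E \<union> shell E t" using t by (auto simp: B_def open_cone_def shell_def)
    moreover have "open_cone E \<inter> shell E t = {}" by (auto simp: open_cone_def shell_def)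
    ultimately show ?thesis by (simp add: plus_emeasure)
  qed
  moreover obtain c where c: "emeasure lborel (open_cone E) = ennreal c" "0 \<le> c"
    using emeasure_open_cone_finite[of E] by (metis ennreal_cases less_irrefl infinity_ennreal_def)
  ultimately have eq: "ennreal c + emeasure lborel (shell E t) = ennreal (t ^ DIM('a) * c)"
    using t by (simp add: ennreal_mult)
  have "ennreal c + emeasure lborel (shell E t) = ennreal c + ennreal ((t ^ DIM('a) - 1) * c)"
    unfolding eq using c t mult_left_mono[OF one_le_power[OF t, of "DIM('a)"] c(2)]
    by (subst ennreal_plus[symmetric]) (auto simp: algebra_simps)
  then have "emeasure lborel (shell E t) = ennreal ((t ^ DIM('a) - 1) * c)"
    by (simp add: ennreal_add_left_cancel)
  then show ?thesis using c t by (simp add: ennreal_mult)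
qed

lemma regular_normal_measurable:
  "(\<lambda>x. if x \<in> regular then \<nu> x else 0) \<in> borel_measurable borel"
  using continuous_on_gauss_map[OF compact_K] regular_borel
  by (intro borel_measurable_continuous_on_if continuous_on_const) (auto simp: regular_def)

lemma support_density_measurable:
  assumes [measurable]: "E \<in> sets borel" and "E \<subseteq> regular"
  shows "(\<lambda>x. ennreal (x \<bullet> \<nu> x) * indicator E x) \<in> borel_measurable borel"
proof -
  note regular_normal_measurable[measurable]
  have "(\<lambda>x. ennreal (x \<bullet> \<nu> x) * indicator E x)
      = (\<lambda>x. ennreal (x \<bullet> (if x \<in> regular then \<nu> x else 0)) * indicator E x)"
    using assms(2) by (intro ext) (auto split: split_indicator)
  also have "\<dots> \<in> borel_measurable borel" by measurable
  finally show ?thesis .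
qed

text \<open>The weight is the distance of the tangent plane from the origin, so that flat pieces get \<open>DIM('a)\<close> times
  the volume of the cone over them, up to the factor that relates Hausdorff and Lebesgue measure.\<close>

definition weighted_surface :: "'a set \<Rightarrow> ennreal" where
  "weighted_surface E = (\<integral>\<^sup>+x. ennreal (x \<bullet> \<nu> x) * indicator E x \<partial>hausdorff_measure (DIM('a) - 1))"

text \<open>Volumes of a shell and of a right prism can be compared because the boundary is almost its tangent
  plane near \<open>x0\<close>. The points \<open>(1 + \<tau> / a) x\<close> of a thin shell are
  matched with the points \<open>P x + \<tau> \<nu>\<close> of a prism over the projection \<open>P E\<close>; after a volume preserving shear
  that takes \<open>x0 / a\<close> to \<open>\<nu>\<close>, this matching is a small Lipschitz perturbation of the identity.\<close>

lemma shell_prism_compare: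
  fixes x0 :: 'a and a \<eta> \<epsilon> r \<delta> :: real
  defines "v \<equiv> \<nu> x0" and "u \<equiv> x0 /\<^sub>R (x0 \<bullet> \<nu> x0) - \<nu> x0"
  assumes x0: "x0 \<in> regular" and a: "a = x0 \<bullet> \<nu> x0"
    and flat: "\<And>x y. x \<in> E \<Longrightarrow> y \<in> E \<Longrightarrow> \<bar>(x - y) \<bullet> v\<bar> \<le> \<epsilon> * norm (x - y)"
    and E: "E \<in> sets borel" "E \<subseteq> {x. N x = 1}" "\<And>x. x \<in> E \<Longrightarrow> norm (x - x0) \<le> r"
    and PE: "(\<lambda>x. x - (x \<bullet> v) *\<^sub>R v) ` E \<in> sets borel"
    and \<epsilon>: "0 \<le> \<epsilon>" "\<epsilon> \<le> 1/2" and r: "0 \<le> r" and \<delta>: "0 < \<delta>"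
    and small: "(1 + norm u) * (2 * \<epsilon> + r / a + 2 * \<delta> / a) \<le> \<eta>" and \<eta>: "\<eta> < 1"
    and L: "1 + \<eta> \<le> L" "1 \<le> L * (1 - \<eta>)"
  shows "emeasure lborel (shell E (1 + \<delta> / a)) \<le> ennreal (L ^ DIM('a)) * emeasure lborel (prism v ((\<lambda>x. x - (x \<bullet> v) *\<^sub>R v) ` E) \<delta>)"
    and "emeasure lborel (prism v ((\<lambda>x. x - (x \<bullet> v) *\<^sub>R v) ` E) \<delta>) \<le> ennreal (L ^ DIM('a)) * emeasure lborel (shell E (1 + \<delta> / a))"
proof -
  define P where "P x = x - (x \<bullet> v) *\<^sub>R v" for x :: 'a
  have a0: "0 < a" using regular_D(5)[OF x0] a by simp
  have vv: "v \<bullet> v = 1" and nv: "norm v = 1" using regular_D(3)[OF x0] by (auto simp: v_def norm_eq_1)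
  have uv: "u \<bullet> v = 0" using a0 vv by (simp add: u_def a[symmetric] v_def[symmetric] inner_diff_left) (simp add: a v_def)
  have \<eta>0: "0 \<le> \<eta>"
  proof -
    have "0 \<le> (1 + norm u) * (2 * \<epsilon> + r / a + 2 * \<delta> / a)"
      using \<epsilon> r \<delta> a0 by (intro mult_nonneg_nonneg add_nonneg_nonneg) auto
    then show ?thesis using small by linarith
  qed
  define \<phi> where "\<phi> = (\<lambda>(x, \<tau>). P x + \<tau> *\<^sub>R v)"
  \<comment> \<open>\<open>S\<close> inverts the shear that takes \<open>v\<close> to \<open>u + v = x0 / a\<close>\<close>
  define S where "S w = w - (w \<bullet> v) *\<^sub>R u" for w
  define \<psi> where "\<psi> = (\<lambda>(x, \<tau>). S ((1 + \<tau> / a) *\<^sub>R x))"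
  define X where "X = E \<times> {0..<\<delta>}"
  have PP: "P x \<bullet> v = 0" for x by (simp add: P_def inner_diff_left vv)
  have near: "norm ((\<psi> p - \<psi> q) - (\<phi> p - \<phi> q)) \<le> \<eta> * norm (\<phi> p - \<phi> q)" if "p \<in> X" "q \<in> X" for p q
  proof -
    obtain x \<tau> y \<sigma> where pq0: "p = (x, \<tau>)" "q = (y, \<sigma>)" by (cases p, cases q) blast
    have pq: "p = (x, \<tau>)" "q = (y, \<sigma>)" "x \<in> E" "y \<in> E" "0 \<le> \<tau>" "\<tau> < \<delta>" "0 \<le> \<sigma>" "\<sigma> < \<delta>"
      using that unfolding pq0 X_def by auto
    define D where "D = \<phi> p - \<phi> q"
    have D: "D = P (x - y) + (\<tau> - \<sigma>) *\<^sub>R v"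
      by (simp add: D_def \<phi>_def pq P_def algebra_simps inner_diff_left)
    have "D \<bullet> v = \<tau> - \<sigma>" by (simp add: D inner_add_left PP vv)
    then have \<tau>\<sigma>: "\<bar>\<tau> - \<sigma>\<bar> \<le> norm D" using Cauchy_Schwarz_ineq2[of D v] nv by simp
    have "norm D ^ 2 = norm (P (x - y)) ^ 2 + (\<tau> - \<sigma>) ^ 2"
      unfolding power2_norm_eq_inner D using PP[of "x - y"]
      by (simp add: inner_add_left inner_add_right vv inner_commute power2_eq_square)
    then have "norm (P (x - y)) ^ 2 \<le> norm D ^ 2" by simp
    then have PD: "norm (P (x - y)) \<le> norm D" by (rule power2_le_imp_le) simp
    have fl: "\<bar>(x - y) \<bullet> v\<bar> \<le> \<epsilon> * norm (x - y)" using flat pq by blast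
    have "norm (x - y) \<le> norm (P (x - y)) + norm (((x - y) \<bullet> v) *\<^sub>R v)"
      unfolding P_def by (metis diff_add_cancel norm_triangle_ineq)
    then have "norm (x - y) \<le> norm D + \<epsilon> * norm (x - y)" using PD fl nv by simp
    moreover have "\<epsilon> * norm (x - y) \<le> 1/2 * norm (x - y)" using \<epsilon> by (intro mult_right_mono) auto
    ultimately have xy: "norm (x - y) \<le> 2 * norm D" by simp
    define W where "W = (1 + \<tau> / a) *\<^sub>R x - (1 + \<sigma> / a) *\<^sub>R y"
    define Q where "Q = ((x - y) \<bullet> v) *\<^sub>R v + (1 / a) *\<^sub>R ((\<tau> - \<sigma>) *\<^sub>R (x - x0) + \<sigma> *\<^sub>R (x - y))"
    have x0u: "x0 = a *\<^sub>R (u + v)" using a0 by (simp add: u_def a v_def)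
    have WQ: "W = (D + (D \<bullet> v) *\<^sub>R u) + Q"
    proof -
      have "W = (x - y) + (1 / a) *\<^sub>R (\<tau> *\<^sub>R x - \<sigma> *\<^sub>R y)"
        by (simp add: W_def algebra_simps)
      also have "(1 / a) *\<^sub>R (\<tau> *\<^sub>R x - \<sigma> *\<^sub>R y)
          = (\<tau> - \<sigma>) *\<^sub>R ((1 / a) *\<^sub>R x0) + (1 / a) *\<^sub>R ((\<tau> - \<sigma>) *\<^sub>R (x - x0) + \<sigma> *\<^sub>R (x - y))"
        by (simp add: algebra_simps diff_divide_distrib)
      also have "(1 / a) *\<^sub>R x0 = u + v" using a0 by (simp add: x0u)
      finally show ?thesis
        unfolding \<open>D \<bullet> v = \<tau> - \<sigma>\<close> by (simp add: D Q_def P_def algebra_simps)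
    qed
    have "\<psi> p - \<psi> q = S W"
      by (simp add: \<psi>_def pq S_def W_def algebra_simps inner_diff_left)
    also have "\<dots> = D + S Q"
      unfolding WQ S_def by (simp add: inner_add_left uv algebra_simps)
    finally have eq: "(\<psi> p - \<psi> q) - (\<phi> p - \<phi> q) = S Q" by (simp add: D_def)
    have "norm (S Q) \<le> norm Q + norm ((Q \<bullet> v) *\<^sub>R u)" unfolding S_def by (rule norm_triangle_ineq4)
    also have "\<dots> \<le> norm Q + norm Q * norm u"
      using Cauchy_Schwarz_ineq2[of Q v] nv by (simp add: mult_right_mono)
    finally have SQ: "norm (S Q) \<le> (1 + norm u) * norm Q" by (simp add: algebra_simps)
    define Z where "Z = (\<tau> - \<sigma>) *\<^sub>R (x - x0) + \<sigma> *\<^sub>R (x - y)"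
    have "norm Z \<le> \<bar>\<tau> - \<sigma>\<bar> * norm (x - x0) + \<bar>\<sigma>\<bar> * norm (x - y)"
      unfolding Z_def by (rule norm_triangle_le) simp
    also have "\<dots> \<le> norm D * r + \<delta> * (2 * norm D)"
      using \<tau>\<sigma> E(3)[OF pq(3)] xy pq by (intro add_mono mult_mono) auto
    finally have "(1 / a) * norm Z \<le> (1 / a) * (norm D * r + \<delta> * (2 * norm D))"
      using a0 by (intro mult_left_mono) auto
    moreover have "norm Q \<le> \<bar>(x - y) \<bullet> v\<bar> + (1 / a) * norm Z"
      unfolding Q_def Z_def[symmetric] by (rule norm_triangle_le) (use nv a0 in simp)
    moreover have "\<bar>(x - y) \<bullet> v\<bar> \<le> \<epsilon> * (2 * norm D)"
      using fl mult_left_mono[OF xy \<epsilon>(1)] by linarith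
    ultimately have "norm Q \<le> \<epsilon> * (2 * norm D) + (1 / a) * (norm D * r + \<delta> * (2 * norm D))"
      by linarith
    also have "\<dots> = (2 * \<epsilon> + r / a + 2 * \<delta> / a) * norm D"
      by (simp add: add_divide_distrib algebra_simps)
    finally have "(1 + norm u) * norm Q \<le> (1 + norm u) * ((2 * \<epsilon> + r / a + 2 * \<delta> / a) * norm D)"
      by (intro mult_left_mono) auto
    also have "\<dots> \<le> \<eta> * norm D"
      unfolding mult.assoc[symmetric] using small by (intro mult_right_mono) auto
    finally show ?thesis using SQ unfolding eq D_def by linarith
  qed
  have L0: "0 < L" using L(1) \<eta>0 by linarith
  have up: "dist (\<psi> p) (\<psi> q) \<le> L * dist (\<phi> p) (\<phi> q)" if "p \<in> X" "q \<in> X" for p q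
  proof -
    have "norm (\<psi> p - \<psi> q) \<le> norm ((\<psi> p - \<psi> q) - (\<phi> p - \<phi> q)) + norm (\<phi> p - \<phi> q)"
      by (metis diff_add_cancel norm_triangle_ineq)
    also have "\<dots> \<le> (1 + \<eta>) * norm (\<phi> p - \<phi> q)" using near[OF that] by (simp add: algebra_simps)
    also have "\<dots> \<le> L * norm (\<phi> p - \<phi> q)" using L(1) by (rule mult_right_mono) simp
    finally show ?thesis by (simp add: dist_norm)
  qed
  have lo: "dist (\<phi> p) (\<phi> q) \<le> L * dist (\<psi> p) (\<psi> q)" if "p \<in> X" "q \<in> X" for p q
  proof -
    have "norm (\<phi> p - \<phi> q) - norm (\<psi> p - \<psi> q) \<le> norm ((\<phi> p - \<phi> q) - (\<psi> p - \<psi> q))"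
      by (rule norm_triangle_ineq2)
    then have "(1 - \<eta>) * norm (\<phi> p - \<phi> q) \<le> norm (\<psi> p - \<psi> q)"
      using near[OF that] norm_minus_commute[of "\<phi> p - \<phi> q" "\<psi> p - \<psi> q"] by (simp add: algebra_simps)
    then have "L * ((1 - \<eta>) * norm (\<phi> p - \<phi> q)) \<le> L * norm (\<psi> p - \<psi> q)"
      using L0 by (intro mult_left_mono) auto
    moreover have "1 * norm (\<phi> p - \<phi> q) \<le> (L * (1 - \<eta>)) * norm (\<phi> p - \<phi> q)"
      using L(2) by (rule mult_right_mono) simp
    ultimately show ?thesis by (simp add: dist_norm mult.assoc)
  qed
  have imP: "\<phi> ` X = prism v (P ` E) \<delta>"
  proof (intro equalityI subsetI)
    fix z assume "z \<in> \<phi> ` X"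
    then obtain x \<tau> where z: "z = P x + \<tau> *\<^sub>R v" "x \<in> E" "0 \<le> \<tau>" "\<tau> < \<delta>" by (auto simp: \<phi>_def X_def)
    have "z \<bullet> v = \<tau>" by (simp add: z inner_add_left PP vv)
    then show "z \<in> prism v (P ` E) \<delta>" using z by (simp add: prism_def)
  next
    fix z assume "z \<in> prism v (P ` E) \<delta>"
    then obtain x where "z - (z \<bullet> v) *\<^sub>R v = P x" "x \<in> E" "0 \<le> z \<bullet> v" "z \<bullet> v < \<delta>"
      by (auto simp: prism_def)
    then show "z \<in> \<phi> ` X"
      by (intro image_eqI[of _ _ "(x, z \<bullet> v)"]) (auto simp: \<phi>_def X_def algebra_simps)
  qed
  let ?t = "1 + \<delta> / a"
  have imS: "\<psi> ` X = {z. z + (z \<bullet> v) *\<^sub>R u \<in> shell E ?t}"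
  proof (intro equalityI subsetI)
    fix z assume "z \<in> \<psi> ` X"
    then obtain x \<tau> where z: "z = S ((1 + \<tau> / a) *\<^sub>R x)" "x \<in> E" "0 \<le> \<tau>" "\<tau> < \<delta>" by (auto simp: \<psi>_def X_def)
    have s: "0 < 1 + \<tau> / a" using z a0 by (simp add: add_pos_nonneg)
    have Nx: "N x = 1" using E(2) z by blast
    have "z + (z \<bullet> v) *\<^sub>R u = (1 + \<tau> / a) *\<^sub>R x" by (simp add: z S_def inner_diff_left uv)
    moreover have "(1 + \<tau> / a) *\<^sub>R x \<in> shell E ?t"
      using s z a0 Nx by (simp add: shell_def N_scale radial_scale radial_boundary divide_strict_right_mono)
    ultimately show "z \<in> {z. z + (z \<bullet> v) *\<^sub>R u \<in> shell E ?t}" by simp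
  next
    fix z assume "z \<in> {z. z + (z \<bullet> v) *\<^sub>R u \<in> shell E ?t}"
    define w where "w = z + (z \<bullet> v) *\<^sub>R u"
    have w: "1 \<le> N w" "N w < ?t" "radial w \<in> E"
      using \<open>z \<in> _\<close> by (auto simp: w_def shell_def)
    have "z = S w" by (simp add: S_def w_def inner_add_left uv)
    also have "w = (1 + (a * (N w - 1)) / a) *\<^sub>R radial w" using a0 by (simp add: scale_radial)
    finally have "z = \<psi> (radial w, a * (N w - 1))" by (simp add: \<psi>_def)
    moreover have "(radial w, a * (N w - 1)) \<in> X" using w a0 by (simp add: X_def field_simps)
    ultimately show "z \<in> \<psi> ` X" by blast
  qed
  have vol: "emeasure lborel (\<psi> ` X) = emeasure lborel (shell E ?t)"
    unfolding imS using E by (intro emeasure_lborel_shear uv borel_shell)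
  have b1: "\<phi> ` X \<in> sets borel" unfolding imP using PE by (auto simp: P_def[abs_def])
  have b2: "\<psi> ` X \<in> sets borel"
  proof -
    have [measurable]: "shell E ?t \<in> sets borel" using E by measurable
    show ?thesis unfolding imS by measurable
  qed
  show "emeasure lborel (shell E ?t) \<le> ennreal (L ^ DIM('a)) * emeasure lborel (prism v ((\<lambda>x. x - (x \<bullet> v) *\<^sub>R v) ` E) \<delta>)"
    using emeasure_lborel_Lipschitz_compare[OF L0 up b1 b2] unfolding vol imP P_def[abs_def] .
  show "emeasure lborel (prism v ((\<lambda>x. x - (x \<bullet> v) *\<^sub>R v) ` E) \<delta>) \<le> ennreal (L ^ DIM('a)) * emeasure lborel (shell E ?t)"
    using emeasure_lborel_Lipschitz_compare[OF L0 lo b2 b1] unfolding vol imP P_def[abs_def] .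
qed

end

lemma ennreal_le_if_le_all_factors:
  fixes X Y :: ennreal
  assumes "\<And>q. 1 < q \<Longrightarrow> q \<le> 2 \<Longrightarrow> X \<le> ennreal q * Y"
  shows "X \<le> Y"
proof (cases Y)
  case (real y)
  have "X \<le> ennreal (2 * y)" using assms[of 2] real by (simp add: ennreal_mult)
  then obtain x where x: "X = ennreal x" "0 \<le> x"
    by (metis ennreal_cases ennreal_less_top leD)
  have le: "x \<le> q * y" if "1 < q" "q \<le> 2" for q
    using assms[OF that] that real x by (simp add: ennreal_mult[symmetric])
  have "x \<le> y"
  proof (rule field_le_epsilon)
    fix e :: real assume e: "0 < e"
    define q where "q = 1 + min 1 (e / (y + 1))"
    have q: "1 < q" "q \<le> 2" using e real by (auto simp: q_def)
    have "(q - 1) * y \<le> (e / (y + 1)) * y" using real by (intro mult_right_mono) (auto simp: q_def)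
    also have "\<dots> \<le> e" using e real by (simp add: field_simps)
    finally show "x \<le> y + e" using le[OF q] by (simp add: algebra_simps)
  qed
  then show ?thesis using real x by (simp add: ennreal_leI)
qed simp

context supported_wulff begin

text \<open>Up to factors \<open>L\<close> close to \<open>1\<close>, the weighted surface measure of \<open>E\<close> is \<open>a = x0 \<bullet> \<nu> x0\<close> times its
  Hausdorff measure, which is that of its projection to the tangent plane, hence \<open>k / \<delta>\<close> times the volume of
  the prism of height \<open>\<delta>\<close> over the projection. That prism has the volume of a shell of relative thickness
  \<open>\<delta> / a\<close>, which is \<open>DIM('a) * (\<delta> / a)\<close> times the volume of the cone.\<close>

lemma local_cone_measure:
  fixes k q :: real
  assumes k: "0 < k"
    and hk: "\<And>v F :: 'a set. norm v = 1 \<Longrightarrow> F \<in> sets borel \<Longrightarrow> F \<subseteq> {x. x \<bullet> v = 0} \<Longrightarrow>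
       hausdorff_outer (DIM('a) - 1) F = ennreal k * emeasure lborel (prism v F 1)"
    and x0: "x0 \<in> regular" and q: "1 < q"
  obtains r where "0 < r"
    "\<And>E. E \<in> sets borel \<Longrightarrow> E \<subseteq> regular \<Longrightarrow> E \<subseteq> ball x0 r \<Longrightarrow>
       weighted_surface E \<le> ennreal (q * (real DIM('a) * k)) * emeasure lborel (open_cone E) \<and>
       ennreal (real DIM('a) * k) * emeasure lborel (open_cone E) \<le> ennreal q * weighted_surface E"
proof -
  let ?D = "DIM('a)" and ?n = "DIM('a) - 1"
  define v where "v = \<nu> x0"
  define a where "a = x0 \<bullet> \<nu> x0"
  define u where "u = x0 /\<^sub>R (x0 \<bullet> \<nu> x0) - \<nu> x0"
  define c where "c = 1 + norm u"
  define P where "P x = x - (x \<bullet> v) *\<^sub>R v" for x :: 'a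
  have a0: "0 < a" using regular_D(5)[OF x0] by (simp add: a_def)
  have nv: "norm v = 1" and vv: "v \<bullet> v = 1" using regular_D(3)[OF x0] by (auto simp: v_def norm_eq_1)
  have c0: "0 < c" by (simp add: c_def add_pos_nonneg)
  have D0: "0 < ?D" "Suc ?n = ?D" using DIM_positive[where 'a='a] by (auto simp del: DIM_positive)
  \<comment> \<open>every comparison below costs a factor \<open>L\<close> at most \<open>2 * DIM + 1\<close> times\<close>
  define L where "L = root (2 * ?D + 1) q"
  have L: "1 < L" "L ^ (2 * ?D + 1) = q"
  proof -
    show "1 < L" using q by (simp add: L_def)
    show "L ^ (2 * ?D + 1) = q" unfolding L_def by (rule real_root_pow_pos2) (use q in auto)
  qed
  \<comment> \<open>\<open>\<eta>\<close> bounds the Lipschitz constant of the deviation from the identity: \<open>1 + \<eta> \<le> L\<close> and \<open>L * (1 - \<eta>) = 1\<close>\<close>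
  define \<eta> where "\<eta> = 1 - 1 / L"
  have \<eta>: "0 < \<eta>" "\<eta> < 1" "L * (1 - \<eta>) = 1" using L by (auto simp: \<eta>_def)
  have "0 \<le> (L - 1) ^ 2 / L" using L by simp
  also have "\<dots> = L + 1 / L - 2" using L by (simp add: power2_eq_square field_simps)
  finally have \<eta>L: "1 + \<eta> \<le> L" by (simp add: \<eta>_def)
  define \<epsilon> where "\<epsilon> = min (min (1/2) \<eta>) (\<eta> / (8 * c))"
  have \<epsilon>: "0 < \<epsilon>" "\<epsilon> \<le> 1/2" "\<epsilon> \<le> \<eta>" "\<epsilon> \<le> \<eta> / (8 * c)" using \<eta> c0 by (auto simp: \<epsilon>_def)
  obtain r1 where r1: "0 < r1"
    "\<And>x y. N x = 1 \<Longrightarrow> N y = 1 \<Longrightarrow> dist x0 x < r1 \<Longrightarrow> dist x0 y < r1 \<Longrightarrow> \<bar>(x - y) \<bullet> \<nu> x0\<bar> \<le> \<epsilon> * norm (x - y)"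
    using flat_near_regular_point[OF x0 \<epsilon>(1)] by blast
  have cont: "continuous_on regular (\<lambda>x. x \<bullet> \<nu> x)"
    using continuous_on_gauss_map[OF compact_K] by (intro continuous_intros) (simp add: regular_def)
  define e where "e = min (a * (L - 1)) (a * (1 - 1 / L))"
  have "0 < e" using a0 L by (simp add: e_def)
  then have "\<exists>d>0. \<forall>x\<in>regular. dist x x0 < d \<longrightarrow> dist (x \<bullet> \<nu> x) (x0 \<bullet> \<nu> x0) < e"
    using cont x0 unfolding continuous_on_iff by blast
  then obtain r2 where r2: "0 < r2" "\<And>x. x \<in> regular \<Longrightarrow> dist x x0 < r2 \<Longrightarrow> dist (x \<bullet> \<nu> x) (x0 \<bullet> \<nu> x0) < e"
    by auto
  define r where "r = min (r1 / 2) (min r2 (a * \<eta> / (4 * c)))"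
  have r: "0 < r" "r < r1" "r \<le> r2" "r \<le> a * \<eta> / (4 * c)"
    using r1(1) r2(1) a0 \<eta> c0 by (auto simp: r_def)
  define t where "t = min (root ?D L) (1 + \<eta> / (8 * c))"
  have "1 < root ?D L" "root ?D L ^ ?D = L"
    using L D0 by (auto simp: real_root_pow_pos2)
  then have t: "1 < t" "t \<le> 1 + \<eta> / (8 * c)" "t ^ ?D \<le> L"
    using \<eta> c0 power_mono[of t "root ?D L" ?D] by (auto simp: t_def)
  define \<delta> where "\<delta> = a * (t - 1)"
  have \<delta>: "0 < \<delta>" "1 + \<delta> / a = t" using a0 t by (auto simp: \<delta>_def)
  note tD = bernoulli_power_bounds[of t ?D L, OF less_imp_le[OF t(1)] t(3)]
  have small: "c * (2 * \<epsilon> + r / a + 2 * \<delta> / a) \<le> \<eta>"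
  proof -
    have "2 * \<epsilon> \<le> \<eta> / (4 * c)" using \<epsilon>(4) c0 by (simp add: field_simps)
    moreover have "r / a \<le> \<eta> / (4 * c)" using r(4) a0 c0 by (simp add: field_simps)
    moreover have "2 * \<delta> / a \<le> \<eta> / (4 * c)"
    proof -
      have "2 * \<delta> / a = 2 * (t - 1)" using a0 by (simp add: \<delta>_def)
      also have "\<dots> \<le> 2 * (\<eta> / (8 * c))" using t(2) by simp
      finally show ?thesis by simp
    qed
    ultimately have "2 * \<epsilon> + r / a + 2 * \<delta> / a \<le> 3 * (\<eta> / (4 * c))" by linarith
    then have "c * (2 * \<epsilon> + r / a + 2 * \<delta> / a) \<le> c * (3 * (\<eta> / (4 * c)))" using c0 by (intro mult_left_mono) auto
    also have "\<dots> \<le> \<eta>" using c0 \<eta> by simp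
    finally show ?thesis .
  qed
  show thesis
  proof (rule that[OF r(1)])
    fix E assume E: "E \<in> sets borel" "E \<subseteq> regular" "E \<subseteq> ball x0 r"
    have NE: "N x = 1" if "x \<in> E" for x using E(2) that regular_D(1) by blast
    have dE: "dist x0 x < r" if "x \<in> E" for x using E(3) that by auto
    have flat: "\<bar>(x - y) \<bullet> v\<bar> \<le> \<epsilon> * norm (x - y)" if "x \<in> E" "y \<in> E" for x y
      unfolding v_def
    proof (rule r1(2)[OF NE NE])
      show "dist x0 x < r1" "dist x0 y < r1" using dE[OF that(1)] dE[OF that(2)] r(2) by linarith+
    qed (use that in auto)
    have Pdiff: "P x - P y = P (x - y)" for x y by (simp add: P_def algebra_simps inner_diff_left)
    have Ple: "norm (P w) \<le> norm w" for w
    proof -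
      have "norm (P w) ^ 2 = norm w ^ 2 - (w \<bullet> v) ^ 2"
        unfolding power2_norm_eq_inner by (simp add: P_def inner_diff_left inner_diff_right vv inner_commute power2_eq_square)
      then have "norm (P w) ^ 2 \<le> norm w ^ 2" by simp
      then show ?thesis by (rule power2_le_imp_le) simp
    qed
    have Pge: "norm w \<le> norm (P w) + \<bar>w \<bullet> v\<bar>" for w
      using norm_triangle_ineq[of "P w" "(w \<bullet> v) *\<^sub>R v"] nv by (simp add: P_def)
    define C where "C = {y. N y = 1} \<inter> cball x0 r"
    have "closed {y. N y = 1}"
      using continuous_N[of UNIV] by (intro closed_Collect_eq continuous_intros)
    then have "compact C" unfolding C_def by (simp add: closed_Int_compact)
    moreover have "continuous_on C P" unfolding P_def by (intro continuous_intros)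
    moreover have "inj_on P C"
    proof (rule inj_onI)
      fix x y assume xy: "x \<in> C" "y \<in> C" "P x = P y"
      have "P (x - y) = 0" using xy(3) Pdiff[of x y] by simp
      moreover have "\<bar>(x - y) \<bullet> v\<bar> \<le> \<epsilon> * norm (x - y)"
        unfolding v_def using xy r(2) by (intro r1(2)) (auto simp: C_def)
      moreover have "\<epsilon> * norm (x - y) \<le> (1/2) * norm (x - y)" using \<epsilon>(2) by (rule mult_right_mono) simp
      moreover have "norm (x - y) \<le> norm (P (x - y)) + \<bar>(x - y) \<bullet> v\<bar>" by (rule Pge)
      ultimately have "norm (x - y) \<le> (1/2) * norm (x - y)" by (simp only: norm_zero)
      then have "norm (x - y) \<le> 0" by linarith
      then show "x = y" by simp
    qed
    moreover have "E \<subseteq> C" using NE less_imp_le[OF dE] by (auto simp: C_def)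
    ultimately have PE: "P ` E \<in> sets borel" using borel_image_compact_inj E(1) by blast
    define H where "H = hausdorff_outer ?n E"
    define H' where "H' = hausdorff_outer ?n (P ` E)"
    define V where "V = emeasure lborel (prism v (P ` E) 1)"
    define Vd where "Vd = emeasure lborel (prism v (P ` E) \<delta>)"
    define S where "S = emeasure lborel (shell E t)"
    define W where "W = emeasure lborel (open_cone E)"
    have H'H: "H' \<le> H"
      using hausdorff_outer_Lipschitz_compare[of 1 E P "\<lambda>x. x" ?n] Ple
      by (simp add: H_def H'_def dist_norm Pdiff)
    have HH': "H \<le> ennreal (L ^ ?n) * H'"
    proof -
      have "dist x y \<le> L * dist (P x) (P y)" if xy: "x \<in> E" "y \<in> E" for x y
      proof -
        have "\<epsilon> * norm (x - y) \<le> \<eta> * norm (x - y)" using \<epsilon>(3) by (rule mult_right_mono) simp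
        then have "(1 - \<eta>) * norm (x - y) \<le> norm (P (x - y))"
          using Pge[of "x - y"] flat[OF xy] by (simp add: algebra_simps)
        then have "L * ((1 - \<eta>) * norm (x - y)) \<le> L * norm (P (x - y))" using L by (intro mult_left_mono) auto
        then show ?thesis using \<eta>(3) by (simp add: dist_norm Pdiff mult.assoc[symmetric])
      qed
      then show ?thesis
        using hausdorff_outer_Lipschitz_compare[of L E "\<lambda>x. x" P ?n] L by (simp add: H_def H'_def)
    qed
    have H'V: "H' = ennreal k * V"
      unfolding H'_def V_def by (rule hk[OF nv PE]) (auto simp: P_def inner_diff_left vv)
    have VdV: "Vd = ennreal \<delta> * V"
      unfolding Vd_def V_def
    proof (rule emeasure_prism_height[OF nv PE])
      have "bounded E" using E(3) bounded_ball bounded_subset by blast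
      then obtain b where "\<And>x. x \<in> E \<Longrightarrow> norm x \<le> b" by (auto simp: bounded_iff)
      then have "\<And>x. x \<in> E \<Longrightarrow> norm (P x) \<le> b" using Ple order_trans by blast
      then show "bounded (P ` E)" by (auto simp: bounded_iff)
    qed (use \<delta> in simp)
    have SW: "S = ennreal (t ^ ?D - 1) * W"
      unfolding S_def W_def using emeasure_shell[OF E(1)] t by simp
    have cmp: "S \<le> ennreal (L ^ ?D) * Vd" "Vd \<le> ennreal (L ^ ?D) * S"
    proof -
      have f1: "\<And>x y. x \<in> E \<Longrightarrow> y \<in> E \<Longrightarrow> \<bar>(x - y) \<bullet> \<nu> x0\<bar> \<le> \<epsilon> * norm (x - y)"
        using flat by (simp add: v_def)
      have f2: "E \<subseteq> {x. N x = 1}" using NE by blast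
      have f3: "\<And>x. x \<in> E \<Longrightarrow> norm (x - x0) \<le> r" using less_imp_le[OF dE] by (simp add: dist_norm norm_minus_commute)
      have f4: "(\<lambda>x. x - (x \<bullet> \<nu> x0) *\<^sub>R \<nu> x0) ` E \<in> sets borel" using PE by (simp only: P_def[abs_def] v_def)
      have f5: "0 \<le> \<epsilon>" "0 \<le> r" using \<epsilon>(1) r(1) by auto
      have f6: "(1 + norm (x0 /\<^sub>R (x0 \<bullet> \<nu> x0) - \<nu> x0)) * (2 * \<epsilon> + r / a + 2 * \<delta> / a) \<le> \<eta>"
        using small by (simp only: c_def u_def)
      have f7: "1 \<le> L * (1 - \<eta>)" using \<eta>(3) by simp
      show "S \<le> ennreal (L ^ ?D) * Vd"
        unfolding S_def Vd_def P_def[abs_def] v_def \<delta>(2)[symmetric]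
        by (rule shell_prism_compare(1)[OF x0 a_def, where \<epsilon>=\<epsilon> and r=r and \<eta>=\<eta>])
          (fact f1 E(1) f2 f3 f4 f5 \<epsilon>(2) \<delta>(1) f6 \<eta>(2) \<eta>L f7)+
      show "Vd \<le> ennreal (L ^ ?D) * S"
        unfolding S_def Vd_def P_def[abs_def] v_def \<delta>(2)[symmetric]
        by (rule shell_prism_compare(2)[OF x0 a_def, where \<epsilon>=\<epsilon> and r=r and \<eta>=\<eta>])
          (fact f1 E(1) f2 f3 f4 f5 \<epsilon>(2) \<delta>(1) f6 \<eta>(2) \<eta>L f7)+
    qed
    have em: "(\<integral>\<^sup>+x. indicator E x \<partial>hausdorff_measure ?n) = H"
      using E(1) by (simp add: H_def emeasure_hausdorff_measure)
    have supp: "x \<bullet> \<nu> x \<le> a * L" "a \<le> L * (x \<bullet> \<nu> x)" "0 \<le> x \<bullet> \<nu> x" if "x \<in> E" for x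
    proof -
      have "dist x x0 < r2" using dE[OF that] r(3) by (simp add: dist_commute)
      with r2(2)[of x] E(2) that have "\<bar>x \<bullet> \<nu> x - a\<bar> < e" by (auto simp: dist_real_def a_def)
      then have b: "x \<bullet> \<nu> x < a + a * (L - 1)" "a - a * (1 - 1 / L) < x \<bullet> \<nu> x" by (auto simp: e_def)
      then show "x \<bullet> \<nu> x \<le> a * L" by (simp add: algebra_simps)
      have "a / L < x \<bullet> \<nu> x" using b(2) by (simp add: algebra_simps)
      then show "a \<le> L * (x \<bullet> \<nu> x)" using L by (simp add: divide_less_eq mult.commute less_imp_le)
      show "0 \<le> x \<bullet> \<nu> x" using regular_D(5)[of x] E(2) that by auto
    qed
    have WS1: "weighted_surface E \<le> ennreal (a * L) * H"
    proof -
      have "weighted_surface E \<le> (\<integral>\<^sup>+x. ennreal (a * L) * indicator E x \<partial>hausdorff_measure ?n)"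
        unfolding weighted_surface_def
        by (intro nn_integral_mono) (auto simp: indicator_def intro!: ennreal_leI supp)
      also have "\<dots> = ennreal (a * L) * H"
        by (subst nn_integral_cmult) (use E(1) in simp, simp only: em)
      finally show ?thesis .
    qed
    have WS2: "ennreal a * H \<le> ennreal L * weighted_surface E"
    proof -
      have "ennreal a * H = (\<integral>\<^sup>+x. ennreal a * indicator E x \<partial>hausdorff_measure ?n)"
        by (subst nn_integral_cmult) (use E(1) in simp, simp only: em)
      also have "\<dots> \<le> (\<integral>\<^sup>+x. ennreal L * (ennreal (x \<bullet> \<nu> x) * indicator E x) \<partial>hausdorff_measure ?n)"
        using L supp by (intro nn_integral_mono) (auto simp: indicator_def ennreal_mult[symmetric] intro!: ennreal_leI)
      also have "\<dots> = ennreal L * weighted_surface E"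
        unfolding weighted_surface_def
        using support_density_measurable[OF E(1,2)] by (intro nn_integral_cmult) (simp add: measurable_cong_sets[OF sets_hausdorff_measure refl])
      finally show ?thesis .
    qed
    have VV: "V = ennreal (1 / \<delta>) * Vd"
      unfolding VdV using \<delta>(1) by (simp add: mult.assoc[symmetric] ennreal_mult[symmetric])
    have pos: "0 \<le> a" "0 \<le> L" "0 \<le> k" "0 \<le> \<delta>" "0 \<le> t ^ ?D - 1" "0 \<le> t - 1" "0 \<le> q"
      using a0 L k \<delta> t one_le_power[of t ?D] q by auto
    have "weighted_surface E \<le> ennreal (a * L) * (ennreal (L ^ ?n) * (ennreal k * (ennreal (1 / \<delta>) * (ennreal (L ^ ?D) * (ennreal (t ^ ?D - 1) * W)))))"
    proof -
      have "weighted_surface E \<le> ennreal (a * L) * H" by (rule WS1)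
      also have "\<dots> \<le> ennreal (a * L) * (ennreal (L ^ ?n) * H')" using HH' by (rule mult_left_mono) simp
      also have "\<dots> = ennreal (a * L) * (ennreal (L ^ ?n) * (ennreal k * (ennreal (1 / \<delta>) * Vd)))"
        by (simp only: H'V VV)
      also have "\<dots> \<le> ennreal (a * L) * (ennreal (L ^ ?n) * (ennreal k * (ennreal (1 / \<delta>) * (ennreal (L ^ ?D) * S))))"
        using cmp(2) by (intro mult_left_mono) auto
      finally show ?thesis by (simp only: SW)
    qed
    also have "\<dots> = ennreal (a * L * L ^ ?n * k * (1 / \<delta>) * L ^ ?D * (t ^ ?D - 1)) * W"
      using pos by (simp add: mult.assoc[symmetric] ennreal_mult[symmetric])
    also have "\<dots> \<le> ennreal (q * (real ?D * k)) * W"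
    proof (intro mult_right_mono ennreal_leI)
      have "a * L * L ^ ?n * k * (1 / \<delta>) * L ^ ?D * (t ^ ?D - 1)
          \<le> a * L * L ^ ?n * k * (1 / \<delta>) * L ^ ?D * (L * (real ?D * (t - 1)))"
        using pos by (intro mult_left_mono tD) auto
      also have "\<dots> = (L * L ^ ?n) * L ^ ?D * L * (real ?D * k) * (a * (t - 1) / \<delta>)"
        by simp
      also have "a * (t - 1) / \<delta> = 1" using \<delta>(1) by (simp add: \<delta>_def[symmetric])
      also have "L * L ^ ?n = L ^ ?D" using D0(2) by (metis power_Suc)
      also have "L ^ ?D * L ^ ?D * L = q" unfolding L(2)[symmetric] by (simp add: power_add mult_2)
      finally show "a * L * L ^ ?n * k * (1 / \<delta>) * L ^ ?D * (t ^ ?D - 1) \<le> q * (real ?D * k)" by simp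
    qed simp
    finally have up: "weighted_surface E \<le> ennreal (q * (real ?D * k)) * W" .
    have "ennreal (real ?D * k) * W = ennreal (k * a / \<delta>) * (ennreal (real ?D * (t - 1)) * W)"
    proof -
      have "a * (t - 1) / \<delta> = 1" using \<delta>(1) by (simp add: \<delta>_def[symmetric])
      moreover have "k * a / \<delta> * (real ?D * (t - 1)) = real ?D * k * (a * (t - 1) / \<delta>)" by (simp add: mult_ac)
      ultimately have "real ?D * k = k * a / \<delta> * (real ?D * (t - 1))" by (simp only: mult_1_right)
      then show ?thesis using pos by (simp only: mult.assoc[symmetric] ennreal_mult[symmetric] divide_nonneg_nonneg mult_nonneg_nonneg of_nat_0_le_iff)
    qed
    also have "\<dots> \<le> ennreal (k * a / \<delta>) * (ennreal (t ^ ?D - 1) * W)"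
      using tD(1) by (intro mult_left_mono mult_right_mono ennreal_leI) auto
    also have "\<dots> = ennreal (k * a / \<delta>) * S" by (simp only: SW)
    also have "\<dots> \<le> ennreal (k * a / \<delta>) * (ennreal (L ^ ?D) * Vd)"
      using cmp(1) by (intro mult_left_mono) auto
    also have "\<dots> = ennreal (L ^ ?D) * (ennreal a * (ennreal k * V))"
    proof -
      have "ennreal (k * a / \<delta>) * (ennreal (L ^ ?D) * Vd) = ennreal (k * a / \<delta> * L ^ ?D * \<delta>) * V"
        unfolding VdV using pos by (simp add: mult.assoc[symmetric] ennreal_mult[symmetric])
      also have "k * a / \<delta> * L ^ ?D * \<delta> = L ^ ?D * a * k" using \<delta>(1) by simp
      also have "ennreal (L ^ ?D * a * k) * V = ennreal (L ^ ?D) * (ennreal a * (ennreal k * V))"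
        using pos by (simp add: mult.assoc[symmetric] ennreal_mult[symmetric])
      finally show ?thesis .
    qed
    also have "\<dots> \<le> ennreal (L ^ ?D) * (ennreal a * H)"
      using H'H unfolding H'V by (intro mult_left_mono) auto
    also have "\<dots> \<le> ennreal (L ^ ?D) * (ennreal L * weighted_surface E)"
      using WS2 by (intro mult_left_mono) auto
    also have "\<dots> = ennreal (L ^ ?D * L) * weighted_surface E"
      using pos by (simp add: mult.assoc[symmetric] ennreal_mult[symmetric])
    also have "\<dots> = ennreal (L ^ (?D + 1)) * weighted_surface E" by (simp add: mult.commute)
    also have "\<dots> \<le> ennreal q * weighted_surface E"
      unfolding L(2)[symmetric] using L(1) by (intro mult_right_mono ennreal_leI power_increasing) auto
    finally have lo: "ennreal (real ?D * k) * W \<le> ennreal q * weighted_surface E" .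
    show "weighted_surface E \<le> ennreal (q * (real ?D * k)) * emeasure lborel (open_cone E) \<and>
       ennreal (real ?D * k) * emeasure lborel (open_cone E) \<le> ennreal q * weighted_surface E"
      using up lo by (simp add: W_def)
  qed
qed


lemma weighted_surface_suminf:
  fixes E :: "nat \<Rightarrow> 'a set"
  assumes E: "\<And>i. E i \<in> sets borel" "\<And>i. E i \<subseteq> regular" and dis: "disjoint_family E"
  shows "weighted_surface (\<Union>i. E i) = (\<Sum>i. weighted_surface (E i))"
proof -
  define M where "M = density (hausdorff_measure (DIM('a) - 1) :: 'a measure) (\<lambda>x. ennreal (x \<bullet> \<nu> x) * indicator regular x)"
  have m: "(\<lambda>x. ennreal (x \<bullet> \<nu> x) * indicator regular x) \<in> borel_measurable (hausdorff_measure (DIM('a) - 1))"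
    using support_density_measurable[OF regular_borel order_refl]
    by (simp add: measurable_cong_sets[OF sets_hausdorff_measure refl])
  have em: "emeasure M A = weighted_surface A" if "A \<in> sets borel" "A \<subseteq> regular" for A
  proof -
    have "emeasure M A = (\<integral>\<^sup>+x. ennreal (x \<bullet> \<nu> x) * indicator regular x * indicator A x \<partial>hausdorff_measure (DIM('a) - 1))"
      unfolding M_def using m that by (intro emeasure_density) auto
    also have "\<dots> = weighted_surface A"
      unfolding weighted_surface_def using that(2) by (intro nn_integral_cong) (auto simp: indicator_def)
    finally show ?thesis .
  qed
  have "(\<Sum>i. emeasure M (E i)) = emeasure M (\<Union>i. E i)"
    by (rule suminf_emeasure) (use E dis in \<open>auto simp: M_def\<close>)
  moreover have "(\<Union>i. E i) \<subseteq> regular" "(\<Union>i. E i) \<in> sets borel" using E by auto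
  ultimately show ?thesis using E by (simp add: em)
qed

lemma emeasure_open_cone_suminf:
  fixes E :: "nat \<Rightarrow> 'a set"
  assumes E: "\<And>i. E i \<in> sets borel" and dis: "disjoint_family E"
  shows "emeasure lborel (open_cone (\<Union>i. E i)) = (\<Sum>i. emeasure lborel (open_cone (E i)))"
proof -
  have "open_cone (\<Union>i. E i) = (\<Union>i. open_cone (E i))" by (auto simp: open_cone_def)
  moreover have "disjoint_family (\<lambda>i. open_cone (E i))"
    unfolding disjoint_family_on_def
  proof (intro ballI impI)
    fix i j :: nat assume "i \<noteq> j"
    then have "E i \<inter> E j = {}" using dis by (simp add: disjoint_family_on_def)
    then show "open_cone (E i) \<inter> open_cone (E j) = {}" by (auto simp: open_cone_def)
  qed
  moreover have "range (\<lambda>i. open_cone (E i)) \<subseteq> sets lborel" using E by auto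
  ultimately show ?thesis by (simp add: suminf_emeasure)
qed

text \<open>By the Lindelof property the regular points are covered by countably many of the balls of the local comparison.
  Both sides are countably additive, so the comparison holds globally with the same factor \<open>q\<close>, which tends to
  \<open>1\<close>.\<close>

lemma weighted_surface_eq_cone:
  fixes k :: real
  assumes k: "0 < k"
    and hk: "\<And>v F :: 'a set. norm v = 1 \<Longrightarrow> F \<in> sets borel \<Longrightarrow> F \<subseteq> {x. x \<bullet> v = 0} \<Longrightarrow>
       hausdorff_outer (DIM('a) - 1) F = ennreal k * emeasure lborel (prism v F 1)"
    and E: "E \<in> sets borel" "E \<subseteq> regular"
  shows "weighted_surface E = ennreal (real DIM('a) * k) * emeasure lborel (open_cone E)"
proof -
  let ?c = "real DIM('a) * k"
  have c0: "0 \<le> ?c" using k by simp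
  have both: "weighted_surface E \<le> ennreal q * (ennreal ?c * emeasure lborel (open_cone E)) \<and>
      ennreal ?c * emeasure lborel (open_cone E) \<le> ennreal q * weighted_surface E" if q: "1 < q" for q
  proof -
    define G where "G E \<longleftrightarrow> weighted_surface E \<le> ennreal (q * ?c) * emeasure lborel (open_cone E) \<and>
       ennreal ?c * emeasure lborel (open_cone E) \<le> ennreal q * weighted_surface E" for E
    have "\<exists>r>0. \<forall>E. E \<in> sets borel \<longrightarrow> E \<subseteq> regular \<longrightarrow> E \<subseteq> ball x r \<longrightarrow> G E" if x: "x \<in> regular" for x
      by (rule local_cone_measure[OF k hk x q]) (auto simp: G_def)
    then obtain r where r: "\<And>x. x \<in> regular \<Longrightarrow> 0 < r x"
      "\<And>x E. x \<in> regular \<Longrightarrow> E \<in> sets borel \<Longrightarrow> E \<subseteq> regular \<Longrightarrow> E \<subseteq> ball x (r x) \<Longrightarrow> G E"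
      by metis
    let ?F = "(\<lambda>x. ball x (r x)) ` regular"
    obtain F' where F': "F' \<subseteq> ?F" "countable F'" "\<Union>F' = \<Union>?F"
      by (rule Lindelof[of ?F]) auto
    have cov: "regular \<subseteq> \<Union>F'"
    proof
      fix x assume x: "x \<in> regular"
      then have "x \<in> ball x (r x)" using r(1) by simp
      then show "x \<in> \<Union>F'" unfolding F'(3) using x by blast
    qed
    define B where "B i = from_nat_into (insert {} F') i" for i
    have rB: "range B = insert {} F'"
      unfolding B_def using F'(2) by (intro range_from_nat_into) auto
    have Bo: "open (B i)" for i
    proof -
      have "B i \<in> insert {} F'" using rB by blast
      then show ?thesis using F'(1) by auto
    qed
    define A where "A i = E \<inter> disjointed B i" for i
    have dj: "disjointed B i \<in> sets borel" for i
      using Bo sets.range_disjointed_sets[of B borel] by (auto simp: image_subset_iff)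
    have A: "A i \<in> sets borel" "A i \<subseteq> regular" for i
      using dj[of i] E by (auto simp: A_def)
    have dis: "disjoint_family A"
      using disjoint_family_disjointed[of B] unfolding A_def disjoint_family_on_def by blast
    have U: "(\<Union>i. A i) = E"
    proof -
      have "(\<Union>i. A i) = E \<inter> (\<Union>i. disjointed B i)" by (auto simp: A_def)
      also have "\<dots> = E \<inter> (\<Union>i. B i)" by (simp only: UN_disjointed_eq)
      also have "\<dots> = E" using cov E(2) rB by auto
      finally show ?thesis .
    qed
    have each: "G (A i)" for i
    proof (cases "B i = {}")
      case True
      then have "A i = {}" using disjointed_subset[of B i] by (auto simp: A_def)
      then show ?thesis by (simp add: G_def weighted_surface_def open_cone_def)
    next
      case False
      have "B i \<in> insert {} F'" using rB by blast
      then obtain x where x: "x \<in> regular" "B i = ball x (r x)" using False F'(1) by blast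
      have "A i \<subseteq> ball x (r x)" using disjointed_subset[of B i] x(2) by (auto simp: A_def)
      then show ?thesis using r(2)[OF x(1) A] by blast
    qed
    have s1: "weighted_surface E = (\<Sum>i. weighted_surface (A i))"
      using weighted_surface_suminf[OF A dis] by (simp only: U)
    have s2: "emeasure lborel (open_cone E) = (\<Sum>i. emeasure lborel (open_cone (A i)))"
      using emeasure_open_cone_suminf[OF A(1) dis] by (simp only: U)
    have "weighted_surface E \<le> (\<Sum>i. ennreal (q * ?c) * emeasure lborel (open_cone (A i)))"
      unfolding s1 using each[unfolded G_def] by (intro suminf_le) auto
    moreover have "(\<Sum>i. ennreal ?c * emeasure lborel (open_cone (A i))) \<le> (\<Sum>i. ennreal q * weighted_surface (A i))"
      using each[unfolded G_def] by (intro suminf_le) auto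
    ultimately show ?thesis
      using q c0 by (simp add: s1 s2 ennreal_mult mult.assoc)
  qed
  show ?thesis
  proof (rule antisym)
    show "weighted_surface E \<le> ennreal ?c * emeasure lborel (open_cone E)"
      using both by (rule ennreal_le_if_le_all_factors[OF conjunct1])
    show "ennreal ?c * emeasure lborel (open_cone E) \<le> weighted_surface E"
      using both by (rule ennreal_le_if_le_all_factors[OF conjunct2])
  qed
qed


text \<open>Two measures on the boundary agree on all Borel sets: surface measure with density \<open>x \<bullet> \<nu> x\<close>, and the
  image of volume on the cone under \<open>radial\<close>.\<close>

lemma nn_integral_surface_eq_cone:
  fixes k :: real and f :: "'a \<Rightarrow> ennreal"
  assumes k: "0 < k"
    and hk: "\<And>v F :: 'a set. norm v = 1 \<Longrightarrow> F \<in> sets borel \<Longrightarrow> F \<subseteq> {x. x \<bullet> v = 0} \<Longrightarrow>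
       hausdorff_outer (DIM('a) - 1) F = ennreal k * emeasure lborel (prism v F 1)"
    and f[measurable]: "f \<in> borel_measurable borel"
  shows "(\<integral>\<^sup>+x. f x * (ennreal (x \<bullet> \<nu> x) * indicator regular x) \<partial>hausdorff_measure (DIM('a) - 1))
       = ennreal (real DIM('a) * k) * (\<integral>\<^sup>+y. f (radial y) * indicator (open_cone regular) y \<partial>lborel)"
proof -
  let ?H = "hausdorff_measure (DIM('a) - 1) :: 'a measure" and ?c = "ennreal (real DIM('a) * k)"
  let ?d = "\<lambda>x. ennreal (x \<bullet> \<nu> x) * indicator regular x"
  have m: "?d \<in> borel_measurable ?H"
    using support_density_measurable[OF regular_borel order_refl]
    by (simp add: measurable_cong_sets[OF sets_hausdorff_measure refl])
  define M where "M = density ?H ?d"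
  define M' where "M' = distr (density lborel (\<lambda>y. ?c * indicator (open_cone regular) y)) borel radial"
  have "M = M'"
  proof (rule measure_eqI)
    show "sets M = sets M'" by (simp add: M_def M'_def)
    fix A assume "A \<in> sets M"
    then have A[measurable]: "A \<in> sets borel" by (simp add: M_def)
    have "emeasure M A = (\<integral>\<^sup>+x. ?d x * indicator A x \<partial>?H)"
      unfolding M_def using m by (intro emeasure_density) auto
    also have "\<dots> = weighted_surface (A \<inter> regular)"
      unfolding weighted_surface_def by (intro nn_integral_cong) (auto simp: indicator_def)
    also have "\<dots> = ?c * emeasure lborel (open_cone (A \<inter> regular))"
      by (rule weighted_surface_eq_cone[OF k hk]) auto
    also have "\<dots> = ?c * (\<integral>\<^sup>+y. indicator (open_cone (A \<inter> regular)) y \<partial>lborel)"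
      by (subst nn_integral_indicator) auto
    also have "\<dots> = (\<integral>\<^sup>+y. ?c * indicator (open_cone (A \<inter> regular)) y \<partial>lborel)"
      by (rule nn_integral_cmult[symmetric]) measurable
    also have "\<dots> = (\<integral>\<^sup>+y. ?c * indicator (open_cone regular) y * indicator (radial -` A) y \<partial>lborel)"
      by (intro nn_integral_cong) (auto simp: indicator_def open_cone_def)
    also have "\<dots> = emeasure (density lborel (\<lambda>y. ?c * indicator (open_cone regular) y)) (radial -` A)"
      using measurable_sets[OF radial_measurable A] by (intro emeasure_density[symmetric]) auto
    also have "\<dots> = emeasure M' A"
      unfolding M'_def by (subst emeasure_distr) auto
    finally show "emeasure M A = emeasure M' A" .
  qed
  have fH: "f \<in> borel_measurable ?H" by (simp add: measurable_cong_sets[OF sets_hausdorff_measure refl])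
  have "(\<integral>\<^sup>+x. f x * ?d x \<partial>?H) = (\<integral>\<^sup>+x. ?d x * f x \<partial>?H)" by (simp only: mult.commute)
  also have "\<dots> = (\<integral>\<^sup>+x. f x \<partial>M)"
    unfolding M_def by (rule nn_integral_density[OF m fH, symmetric])
  also have "\<dots> = (\<integral>\<^sup>+y. f (radial y) \<partial>density lborel (\<lambda>y. ?c * indicator (open_cone regular) y))"
    unfolding \<open>M = M'\<close> M'_def by (rule nn_integral_distr) auto
  also have "\<dots> = (\<integral>\<^sup>+y. ?c * indicator (open_cone regular) y * f (radial y) \<partial>lborel)"
    by (rule nn_integral_density) auto
  also have "\<dots> = (\<integral>\<^sup>+y. ?c * (f (radial y) * indicator (open_cone regular) y) \<partial>lborel)"
    by (simp only: mult_ac)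
  also have "\<dots> = ?c * (\<integral>\<^sup>+y. f (radial y) * indicator (open_cone regular) y \<partial>lborel)"
    by (rule nn_integral_cmult) measurable
  finally show ?thesis .
qed

subsection \<open>Almost every direction is regular\<close>

definition touching_normal :: "'a \<Rightarrow> 'a" where
  "touching_normal y = (SOME v. v \<in> sphere 0 1 \<and> N y = y \<bullet> v / h v)"

lemma touching_normal: "touching_normal y \<in> sphere 0 1" "N y = y \<bullet> touching_normal y / h (touching_normal y)"
proof -
  have "\<exists>v. v \<in> sphere 0 1 \<and> N y = y \<bullet> v / h v" using wulff_gauge_attained[OF pos, of y] by blast
  from someI_ex[OF this] show "touching_normal y \<in> sphere 0 1" "N y = y \<bullet> touching_normal y / h (touching_normal y)"
    by (auto simp: touching_normal_def)
qed

text \<open>Points at which the one-sided derivatives of the gauge in direction \<open>b\<close> differ, expressed by second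
  difference quotients so that the set is visibly Borel.\<close>

definition kink_set :: "'a \<Rightarrow> 'a set" where
  "kink_set b = {y. \<exists>m::nat. \<forall>j::nat. 1 / real (Suc m) \<le>
     real (Suc j) * (N (y + (1 / real (Suc j)) *\<^sub>R b) + N (y - (1 / real (Suc j)) *\<^sub>R b) - 2 * N y)}"

lemma kink_set_borel [measurable]: "kink_set b \<in> sets borel"
  unfolding kink_set_def by measurable

text \<open>Along a line the coefficient of a chosen subgradient is monotone, and it jumps at every kink.\<close>

lemma countable_kinks_on_line: "countable {s. y + s *\<^sub>R b \<in> kink_set b}"
proof -
  \<comment> \<open>coefficient in direction \<open>b\<close> of a subgradient of the gauge\<close>
  define p where "p s = touching_normal (y + s *\<^sub>R b) \<bullet> b / h (touching_normal (y + s *\<^sub>R b))" for s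
  have sub: "N (y + s *\<^sub>R b) + (t - s) * p s \<le> N (y + t *\<^sub>R b)" for s t
  proof -
    let ?v = "touching_normal (y + s *\<^sub>R b)"
    have "(y + t *\<^sub>R b) \<bullet> ?v / h ?v \<le> N (y + t *\<^sub>R b)" by (rule N_upper[OF touching_normal(1)])
    moreover have "(y + t *\<^sub>R b) \<bullet> ?v / h ?v = (y + s *\<^sub>R b) \<bullet> ?v / h ?v + (t - s) * p s"
      by (simp add: p_def inner_add_left inner_commute[of b] algebra_simps add_divide_distrib diff_divide_distrib)
    ultimately show ?thesis using touching_normal(2)[of "y + s *\<^sub>R b"] by simp
  qed
  have "mono p"
  proof (rule monoI)
    fix s t :: real assume "s \<le> t"
    have "0 \<le> (t - s) * (p t - p s)" using sub[of s t] sub[of t s] by (simp add: algebra_simps)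
    then show "p s \<le> p t" using \<open>s \<le> t\<close> by (cases "s = t") (auto simp: zero_le_mult_iff)
  qed
  then have "countable {s. \<not> isCont p s}" by (rule mono_ctble_discont)
  moreover have "{s. y + s *\<^sub>R b \<in> kink_set b} \<subseteq> {s. \<not> isCont p s}"
  proof (intro subsetI CollectI notI)
    fix s assume "s \<in> {s. y + s *\<^sub>R b \<in> kink_set b}" and c: "isCont p s"
    then obtain m :: nat where m: "\<And>j. 1 / real (Suc m) \<le> real (Suc j) *
        (N (y + s *\<^sub>R b + (1 / real (Suc j)) *\<^sub>R b) + N (y + s *\<^sub>R b - (1 / real (Suc j)) *\<^sub>R b) - 2 * N (y + s *\<^sub>R b))"
      by (auto simp: kink_set_def)
    have jump: "1 / real (Suc m) \<le> p (s + 1 / real (Suc j)) - p (s - 1 / real (Suc j))" for j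
    proof -
      define r where "r = 1 / real (Suc j)"
      have r: "0 < r" "real (Suc j) * r = 1" by (auto simp: r_def)
      have "N (y + (s + r) *\<^sub>R b) + N (y + (s - r) *\<^sub>R b) - 2 * N (y + s *\<^sub>R b) \<le> r * (p (s + r) - p (s - r))"
        using sub[of "s + r" s] sub[of "s - r" s] by (simp add: algebra_simps)
      then have "real (Suc j) * (N (y + (s + r) *\<^sub>R b) + N (y + (s - r) *\<^sub>R b) - 2 * N (y + s *\<^sub>R b))
          \<le> real (Suc j) * (r * (p (s + r) - p (s - r)))"
        by (intro mult_left_mono) auto
      also have "\<dots> = p (s + r) - p (s - r)" using r(2) by (simp only: mult.assoc[symmetric] mult_1)
      finally show ?thesis using m[of j] unfolding r_def[symmetric] by (simp add: algebra_simps)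
    qed
    have "(\<lambda>j. s + 1 / real (Suc j)) \<longlonglongrightarrow> s + 0" "(\<lambda>j. s - 1 / real (Suc j)) \<longlonglongrightarrow> s - 0"
      using LIMSEQ_inverse_real_of_nat by (intro tendsto_intros; simp add: inverse_eq_divide)+
    then have "(\<lambda>j. p (s + 1 / real (Suc j)) - p (s - 1 / real (Suc j))) \<longlonglongrightarrow> p s - p s"
      using c by (intro tendsto_diff isCont_tendsto_compose[OF c]) auto
    then have "1 / real (Suc m) \<le> p s - p s" using jump by (intro LIMSEQ_le_const[of _ "p s - p s"]) auto
    then show False by simp
  qed
  ultimately show ?thesis by (rule countable_subset[rotated])
qed

text \<open>Translates of the kink set by multiples of \<open>b\<close> have the same volume; averaging over them and
  integrating along \<open>b\<close> first gives \<open>0\<close>.\<close>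

lemma emeasure_kink_set: "emeasure lborel (kink_set b) = 0"
proof -
  let ?I = "{0..1::real}"
  have [measurable]: "?I \<in> sets borel" by simp
  have null: "(\<integral>\<^sup>+s. indicator ?I s * indicator (kink_set b) (y + s *\<^sub>R b) \<partial>lborel) = 0" for y
  proof -
    have "emeasure lborel {s. y + s *\<^sub>R b \<in> kink_set b} = 0"
      by (rule emeasure_lborel_countable[OF countable_kinks_on_line])
    moreover have "{s. y + s *\<^sub>R b \<in> kink_set b} \<in> sets borel" by measurable
    ultimately have "(\<integral>\<^sup>+s. indicator {s. y + s *\<^sub>R b \<in> kink_set b} s \<partial>lborel) = 0" by simp
    moreover have "(\<integral>\<^sup>+s. indicator ?I s * indicator (kink_set b) (y + s *\<^sub>R b) \<partial>lborel)
        \<le> (\<integral>\<^sup>+s. indicator {s. y + s *\<^sub>R b \<in> kink_set b} s \<partial>lborel)"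
      by (intro nn_integral_mono) (auto simp: indicator_def)
    ultimately show ?thesis by simp
  qed
  have "emeasure lborel (kink_set b) = (\<integral>\<^sup>+s. indicator ?I s * emeasure lborel (kink_set b) \<partial>lborel)"
    by (subst nn_integral_multc) auto
  also have "\<dots> = (\<integral>\<^sup>+s. (\<integral>\<^sup>+y. indicator ?I s * indicator (kink_set b) (y + s *\<^sub>R b) \<partial>lborel) \<partial>lborel)"
  proof (rule nn_integral_cong)
    fix s :: real
    have "(\<integral>\<^sup>+y. indicator (kink_set b) (y + s *\<^sub>R b) \<partial>lborel) = (\<integral>\<^sup>+y. indicator {y. s *\<^sub>R b + y \<in> kink_set b} y \<partial>lborel)"
      by (intro nn_integral_cong) (auto simp: indicator_def add.commute)
    also have "\<dots> = emeasure lborel {y. s *\<^sub>R b + y \<in> kink_set b}"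
      by (rule nn_integral_indicator) measurable
    also have "\<dots> = emeasure lborel (kink_set b)" by (rule emeasure_lborel_translate) measurable
    finally have "(\<integral>\<^sup>+y. indicator (kink_set b) (y + s *\<^sub>R b) \<partial>lborel) = emeasure lborel (kink_set b)" .
    moreover have "(\<integral>\<^sup>+y. indicator ?I s * indicator (kink_set b) (y + s *\<^sub>R b) \<partial>lborel)
        = indicator ?I s * (\<integral>\<^sup>+y. indicator (kink_set b) (y + s *\<^sub>R b) \<partial>lborel)"
      by (rule nn_integral_cmult) measurable
    ultimately show "indicator ?I s * emeasure lborel (kink_set b)
        = (\<integral>\<^sup>+y. indicator ?I s * indicator (kink_set b) (y + s *\<^sub>R b) \<partial>lborel)" by simp
  qed
  also have "\<dots> = (\<integral>\<^sup>+y. (\<integral>\<^sup>+s. indicator ?I s * indicator (kink_set b) (y + s *\<^sub>R b) \<partial>lborel) \<partial>lborel)"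
    by (rule lborel_pair.Fubini'[symmetric]) measurable
  also have "\<dots> = 0" by (simp only: null) simp
  finally show ?thesis .
qed

text \<open>Two outer normals \<open>v\<close>, \<open>w\<close> at \<open>radial y\<close> give two subgradients \<open>v / h v\<close>, \<open>w / h w\<close> of the gauge at
  \<open>y\<close>, which differ in some coordinate.\<close>

lemma irregular_in_kink_set:
  assumes y: "y \<noteq> 0" and irr: "radial y \<notin> regular"
  shows "\<exists>b\<in>Basis. y \<in> kink_set b"
proof -
  have N1: "N (radial y) = 1" by (rule N_radial[OF y])
  obtain v where v: "outer_unit_normal K (radial y) v" using ex_outer_unit_normal[OF N1] .
  have "\<not> (\<exists>!v. outer_unit_normal K (radial y) v)" using irr N1 by (simp add: regular_def frontier_K)
  then obtain w where w: "outer_unit_normal K (radial y) w" "w \<noteq> v" using v by blast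
  have vw: "v \<in> sphere 0 1" "radial y \<bullet> v = h v" "w \<in> sphere 0 1" "radial y \<bullet> w = h w"
    using v w(1) N1 outer_unit_normal_iff[of "radial y"] by auto
  have sub: "N y + (z - y) \<bullet> u / h u \<le> N z" if u: "u \<in> sphere 0 1" "radial y \<bullet> u = h u" for u z
  proof -
    have "y \<bullet> u = N y * h u" using scale_radial[of y] u(2) by (metis inner_scaleR_left)
    then have "y \<bullet> u / h u = N y" using h_pos[OF u(1)] by simp
    then show ?thesis using N_upper[OF u(1), of z] by (simp add: inner_diff_left diff_divide_distrib)
  qed
  have "v /\<^sub>R h v \<noteq> w /\<^sub>R h w"
  proof
    assume eq: "v /\<^sub>R h v = w /\<^sub>R h w"
    then have "norm (v /\<^sub>R h v) = norm (w /\<^sub>R h w)" by simp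
    then have "h v = h w" using h_pos[OF vw(1)] h_pos[OF vw(3)] vw(1,3) by simp
    then show False using eq w(2) h_pos[OF vw(3)] by simp
  qed
  then obtain b where b: "b \<in> Basis" "(v /\<^sub>R h v) \<bullet> b \<noteq> (w /\<^sub>R h w) \<bullet> b" by (meson euclidean_eqI)
  have kink: "y \<in> kink_set b" if u: "u \<in> sphere 0 1" "radial y \<bullet> u = h u" and u': "u' \<in> sphere 0 1" "radial y \<bullet> u' = h u'"
    and lt: "b \<bullet> u' / h u' < b \<bullet> u / h u" for u u'
  proof -
    obtain m :: nat where m: "inverse (real (Suc m)) < b \<bullet> u / h u - b \<bullet> u' / h u'"
      using reals_Archimedean lt by (metis diff_gt_0_iff_gt)
    have "1 / real (Suc m) \<le> real (Suc j) * (N (y + (1 / real (Suc j)) *\<^sub>R b) + N (y - (1 / real (Suc j)) *\<^sub>R b) - 2 * N y)" for j :: nat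
    proof -
      define r where "r = 1 / real (Suc j)"
      have r: "real (Suc j) * r = 1" by (simp add: r_def)
      have "r * (b \<bullet> u / h u - b \<bullet> u' / h u') \<le> N (y + r *\<^sub>R b) + N (y - r *\<^sub>R b) - 2 * N y"
        using sub[OF u, of "y + r *\<^sub>R b"] sub[OF u', of "y - r *\<^sub>R b"] by (simp add: algebra_simps)
      then have "real (Suc j) * (r * (b \<bullet> u / h u - b \<bullet> u' / h u')) \<le> real (Suc j) * (N (y + r *\<^sub>R b) + N (y - r *\<^sub>R b) - 2 * N y)"
        by (rule mult_left_mono) simp
      then show ?thesis using m unfolding mult.assoc[symmetric] r r_def[symmetric] by (simp add: inverse_eq_divide)
    qed
    then show ?thesis by (auto simp: kink_set_def)
  qed
  have "b \<bullet> v / h v \<noteq> b \<bullet> w / h w" using b(2) by (simp add: inner_commute[of b] divide_inverse mult.commute)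
  then show ?thesis using kink[of v w] kink[of w v] vw b(1) by (meson linorder_neqE)
qed

lemma AE_regular: "AE y in lborel. y \<noteq> 0 \<longrightarrow> radial y \<in> regular"
proof -
  have "emeasure lborel (\<Union>b\<in>Basis. kink_set b) = 0"
  proof -
    have "(\<Union>b\<in>Basis. kink_set b) \<in> null_sets lborel"
      by (intro null_sets.finite_UN) (auto simp: null_sets_def emeasure_kink_set)
    then show ?thesis by (simp add: null_sets_def)
  qed
  then have "(\<Union>b\<in>Basis. kink_set b) \<in> null_sets lborel" by (auto simp: null_sets_def)
  then show ?thesis
    by (rule AE_I') (use irregular_in_kink_set in auto)
qed

end

lemma nn_integral_power_interval:
  assumes c: "0 < c" and D: "0 < D"
  shows "(\<integral>\<^sup>+l. ennreal (real D * l ^ (D - 1) * c ^ D) * indicator {l. 0 < l \<and> l * c < 1} l \<partial>lborel) = 1"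
proof -
  have "(\<integral>\<^sup>+l. ennreal (real D * l ^ (D - 1) * c ^ D) * indicator {l. 0 < l \<and> l * c < 1} l \<partial>lborel)
      = (\<integral>\<^sup>+l. ennreal (real D * l ^ (D - 1) * c ^ D) * indicator {0..1 / c} l \<partial>lborel)"
  proof (rule nn_integral_cong_AE)
    show "AE l in lborel. ennreal (real D * l ^ (D - 1) * c ^ D) * indicator {l. 0 < l \<and> l * c < 1} l
        = ennreal (real D * l ^ (D - 1) * c ^ D) * indicator {0..1 / c} l"
      using AE_lborel_singleton[of "0::real"] AE_lborel_singleton[of "1 / c"]
    proof eventually_elim
      case (elim l)
      then have "(0 < l \<and> l * c < 1) \<longleftrightarrow> l \<in> {0..1 / c}"
        using c by (auto simp: field_simps)
      then show ?case by (simp add: indicator_def)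
    qed
  qed
  also have "\<dots> = ennreal ((1 / c) ^ D * c ^ D - 0 ^ D * c ^ D)"
  proof (rule nn_integral_FTC_Icc)
    fix x :: real
    show "DERIV (\<lambda>x. x ^ D * c ^ D) x :> real D * x ^ (D - 1) * c ^ D"
      by (auto intro!: derivative_eq_intros)
  qed (use c in auto)
  also have "\<dots> = 1" using c D by (simp add: power_mult_distrib[symmetric] zero_power)
  finally show ?thesis .
qed

context supported_wulff begin

text \<open>Polar coordinates adapted to the gauge: every nonzero point is \<open>radial z /\<^sub>R t\<close>. Inserting a weight
  \<open>\<integral> D \<lambda> ^ (D - 1) N y ^ D = 1\<close> over \<open>0 < \<lambda> < 1 / N y\<close> and rescaling by \<open>\<lambda>\<close> moves the
  integration to the body.\<close>

lemma nn_integral_gauge_polar: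
  fixes F :: "'a \<Rightarrow> ennreal"
  assumes F[measurable]: "F \<in> borel_measurable borel"
  shows "(\<integral>\<^sup>+y. F y \<partial>lborel) = (\<integral>\<^sup>+z. indicator {z. 0 < N z \<and> N z < 1} z *
     (\<integral>\<^sup>+t. ennreal (real DIM('a) / t ^ (DIM('a) + 1)) * indicator {0<..} t * F (radial z /\<^sub>R t) \<partial>lborel) \<partial>lborel)"
proof -
  let ?D = "DIM('a)"
  have D0: "0 < ?D" by simp
  have "(\<integral>\<^sup>+y. F y \<partial>lborel) = (\<integral>\<^sup>+y. (\<integral>\<^sup>+l. F y * (indicator {y. 0 < N y} y *
      (ennreal (real ?D * l ^ (?D - 1) * N y ^ ?D) * indicator {l. 0 < l \<and> l * N y < 1} l)) \<partial>lborel) \<partial>lborel)"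
  proof (rule nn_integral_cong_AE, rule AE_mp[OF AE_lborel_singleton[of "0::'a"]], rule AE_I2, rule impI)
    fix y :: 'a assume "y \<noteq> 0"
    then have Ny: "0 < N y" by (rule N_pos)
    have "(\<integral>\<^sup>+l. F y * (indicator {y. 0 < N y} y *
      (ennreal (real ?D * l ^ (?D - 1) * N y ^ ?D) * indicator {l. 0 < l \<and> l * N y < 1} l)) \<partial>lborel)
      = F y * (\<integral>\<^sup>+l. ennreal (real ?D * l ^ (?D - 1) * N y ^ ?D) * indicator {l. 0 < l \<and> l * N y < 1} l \<partial>lborel)"
      using Ny by (subst nn_integral_cmult) auto
    then show "F y = (\<integral>\<^sup>+l. F y * (indicator {y. 0 < N y} y *
      (ennreal (real ?D * l ^ (?D - 1) * N y ^ ?D) * indicator {l. 0 < l \<and> l * N y < 1} l)) \<partial>lborel)"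
      by (simp only: nn_integral_power_interval[OF Ny D0] mult_1_right)
  qed
  also have "\<dots> = (\<integral>\<^sup>+y. (\<integral>\<^sup>+l. F y * (indicator {0<..} (N y) *
      (ennreal (real ?D * l ^ (?D - 1) * N y ^ ?D) * (indicator {0<..} l * indicator {..<1} (l * N y)))) \<partial>lborel) \<partial>lborel)"
    by (intro nn_integral_cong) (auto simp: indicator_def)
  also have "\<dots> = (\<integral>\<^sup>+l. (\<integral>\<^sup>+y. F y * (indicator {0<..} (N y) *
      (ennreal (real ?D * l ^ (?D - 1) * N y ^ ?D) * (indicator {0<..} l * indicator {..<1} (l * N y)))) \<partial>lborel) \<partial>lborel)"
    by (rule lborel_pair.Fubini'[symmetric]) measurable
  also have "\<dots> = (\<integral>\<^sup>+l. (\<integral>\<^sup>+z. F (z /\<^sub>R l) * (indicator {0<..} (N z) * indicator {..<1} (N z) *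
      (ennreal (real ?D * N z ^ ?D / l ^ (?D + 1)) * indicator {0<..} l)) \<partial>lborel) \<partial>lborel)"
  proof (rule nn_integral_cong)
    fix l :: real
    show "(\<integral>\<^sup>+y. F y * (indicator {0<..} (N y) *
        (ennreal (real ?D * l ^ (?D - 1) * N y ^ ?D) * (indicator {0<..} l * indicator {..<1} (l * N y)))) \<partial>lborel)
      = (\<integral>\<^sup>+z. F (z /\<^sub>R l) * (indicator {0<..} (N z) * indicator {..<1} (N z) *
        (ennreal (real ?D * N z ^ ?D / l ^ (?D + 1)) * indicator {0<..} l)) \<partial>lborel)"
    proof (cases "0 < l")
      case True
      let ?c = "1 / l"
      have c: "0 < ?c" using True by simp
      have "(\<integral>\<^sup>+y. F y * (indicator {0<..} (N y) *
        (ennreal (real ?D * l ^ (?D - 1) * N y ^ ?D) * (indicator {0<..} l * indicator {..<1} (l * N y)))) \<partial>lborel)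
        = ennreal (?c ^ ?D) * (\<integral>\<^sup>+z. F (?c *\<^sub>R z) * (indicator {0<..} (N (?c *\<^sub>R z)) *
        (ennreal (real ?D * l ^ (?D - 1) * N (?c *\<^sub>R z) ^ ?D) * (indicator {0<..} l * indicator {..<1} (l * N (?c *\<^sub>R z))))) \<partial>lborel)"
        by (rule nn_integral_lborel_scale[OF c]) measurable
      also have "\<dots> = (\<integral>\<^sup>+z. ennreal (?c ^ ?D) * (F (?c *\<^sub>R z) * (indicator {0<..} (N (?c *\<^sub>R z)) *
        (ennreal (real ?D * l ^ (?D - 1) * N (?c *\<^sub>R z) ^ ?D) * (indicator {0<..} l * indicator {..<1} (l * N (?c *\<^sub>R z)))))) \<partial>lborel)"
        by (rule nn_integral_cmult[symmetric]) measurable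
      also have "\<dots> = (\<integral>\<^sup>+z. F (z /\<^sub>R l) * (indicator {0<..} (N z) * indicator {..<1} (N z) *
        (ennreal (real ?D * N z ^ ?D / l ^ (?D + 1)) * indicator {0<..} l)) \<partial>lborel)"
      proof (rule nn_integral_cong)
        fix z :: 'a
        have Nc: "N (?c *\<^sub>R z) = N z / l" using N_scale[of ?c z] True by simp
        have l1: "l * N (?c *\<^sub>R z) = N z" using True by (simp add: Nc)
        have l2: "0 < N (?c *\<^sub>R z) \<longleftrightarrow> 0 < N z" using True by (simp add: Nc zero_less_divide_iff)
        have "?c ^ ?D * (real ?D * l ^ (?D - 1) * N (?c *\<^sub>R z) ^ ?D) = real ?D * N z ^ ?D / l ^ (?D + 1)"
        proof -
          have "l * l ^ (?D - 1) = l ^ ?D" using D0 by (metis power_minus_mult mult.commute)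
          then have "l ^ (?D - 1) = l ^ ?D / l" using True by (simp add: field_simps)
          then show ?thesis using True by (simp add: Nc power_divide)
        qed
        then have e: "ennreal (?c ^ ?D) * ennreal (real ?D * l ^ (?D - 1) * N (?c *\<^sub>R z) ^ ?D) = ennreal (real ?D * N z ^ ?D / l ^ (?D + 1))"
          using True N_nonneg[of "?c *\<^sub>R z"] by (subst ennreal_mult[symmetric]) auto
        have "ennreal (?c ^ ?D) * (F (?c *\<^sub>R z) * (indicator {0<..} (N (?c *\<^sub>R z)) *
          (ennreal (real ?D * l ^ (?D - 1) * N (?c *\<^sub>R z) ^ ?D) * (indicator {0<..} l * indicator {..<1} (l * N (?c *\<^sub>R z))))))
          = F (?c *\<^sub>R z) * (indicator {0<..} (N (?c *\<^sub>R z)) * indicator {..<1} (l * N (?c *\<^sub>R z)) *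
          ((ennreal (?c ^ ?D) * ennreal (real ?D * l ^ (?D - 1) * N (?c *\<^sub>R z) ^ ?D)) * indicator {0<..} l))"
          by (simp only: mult_ac)
        also have "\<dots> = F (z /\<^sub>R l) * (indicator {0<..} (N z) * indicator {..<1} (N z) *
          (ennreal (real ?D * N z ^ ?D / l ^ (?D + 1)) * indicator {0<..} l))"
          unfolding e l1 using l2 by (simp add: indicator_def inverse_eq_divide)
        finally show "ennreal (?c ^ ?D) * (F (?c *\<^sub>R z) * (indicator {0<..} (N (?c *\<^sub>R z)) *
          (ennreal (real ?D * l ^ (?D - 1) * N (?c *\<^sub>R z) ^ ?D) * (indicator {0<..} l * indicator {..<1} (l * N (?c *\<^sub>R z))))))
          = F (z /\<^sub>R l) * (indicator {0<..} (N z) * indicator {..<1} (N z) *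
          (ennreal (real ?D * N z ^ ?D / l ^ (?D + 1)) * indicator {0<..} l))" .
      qed
      finally show ?thesis .
    qed simp
  qed
  also have "\<dots> = (\<integral>\<^sup>+z. (\<integral>\<^sup>+l. F (z /\<^sub>R l) * (indicator {0<..} (N z) * indicator {..<1} (N z) *
      (ennreal (real ?D * N z ^ ?D / l ^ (?D + 1)) * indicator {0<..} l)) \<partial>lborel) \<partial>lborel)"
    by (rule lborel_pair.Fubini') measurable
  also have "\<dots> = (\<integral>\<^sup>+z. indicator {z. 0 < N z \<and> N z < 1} z *
     (\<integral>\<^sup>+t. ennreal (real ?D / t ^ (?D + 1)) * indicator {0<..} t * F (radial z /\<^sub>R t) \<partial>lborel) \<partial>lborel)"
  proof (rule nn_integral_cong)
    fix z :: 'a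
    show "(\<integral>\<^sup>+l. F (z /\<^sub>R l) * (indicator {0<..} (N z) * indicator {..<1} (N z) *
      (ennreal (real ?D * N z ^ ?D / l ^ (?D + 1)) * indicator {0<..} l)) \<partial>lborel)
      = indicator {z. 0 < N z \<and> N z < 1} z *
     (\<integral>\<^sup>+t. ennreal (real ?D / t ^ (?D + 1)) * indicator {0<..} t * F (radial z /\<^sub>R t) \<partial>lborel)"
    proof (cases "0 < N z \<and> N z < 1")
      case True
      let ?n = "N z"
      have n: "0 < ?n" using True by simp
      have "(\<integral>\<^sup>+l. F (z /\<^sub>R l) * (ennreal (real ?D * ?n ^ ?D / l ^ (?D + 1)) * indicator {0<..} l) \<partial>lborel)
         = ennreal \<bar>?n\<bar> * (\<integral>\<^sup>+t. F (z /\<^sub>R (0 + ?n * t)) * (ennreal (real ?D * ?n ^ ?D / (0 + ?n * t) ^ (?D + 1)) * indicator {0<..} (0 + ?n * t)) \<partial>lborel)"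
        by (rule nn_integral_real_affine) (use n in auto)
      also have "\<dots> = (\<integral>\<^sup>+t. ennreal \<bar>?n\<bar> * (F (z /\<^sub>R (0 + ?n * t)) * (ennreal (real ?D * ?n ^ ?D / (0 + ?n * t) ^ (?D + 1)) * indicator {0<..} (0 + ?n * t))) \<partial>lborel)"
        by (rule nn_integral_cmult[symmetric]) measurable
      also have "\<dots> = (\<integral>\<^sup>+t. ennreal (real ?D / t ^ (?D + 1)) * indicator {0<..} t * F (radial z /\<^sub>R t) \<partial>lborel)"
      proof (rule nn_integral_cong)
        fix t :: real
        show "ennreal \<bar>?n\<bar> * (F (z /\<^sub>R (0 + ?n * t)) * (ennreal (real ?D * ?n ^ ?D / (0 + ?n * t) ^ (?D + 1)) * indicator {0<..} (0 + ?n * t)))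
          = ennreal (real ?D / t ^ (?D + 1)) * indicator {0<..} t * F (radial z /\<^sub>R t)"
        proof (cases "0 < t")
          case t: True
          have r: "z /\<^sub>R (0 + ?n * t) = radial z /\<^sub>R t" by (simp add: radial_def mult.commute)
          have "?n * (real ?D * ?n ^ ?D / (0 + ?n * t) ^ (?D + 1)) = real ?D / t ^ (?D + 1)"
            using n t by (simp add: power_mult_distrib field_simps)
          then have e: "ennreal \<bar>?n\<bar> * ennreal (real ?D * ?n ^ ?D / (0 + ?n * t) ^ (?D + 1)) = ennreal (real ?D / t ^ (?D + 1))"
            using n t by (subst ennreal_mult[symmetric]) auto
          have "ennreal \<bar>?n\<bar> * (F (z /\<^sub>R (0 + ?n * t)) * (ennreal (real ?D * ?n ^ ?D / (0 + ?n * t) ^ (?D + 1)) * indicator {0<..} (0 + ?n * t)))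
            = (ennreal \<bar>?n\<bar> * ennreal (real ?D * ?n ^ ?D / (0 + ?n * t) ^ (?D + 1))) * indicator {0<..} (0 + ?n * t) * F (z /\<^sub>R (0 + ?n * t))"
            by (simp only: mult_ac)
          then show ?thesis unfolding e r using n t by simp
        next
          case False
          then have "\<not> 0 < ?n * t" using n by (simp add: zero_less_mult_iff)
          then show ?thesis using False by simp
        qed
      qed
      finally show ?thesis using True by simp
    next
      case False
      then show ?thesis by (auto simp: indicator_def)
    qed
  qed
  finally show ?thesis .
qed

end

section \<open>Maximising Gaussian volume\<close>

text \<open>Not normalised: constant factors do not affect the maximisers.\<close>

definition gaussian :: "'a::euclidean_space measure" where
  "gaussian = density lborel (\<lambda>x. ennreal (exp (- (norm x)\<^sup>2 / 2)))"

lemma sets_gaussian [simp, measurable_cong]: "sets gaussian = sets borel"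
  by (simp add: gaussian_def)

lemma space_gaussian [simp]: "space gaussian = UNIV"
  by (simp add: gaussian_def)

lemma emeasure_gaussian:
  assumes "A \<in> sets borel"
  shows "emeasure gaussian A = (\<integral>\<^sup>+x. ennreal (exp (- (norm x)\<^sup>2 / 2)) * indicator A x \<partial>lborel)"
  unfolding gaussian_def using assms by (intro emeasure_density) auto

lemma emeasure_gaussian_finite: "emeasure (gaussian :: 'a::euclidean_space measure) A < \<infinity>"
proof -
  have one: "(\<integral>\<^sup>+t. ennreal (exp (- t\<^sup>2 / 2)) \<partial>lborel) < \<infinity>"
  proof -
    interpret prob_space "density lborel std_normal_density" by (rule prob_space_normal_density) simp
    have "(\<integral>\<^sup>+t. ennreal (std_normal_density t) \<partial>lborel) = 1"
      using emeasure_space_1 by (simp add: emeasure_density)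
    moreover have "(\<integral>\<^sup>+t. ennreal (exp (- t\<^sup>2 / 2)) \<partial>lborel) = (\<integral>\<^sup>+t. ennreal (sqrt (2 * pi)) * ennreal (std_normal_density t) \<partial>lborel)"
      by (intro nn_integral_cong) (simp add: std_normal_density_def ennreal_mult[symmetric])
    ultimately show ?thesis by (simp add: nn_integral_cmult)
  qed
  have "ennreal (exp (- (norm x)\<^sup>2 / 2)) = (\<Prod>b\<in>Basis. ennreal (exp (- (x \<bullet> b)\<^sup>2 / 2)))" for x :: 'a
  proof -
    have "(norm x)\<^sup>2 = (\<Sum>b\<in>Basis. (x \<bullet> b)\<^sup>2)"
      unfolding power2_norm_eq_inner by (subst euclidean_inner) (simp add: power2_eq_square)
    then have "exp (- (norm x)\<^sup>2 / 2) = (\<Prod>b\<in>Basis. exp (- (x \<bullet> b)\<^sup>2 / 2))"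
      by (simp add: exp_sum[symmetric] sum_negf sum_divide_distrib)
    then show ?thesis by (simp add: prod_ennreal)
  qed
  then have "emeasure (gaussian :: 'a measure) UNIV = (\<integral>\<^sup>+x. (\<Prod>b\<in>Basis. ennreal (exp (- (x \<bullet> b)\<^sup>2 / 2))) \<partial>(lborel :: 'a measure))"
    by (simp add: emeasure_gaussian)
  also have "\<dots> = (\<Prod>b\<in>(Basis :: 'a set). \<integral>\<^sup>+t. ennreal (exp (- t\<^sup>2 / 2)) \<partial>lborel)"
    by (rule nn_integral_lborel_prod) auto
  also have "\<dots> < \<infinity>" using one by (simp add: power_less_top_ennreal)
  finally have "emeasure (gaussian :: 'a measure) UNIV < \<infinity>" .
  moreover have "emeasure (gaussian :: 'a measure) A \<le> emeasure (gaussian :: 'a measure) UNIV"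
    using emeasure_space[of "gaussian :: 'a measure" A] by simp
  ultimately show ?thesis by (rule le_less_trans[rotated])
qed

lemma emeasure_gaussian_reflect:
  fixes A :: "'a::euclidean_space set"
  assumes [measurable]: "A \<in> sets borel"
  shows "emeasure gaussian {x. reflect v x \<in> A} = emeasure gaussian A"
proof -
  have lb: "distr lborel borel (reflect v) = (lborel :: 'a measure)"
  proof (rule measure_eqI)
    fix B :: "'a set" assume "B \<in> sets (distr lborel borel (reflect v))"
    then have "B \<in> sets borel" by simp
    then show "emeasure (distr lborel borel (reflect v)) B = emeasure lborel B"
      using emeasure_lborel_reflect[of B v] by (subst emeasure_distr) (auto simp: vimage_def)
  qed simp
  have S: "{x. reflect v x \<in> A} \<in> sets borel" by measurable
  have "emeasure gaussian A = (\<integral>\<^sup>+x. ennreal (exp (- (norm x)\<^sup>2 / 2)) * indicator A x \<partial>distr lborel borel (reflect v))"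
    unfolding lb by (simp add: emeasure_gaussian)
  also have "\<dots> = (\<integral>\<^sup>+x. ennreal (exp (- (norm (reflect v x))\<^sup>2 / 2)) * indicator A (reflect v x) \<partial>lborel)"
    by (rule nn_integral_distr) auto
  also have "\<dots> = (\<integral>\<^sup>+x. ennreal (exp (- (norm x)\<^sup>2 / 2)) * indicator {x. reflect v x \<in> A} x \<partial>lborel)"
    by (intro nn_integral_cong) (simp add: indicator_def)
  also have "\<dots> = emeasure gaussian {x. reflect v x \<in> A}"
    by (simp only: emeasure_gaussian[OF S])
  finally show ?thesis by simp
qed

text \<open>A reflection moves the slab to a coordinate direction, where the slabs shrink to a null set; the bound
  is thus uniform in \<open>v\<close>.\<close>

lemma gaussian_slab_small:
  assumes e: "0 < e"
  obtains \<delta> where "0 < \<delta>" "\<And>v :: 'a::euclidean_space. norm v = 1 \<Longrightarrow> emeasure gaussian {x. \<bar>x \<bullet> v\<bar> \<le> \<delta>} < ennreal e"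
proof -
  obtain b :: 'a where b: "b \<in> Basis" using nonempty_Basis by blast
  define S where "S k = {x :: 'a. \<bar>x \<bullet> b\<bar> \<le> 1 / real (Suc k)}" for k
  have S[measurable]: "S k \<in> sets borel" for k unfolding S_def by measurable
  have "(\<lambda>k. emeasure gaussian (S k)) \<longlonglongrightarrow> emeasure gaussian (\<Inter>k. S k)"
  proof (rule Lim_emeasure_decseq)
    show "decseq S" unfolding decseq_def S_def
      by (auto intro: order_trans simp: frac_le)
    show "emeasure gaussian (S i) \<noteq> \<infinity>" for i using emeasure_gaussian_finite[of "S i"] by simp
  qed auto
  moreover have "emeasure gaussian (\<Inter>k. S k) = 0"
  proof -
    have Int: "(\<Inter>k. S k) \<subseteq> {x. b \<bullet> x = 0}"
    proof
      fix x assume x: "x \<in> (\<Inter>k. S k)"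
      have "\<bar>x \<bullet> b\<bar> \<le> 0"
      proof (rule field_le_epsilon)
        fix e :: real assume "0 < e"
        then obtain k where "inverse (real (Suc k)) < e" using reals_Archimedean by blast
        moreover have "\<bar>x \<bullet> b\<bar> \<le> 1 / real (Suc k)" using x by (auto simp: S_def)
        ultimately show "\<bar>x \<bullet> b\<bar> \<le> 0 + e" by (simp add: inverse_eq_divide)
      qed
      then show "x \<in> {x. b \<bullet> x = 0}" by (simp add: inner_commute)
    qed
    have "negligible {x. b \<bullet> x = 0}" using b by (intro negligible_hyperplane) auto
    moreover have H: "{x. b \<bullet> x = 0} \<in> sets borel" by measurable
    ultimately have "emeasure lborel {x. b \<bullet> x = 0} = 0"
      by (simp add: negligible_iff_null_sets null_sets_def)
    then have n: "{x. b \<bullet> x = 0} \<in> null_sets lborel" using H by (simp add: null_sets_def)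
    have "AE x in lborel. x \<notin> {x. b \<bullet> x = 0}" using n by (rule AE_not_in)
    then have "emeasure gaussian {x. b \<bullet> x = 0} = 0"
      unfolding emeasure_gaussian[OF H] by (subst nn_integral_0_iff_AE) (auto elim: eventually_mono)
    moreover have "emeasure gaussian (\<Inter>k. S k) \<le> emeasure gaussian {x. b \<bullet> x = 0}"
      using Int H by (intro emeasure_mono) auto
    ultimately show ?thesis by simp
  qed
  ultimately have "(\<lambda>k. emeasure gaussian (S k)) \<longlonglongrightarrow> 0" by simp
  then have "eventually (\<lambda>k. emeasure gaussian (S k) < ennreal e) sequentially"
    using e by (intro order_tendstoD) auto
  then obtain k where k: "emeasure gaussian (S k) < ennreal e" by (meson eventually_sequentially order_refl)
  show thesis
  proof (rule that[of "1 / real (Suc k)"])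
    fix v :: 'a assume v: "norm v = 1"
    have "reflect (b - v) b = v" using reflect_swap[of b v] b v by simp
    then have Rv: "reflect (b - v) v = b" by (metis reflect_reflect)
    have "reflect (b - v) x \<bullet> b = x \<bullet> v" for x
      using inner_reflect_reflect[of "b - v" x v] by (simp add: Rv)
    then have "{x. \<bar>x \<bullet> v\<bar> \<le> 1 / real (Suc k)} = {x. reflect (b - v) x \<in> S k}" by (simp add: S_def)
    then show "emeasure gaussian {x. \<bar>x \<bullet> v\<bar> \<le> 1 / real (Suc k)} < ennreal e"
      using emeasure_gaussian_reflect[OF S] k by simp
  qed simp
qed

definition admissible :: "'a::euclidean_space measure \<Rightarrow> ('a \<Rightarrow> real) \<Rightarrow> bool" where
  "admissible \<mu> g \<longleftrightarrow> positive_on_sphere g \<and> (\<forall>v\<in>sphere 0 1. g (- v) = g v) \<and> (\<integral>v. ln (g v) \<partial>\<mu>) \<le> 0"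

lemma integrable_continuous_on_sphere:
  fixes f :: "'a::euclidean_space \<Rightarrow> real"
  assumes \<mu>: "finite_measure \<mu>" "sets \<mu> = sets sphere_borel" and f: "continuous_on (sphere 0 1) f"
  shows "integrable \<mu> f"
proof -
  have sp: "space \<mu> = sphere 0 1" using sets_eq_imp_space_eq[OF \<mu>(2)] by (simp add: space_restrict_space)
  have "bounded (f ` sphere 0 1)" by (intro compact_imp_bounded compact_continuous_image f compact_sphere)
  then obtain B where "\<forall>y\<in>f ` sphere 0 1. norm y \<le> B" unfolding bounded_iff by blast
  then have B: "\<And>v. v \<in> sphere 0 1 \<Longrightarrow> norm (f v) \<le> B" by blast
  have "f \<in> borel_measurable \<mu>"
    using borel_measurable_continuous_on_restrict[OF f] by (simp add: measurable_cong_sets[OF \<mu>(2) refl])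
  then show ?thesis
    by (rule finite_measure.integrable_const_bound[OF \<mu>(1), of _ B, rotated]) (use B sp in auto)
qed

lemma sphere_measure_space:
  assumes "sets \<mu> = sets (sphere_borel :: 'a::euclidean_space measure)"
  shows "space \<mu> = sphere 0 1"
  using sets_eq_imp_space_eq[OF assms] by (simp add: space_restrict_space)

text \<open>The integral is a continuous positive function of \<open>v\<close> on the compact sphere.\<close>

lemma spread_constant:
  fixes \<mu> :: "'a::euclidean_space measure"
  assumes \<mu>: "finite_measure \<mu>" "sets \<mu> = sets sphere_borel"
    and spread: "\<And>v. norm v = 1 \<Longrightarrow> 0 < measure \<mu> {u \<in> sphere 0 1. u \<bullet> v \<noteq> 0}"
  obtains c where "0 < c" "\<And>v. norm v = 1 \<Longrightarrow> c \<le> (\<integral>u. \<bar>u \<bullet> v\<bar> \<partial>\<mu>)"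
proof -
  interpret finite_measure \<mu> by (rule \<mu>(1))
  have sp: "space \<mu> = sphere 0 1" by (rule sphere_measure_space[OF \<mu>(2)])
  define F where "F v = (\<integral>u. \<bar>u \<bullet> v\<bar> \<partial>\<mu>)" for v
  have int: "integrable \<mu> (\<lambda>u. \<bar>u \<bullet> v\<bar>)" for v
    by (intro integrable_continuous_on_sphere \<mu> continuous_intros)
  have le: "F v - F w \<le> measure \<mu> (space \<mu>) * dist v w" for v w
  proof -
    have "F v - F w = (\<integral>u. \<bar>u \<bullet> v\<bar> - \<bar>u \<bullet> w\<bar> \<partial>\<mu>)"
      unfolding F_def by (rule Bochner_Integration.integral_diff[symmetric, OF int int])
    also have "\<dots> \<le> (\<integral>u. dist v w \<partial>\<mu>)"
    proof (rule integral_mono)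
      fix u assume "u \<in> space \<mu>"
      then have "norm u = 1" by (simp add: sp)
      then have "\<bar>u \<bullet> (v - w)\<bar> \<le> norm (v - w)" using Cauchy_Schwarz_ineq2[of u "v - w"] by simp
      then show "\<bar>u \<bullet> v\<bar> - \<bar>u \<bullet> w\<bar> \<le> dist v w" by (simp add: dist_norm inner_diff_right)
    qed (auto intro!: Bochner_Integration.integrable_diff int)
    finally show ?thesis by simp
  qed
  have "(measure \<mu> (space \<mu>))-lipschitz_on (sphere 0 1) F"
  proof (rule lipschitz_onI)
    show "dist (F v) (F w) \<le> measure \<mu> (space \<mu>) * dist v w" for v w
      using le[of v w] le[of w v] by (simp add: dist_real_def abs_le_iff dist_commute)
  qed simp
  then have "continuous_on (sphere 0 1) F" by (rule lipschitz_on_continuous_on)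
  then obtain v0 where v0: "v0 \<in> sphere 0 1" "\<forall>v\<in>sphere 0 1. F v0 \<le> F v"
    using continuous_attains_inf[OF compact_sphere sphere_nonempty] by blast
  have "0 < F v0"
  proof (rule ccontr)
    assume "\<not> 0 < F v0"
    moreover have "0 \<le> F v0" unfolding F_def by (rule integral_nonneg_AE) auto
    ultimately have "F v0 = 0" by simp
    then have "AE u in \<mu>. \<bar>u \<bullet> v0\<bar> = 0"
      unfolding F_def using integral_nonneg_eq_0_iff_AE[OF int, of v0] by simp
    moreover have "{u \<in> sphere 0 1. u \<bullet> v0 \<noteq> 0} \<in> sets \<mu>"
    proof -
      have "{u \<in> space \<mu>. u \<bullet> v0 \<noteq> 0} \<in> sets \<mu>"
      proof (rule borel_measurable_neq)
        have "continuous_on (sphere 0 1) (\<lambda>u. u \<bullet> v0)" by (intro continuous_intros)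
        from borel_measurable_continuous_on_restrict[OF this]
        show "(\<lambda>u. u \<bullet> v0) \<in> borel_measurable \<mu>" by (simp add: measurable_cong_sets[OF \<mu>(2) refl])
      qed simp
      then show ?thesis by (simp add: sp)
    qed
    ultimately have "emeasure \<mu> {u \<in> sphere 0 1. u \<bullet> v0 \<noteq> 0} = 0"
      by (subst (asm) AE_iff_measurable[where N="{u \<in> sphere 0 1. u \<bullet> v0 \<noteq> 0}"]) (auto simp: sp)
    then show False using spread[of v0] v0(1) by (simp add: measure_def)
  qed
  then show thesis using v0 by (intro that[of "F v0"]) (auto simp: F_def)
qed

text \<open>Let \<open>x = s v\<close> with \<open>norm v = 1\<close> and \<open>s > \<delta>\<close>. By symmetry \<open>g u \<ge> s \<bar>u \<bullet> v\<bar>\<close>, so \<open>2 g u\<close> is at least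
  the convex combination of \<open>\<delta>\<close> and \<open>s\<close> with weight \<open>\<bar>u \<bullet> v\<bar>\<close> on \<open>s\<close>. Concavity of \<open>ln\<close> and integration turn
  \<open>\<integral> ln g d\<mu> \<le> 0\<close> into a bound on \<open>c * (ln s - ln \<delta>)\<close>.\<close>

lemma admissible_support_bounded:
  fixes \<mu> :: "'a::euclidean_space measure"
  assumes \<mu>: "finite_measure \<mu>" "sets \<mu> = sets sphere_borel"
    and c: "0 < c" "\<And>v. norm v = 1 \<Longrightarrow> c \<le> (\<integral>u. \<bar>u \<bullet> v\<bar> \<partial>\<mu>)"
    and \<delta>: "0 < \<delta>"
  shows "\<exists>R>0. \<forall>g x. admissible \<mu> g \<longrightarrow> (\<forall>v\<in>sphere 0 1. \<delta> \<le> g v) \<longrightarrow> x \<in> wulff g \<longrightarrow> norm x \<le> R"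
proof -
  interpret finite_measure \<mu> by (rule \<mu>(1))
  have sp: "space \<mu> = sphere 0 1" by (rule sphere_measure_space[OF \<mu>(2)])
  define m where "m = measure \<mu> (space \<mu>)"
  define R where "R = max \<delta> (exp (ln \<delta> + m * (ln 2 - ln \<delta>) / c))"
  show ?thesis
  proof (intro exI[of _ R] conjI allI impI)
    show "0 < R" using \<delta> by (simp add: R_def)
    fix g x assume g: "admissible \<mu> g" and "\<forall>v\<in>sphere 0 1. \<delta> \<le> g v" and x: "x \<in> wulff g"
    then have g\<delta>: "\<And>v. v \<in> sphere 0 1 \<Longrightarrow> \<delta> \<le> g v" by blast
    define s where "s = norm x"
    show "norm x \<le> R"
    proof (cases "s \<le> \<delta>")
      case False
      then have s: "\<delta> < s" "0 < s" using \<delta> by auto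
      define v where "v = x /\<^sub>R s"
      have v: "norm v = 1" and xv: "x = s *\<^sub>R v" using s by (auto simp: v_def s_def)
      have pt: "(1 - \<bar>u \<bullet> v\<bar>) * ln \<delta> + \<bar>u \<bullet> v\<bar> * ln s - ln 2 \<le> ln (g u)" if u: "u \<in> sphere 0 1" for u
      proof -
        let ?t = "\<bar>u \<bullet> v\<bar>"
        have t: "0 \<le> ?t" "?t \<le> 1" using Cauchy_Schwarz_ineq2[of u v] u v by auto
        have "s * ?t \<le> g u"
        proof -
          have "x \<bullet> u \<le> g u" using x u by (simp add: wulff_def)
          moreover have "x \<bullet> (- u) \<le> g u"
          proof -
            have "- u \<in> sphere 0 1" using u by simp
            then have "x \<bullet> (- u) \<le> g (- u)" using x unfolding wulff_def by blast
            then show ?thesis using g u by (simp add: admissible_def)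
          qed
          ultimately show ?thesis using s(2) by (simp add: xv inner_commute abs_mult_pos' abs_le_iff mult.commute abs_if)
        qed
        moreover have "(1 - ?t) * \<delta> \<le> 1 * \<delta>" using t \<delta> by (intro mult_right_mono) auto
        ultimately have two: "(1 - ?t) * \<delta> + ?t * s \<le> 2 * g u" using g\<delta>[OF u] by (simp add: mult.commute)
        have pos: "0 < (1 - ?t) * \<delta> + ?t * s"
        proof (cases "?t = 0")
          case False
          then have "0 < ?t * s" using t s by simp
          moreover have "0 \<le> (1 - ?t) * \<delta>" using t \<delta> by simp
          ultimately show ?thesis by linarith
        qed (use \<delta> in simp)
        have "(1 - ?t) * ln \<delta> + ?t * ln s \<le> ln ((1 - ?t) * \<delta> + ?t * s)"
          using ln_concave t \<delta> s unfolding concave_on_iff by (auto dest!: bspec[of _ _ \<delta>] bspec[of _ _ s])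
        also have "\<dots> \<le> ln (2 * g u)" using two pos by simp
        also have "\<dots> = ln 2 + ln (g u)" using g\<delta>[OF u] \<delta> by (subst ln_mult) auto
        finally show ?thesis by simp
      qed
      have g_cont: "continuous_on (sphere 0 1) (\<lambda>u. ln (g u))"
        using g by (intro continuous_intros) (auto simp: admissible_def positive_on_sphere_def)
      have ti: "integrable \<mu> (\<lambda>u. \<bar>u \<bullet> v\<bar>)"
        by (intro integrable_continuous_on_sphere \<mu> continuous_intros)
      have "(\<integral>u. (ln \<delta> - ln 2) + \<bar>u \<bullet> v\<bar> * (ln s - ln \<delta>) \<partial>\<mu>) \<le> (\<integral>u. ln (g u) \<partial>\<mu>)"
      proof (rule integral_mono)
        show "integrable \<mu> (\<lambda>u. (ln \<delta> - ln 2) + \<bar>u \<bullet> v\<bar> * (ln s - ln \<delta>))" using ti by simp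
        show "integrable \<mu> (\<lambda>u. ln (g u))" by (rule integrable_continuous_on_sphere[OF \<mu> g_cont])
        fix u assume "u \<in> space \<mu>"
        then show "(ln \<delta> - ln 2) + \<bar>u \<bullet> v\<bar> * (ln s - ln \<delta>) \<le> ln (g u)" using pt[of u] by (simp add: sp algebra_simps)
      qed
      also have "\<dots> \<le> 0" using g by (simp add: admissible_def)
      finally have "m * (ln \<delta> - ln 2) + (\<integral>u. \<bar>u \<bullet> v\<bar> \<partial>\<mu>) * (ln s - ln \<delta>) \<le> 0"
        using ti by (simp add: m_def)
      moreover have "c * (ln s - ln \<delta>) \<le> (\<integral>u. \<bar>u \<bullet> v\<bar> \<partial>\<mu>) * (ln s - ln \<delta>)"
        using c(2)[OF v] s \<delta> by (intro mult_right_mono) auto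
      ultimately have "c * (ln s - ln \<delta>) \<le> m * (ln 2 - ln \<delta>)" by (simp add: algebra_simps)
      then have "ln s - ln \<delta> \<le> m * (ln 2 - ln \<delta>) / c" using c(1) by (simp add: pos_le_divide_eq mult.commute)
      then have "ln s \<le> ln \<delta> + m * (ln 2 - ln \<delta>) / c" by simp
      then have "s \<le> exp (ln \<delta> + m * (ln 2 - ln \<delta>) / c)" using s(2) by (metis exp_ln exp_le_cancel_iff)
      then show ?thesis by (simp add: R_def s_def)
    qed (simp add: s_def R_def)
  qed
qed

lemma ln_diff_le:
  fixes a b d :: real
  assumes "0 < d" "d \<le> a" "d \<le> b"
  shows "\<bar>ln a - ln b\<bar> \<le> \<bar>a - b\<bar> / d"
proof -
  have "ln a - ln b \<le> \<bar>a - b\<bar> / d" if "d \<le> a" "d \<le> b" for a b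
  proof -
    have "ln a - ln b = ln (a / b)" using assms(1) that by (simp add: ln_div)
    also have "\<dots> \<le> a / b - 1" using assms(1) that by (intro ln_le_minus_one) simp
    also have "\<dots> = (a - b) / b" using assms(1) that by (simp add: field_simps)
    also have "\<dots> \<le> \<bar>a - b\<bar> / d" using assms(1) that by (intro frac_le) auto
    finally show ?thesis .
  qed
  from this[of a b] this[of b a] show ?thesis using assms by (simp add: abs_le_iff abs_minus_commute)
qed

lemma wulff_symmetric:
  assumes g: "positive_on_sphere g" "\<And>v. v \<in> sphere 0 1 \<Longrightarrow> g (- v) = g v" and x: "x \<in> wulff g"
  shows "- x \<in> wulff g"
proof -
  have "x \<bullet> (- v) \<le> g v" if "v \<in> sphere 0 1" for v
  proof -
    have "- v \<in> sphere 0 1" using that by simp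
    then have "x \<bullet> (- v) \<le> g (- v)" using x unfolding wulff_def by blast
    then show ?thesis using g(2)[OF that] by simp
  qed
  then show ?thesis by (simp add: wulff_def)
qed

lemma admissible_support_fun:
  assumes \<mu>: "finite_measure \<mu>" "sets \<mu> = sets sphere_borel" and g: "admissible \<mu> g"
  shows "admissible \<mu> (support_fun (wulff g))"
proof -
  have pos: "positive_on_sphere g" and even: "\<And>v. v \<in> sphere 0 1 \<Longrightarrow> g (- v) = g v" and int: "(\<integral>v. ln (g v) \<partial>\<mu>) \<le> 0"
    using g by (auto simp: admissible_def)
  note h = support_fun_wulff[OF pos]
  have K: "compact (wulff g)" "wulff g \<noteq> {}" using wulff_body[OF pos] interior_subset by blast+
  have le: "support_fun (wulff g) (- v) \<le> support_fun (wulff g) v" for v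
  proof -
    obtain x where x: "x \<in> wulff g" "support_fun (wulff g) (- v) = x \<bullet> (- v)" using support_fun_attained[OF K] .
    show ?thesis using support_fun_upper[OF K(1) wulff_symmetric[OF pos even x(1)], of v] x(2) by simp
  qed
  have cont: "continuous_on (sphere 0 1) (\<lambda>v. ln (f v))" if "positive_on_sphere f" for f :: "'a \<Rightarrow> real"
    using that by (intro continuous_intros) (auto simp: positive_on_sphere_def)
  have "(\<integral>v. ln (support_fun (wulff g) v) \<partial>\<mu>) \<le> (\<integral>v. ln (g v) \<partial>\<mu>)"
  proof (rule integral_mono)
    show "ln (support_fun (wulff g) v) \<le> ln (g v)" if "v \<in> space \<mu>" for v
    proof -
      have v: "v \<in> sphere 0 1" using that by (simp only: sphere_measure_space[OF \<mu>(2)])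
      then have "0 < support_fun (wulff g) v" using h(1) by (simp add: positive_on_sphere_def)
      then show ?thesis using h(2)[OF v] by simp
    qed
  qed (intro integrable_continuous_on_sphere[OF \<mu>] cont pos h(1))+
  then show ?thesis
    unfolding admissible_def using h(1) int le[of "- _"] le by (auto intro!: antisym)
qed

text \<open>Passing to support functions changes neither the Wulff shapes nor admissibility, and makes a
  maximising sequence equicontinuous. If \<open>H (k n) \<longlonglongrightarrow> h\<close> uniformly, then eventually \<open>wulff (H (k n))\<close> lies in
  the body \<open>wulff_gauge h \<le> 1 + \<epsilon>\<close>, and these bodies decrease to \<open>wulff h\<close>.\<close>

lemma gaussian_maximiser_exists:
  fixes \<mu> :: "'a::euclidean_space measure"
  assumes \<mu>: "finite_measure \<mu>" "sets \<mu> = sets sphere_borel"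
    and spread: "\<And>v. norm v = 1 \<Longrightarrow> 0 < measure \<mu> {u \<in> sphere 0 1. u \<bullet> v \<noteq> 0}"
  obtains h where "admissible \<mu> h" "\<And>g. admissible \<mu> g \<Longrightarrow> emeasure gaussian (wulff g) \<le> emeasure gaussian (wulff h)"
proof -
  interpret finite_measure \<mu> by (rule \<mu>(1))
  have sp: "space \<mu> = sphere 0 1" by (rule sphere_measure_space[OF \<mu>(2)])
  \<comment> \<open>the values that compete for the maximum\<close>
  define G where "G = (\<lambda>g. emeasure gaussian (wulff g)) ` {g. admissible \<mu> g}"
  have one: "admissible \<mu> (\<lambda>_. 1)" by (simp add: admissible_def positive_on_sphere_def)
  then have "G \<noteq> {}" by (auto simp: G_def)
  from ennreal_Sup_countable_SUP[OF this] obtain f :: "nat \<Rightarrow> ennreal"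
    where f: "incseq f" "range f \<subseteq> G" "Sup G = (SUP i. f i)" by blast
  have wb: "wulff g \<in> sets borel" if "positive_on_sphere g" for g :: "'a \<Rightarrow> real"
    using wulff_body(1)[OF that] by (rule borel_compact)
  have "0 < emeasure gaussian (wulff (\<lambda>_ :: 'a. 1))"
  proof -
    have p1: "positive_on_sphere (\<lambda>_ :: 'a. 1)" using one by (simp add: admissible_def)
    obtain e where e: "0 < e" "cball 0 e \<subseteq> wulff (\<lambda>_ :: 'a. 1)"
      using wulff_body(3)[OF p1] mem_interior_cball by blast
    have "ennreal (exp (- e\<^sup>2 / 2)) * emeasure lborel (cball (0::'a) e)
        = (\<integral>\<^sup>+x. ennreal (exp (- e\<^sup>2 / 2)) * indicator (cball (0::'a) e) x \<partial>lborel)"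
      by (rule nn_integral_cmult_indicator[symmetric]) simp
    also have "\<dots> \<le> emeasure gaussian (cball (0::'a) e)"
      unfolding emeasure_gaussian[OF borel_closed[OF closed_cball]]
      by (intro nn_integral_mono) (auto simp: indicator_def intro!: ennreal_leI power_mono)
    also have "\<dots> \<le> emeasure gaussian (wulff (\<lambda>_ :: 'a. 1))"
      using e wb[OF p1] by (intro emeasure_mono) auto
    finally have "ennreal (exp (- e\<^sup>2 / 2)) * emeasure lborel (cball (0::'a) e) \<le> emeasure gaussian (wulff (\<lambda>_ :: 'a. 1))" .
    moreover have "0 < ennreal (exp (- e\<^sup>2 / 2)) * emeasure lborel (cball (0::'a) e)"
      using emeasure_lborel_cball_pos_finite(1)[OF e(1), of "0::'a"] by (simp add: ennreal_zero_less_mult_iff)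
    ultimately show ?thesis by (rule less_le_trans[rotated])
  qed
  also have "\<dots> \<le> Sup G" unfolding G_def using one by (intro SUP_upper) simp
  finally have "0 < (SUP i. f i)" unfolding f(3) .
  then obtain i0 where i0: "0 < f i0" by (auto simp: less_SUP_iff)
  have "\<exists>g. admissible \<mu> g \<and> emeasure gaussian (wulff g) = f (i0 + i)" for i
  proof -
    have "f (i0 + i) \<in> G" using f(2) by blast
    then show ?thesis by (auto simp: G_def)
  qed
  then obtain g where g: "\<And>i. admissible \<mu> (g i)" "\<And>i. emeasure gaussian (wulff (g i)) = f (i0 + i)" by metis
  define H where "H i = support_fun (wulff (g i))" for i
  have gpos: "positive_on_sphere (g i)" for i using g(1)[of i] by (simp add: admissible_def)
  have Hadm: "admissible \<mu> (H i)" for i unfolding H_def by (rule admissible_support_fun[OF \<mu> g(1)])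
  have Hpos: "positive_on_sphere (H i)" for i using Hadm[of i] by (simp add: admissible_def)
  have Heven: "H i (- v) = H i v" if "v \<in> sphere 0 1" for i v using Hadm[of i] that by (simp add: admissible_def)
  have Hw: "wulff (H i) = wulff (g i)" for i unfolding H_def by (rule support_fun_wulff(3)[OF gpos])
  obtain e0 where e0: "0 < e0" "ennreal e0 \<le> f i0"
  proof -
    have "f i0 \<noteq> \<infinity>" using g(2)[of 0] emeasure_gaussian_finite[of "wulff (g 0)"] by auto
    then obtain e0 where "f i0 = ennreal e0" "0 \<le> e0" by (metis ennreal_cases infinity_ennreal_def)
    then show thesis using that[of e0] i0 by (cases "e0 = 0") auto
  qed
  obtain \<delta> where \<delta>: "0 < \<delta>" "\<And>v :: 'a. norm v = 1 \<Longrightarrow> emeasure gaussian {x. \<bar>x \<bullet> v\<bar> \<le> \<delta>} < ennreal e0"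
    using gaussian_slab_small[OF e0(1)] by blast
  have H\<delta>: "\<delta> \<le> H i v" if v: "v \<in> sphere 0 1" for i v
  proof (rule ccontr)
    assume "\<not> \<delta> \<le> H i v"
    have "wulff (H i) \<subseteq> {x. \<bar>x \<bullet> v\<bar> \<le> \<delta>}"
    proof
      fix x assume x: "x \<in> wulff (H i)"
      have "x \<bullet> v \<le> H i v" "(- x) \<bullet> v \<le> H i v"
        using x wulff_symmetric[OF Hpos Heven x] v by (auto simp: wulff_def)
      then show "x \<in> {x. \<bar>x \<bullet> v\<bar> \<le> \<delta>}" using \<open>\<not> \<delta> \<le> H i v\<close> by (simp add: abs_le_iff)
    qed
    moreover have "{x. \<bar>x \<bullet> v\<bar> \<le> \<delta>} \<in> sets borel" by measurable
    ultimately have "emeasure gaussian (wulff (H i)) \<le> emeasure gaussian {x. \<bar>x \<bullet> v\<bar> \<le> \<delta>}"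
      by (intro emeasure_mono) auto
    also have "\<dots> < ennreal e0" using \<delta>(2)[of v] v by simp
    also have "\<dots> \<le> f i0" by (rule e0(2))
    also have "\<dots> \<le> f (i0 + i)" using f(1) by (simp add: incseq_def)
    finally show False using g(2)[of i] by (simp add: Hw)
  qed
  obtain c where c: "0 < c" "\<And>v. norm v = 1 \<Longrightarrow> c \<le> (\<integral>u. \<bar>u \<bullet> v\<bar> \<partial>\<mu>)"
    using spread_constant[OF \<mu> spread] by blast
  obtain R where R: "0 < R"
    "\<forall>g x. admissible \<mu> g \<longrightarrow> (\<forall>v\<in>sphere 0 1. \<delta> \<le> g v) \<longrightarrow> x \<in> wulff g \<longrightarrow> norm x \<le> R"
    using admissible_support_bounded[OF \<mu> c \<delta>(1)] by blast
  have KR: "norm x \<le> R" if "x \<in> wulff (g i)" for x i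
    using R(2) Hadm[of i] H\<delta>[of _ i] that by (simp add: Hw)
  have K: "compact (wulff (g i))" "wulff (g i) \<noteq> {}" for i using wulff_body[OF gpos[of i]] interior_subset by blast+
  have HL: "\<bar>H i v - H i w\<bar> \<le> R * norm (v - w)" for i v w
    unfolding H_def by (rule support_fun_Lipschitz[OF K KR])
  have HR: "norm (H i v) \<le> R" if v: "v \<in> sphere 0 1" for i v
  proof -
    obtain x where x: "x \<in> wulff (g i)" "H i v = x \<bullet> v" unfolding H_def using support_fun_attained[OF K] .
    have "\<bar>x \<bullet> v\<bar> \<le> norm x" using Cauchy_Schwarz_ineq2[of x v] v by simp
    then show ?thesis using KR[OF x(1)] x(2) by simp
  qed
  obtain h k where hk: "continuous_on (sphere 0 1) h" "strict_mono (k :: nat \<Rightarrow> nat)"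
    "\<And>e. 0 < e \<Longrightarrow> \<exists>N. \<forall>n x. n \<ge> N \<and> x \<in> sphere 0 1 \<longrightarrow> norm (H (k n) x - h x) < e"
  proof (rule Arzela_Ascoli[of "sphere (0::'a) 1" H R])
    fix x :: 'a and e :: real assume "0 < e"
    have "R * (e / (R + 1)) < e" using R(1) \<open>0 < e\<close> by (simp add: field_simps)
    have "norm (H n x - H n y) < e" if "norm (x - y) < e / (R + 1)" for n y
    proof -
      have "R * norm (x - y) \<le> R * (e / (R + 1))" using that R(1) by (intro mult_left_mono) auto
      then show ?thesis using HL[of n x y] \<open>R * (e / (R + 1)) < e\<close> by simp
    qed
    then show "\<exists>d>0. \<forall>n y. y \<in> sphere 0 1 \<and> norm (x - y) < d \<longrightarrow> norm (H n x - H n y) < e"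
      using R(1) \<open>0 < e\<close> by (intro exI[of _ "e / (R + 1)"]) auto
  qed (use HR in auto)
  have lim: "(\<lambda>n. H (k n) v) \<longlonglongrightarrow> h v" if v: "v \<in> sphere 0 1" for v
  proof (rule LIMSEQ_I)
    fix r :: real assume "0 < r"
    from hk(3)[OF this] obtain N where "\<forall>n x. n \<ge> N \<and> x \<in> sphere 0 1 \<longrightarrow> norm (H (k n) x - h x) < r" by blast
    then show "\<exists>no. \<forall>n\<ge>no. norm (H (k n) v - h v) < r" using v by blast
  qed
  have h\<delta>: "\<delta> \<le> h v" if v: "v \<in> sphere 0 1" for v
    using LIMSEQ_le_const[OF lim[OF v]] H\<delta>[OF v] by blast
  have hpos: "positive_on_sphere h" using hk(1) h\<delta> \<delta>(1) by (force simp: positive_on_sphere_def)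
  have heven: "h (- v) = h v" if v: "v \<in> sphere 0 1" for v
  proof (rule LIMSEQ_unique)
    show "(\<lambda>n. H (k n) v) \<longlonglongrightarrow> h v" by (rule lim[OF v])
    have "(\<lambda>n. H (k n) (- v)) \<longlonglongrightarrow> h (- v)" using v by (intro lim) simp
    then show "(\<lambda>n. H (k n) v) \<longlonglongrightarrow> h (- v)" by (simp add: Heven[OF v])
  qed
  have cont: "continuous_on (sphere 0 1) (\<lambda>v. ln (f v))" if "positive_on_sphere f" for f :: "'a \<Rightarrow> real"
    using that by (intro continuous_intros) (auto simp: positive_on_sphere_def)
  have hint: "(\<integral>v. ln (h v) \<partial>\<mu>) \<le> 0"
  proof (rule field_le_epsilon)
    fix e :: real assume e: "0 < e"
    define m where "m = measure \<mu> (space \<mu>) + 1"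
    have m: "0 < m" by (simp add: m_def add_nonneg_pos)
    define e' where "e' = e * \<delta> / m"
    have e': "0 < e'" using e \<delta>(1) m by (simp add: e'_def)
    obtain n where n: "\<And>v. v \<in> sphere 0 1 \<Longrightarrow> norm (H (k n) v - h v) < e'" using hk(3)[OF e'] by blast
    have "(\<integral>v. ln (h v) \<partial>\<mu>) \<le> (\<integral>v. ln (H (k n) v) + e / m \<partial>\<mu>)"
    proof (rule integral_mono)
      show "integrable \<mu> (\<lambda>v. ln (h v))" by (intro integrable_continuous_on_sphere[OF \<mu>] cont hpos)
      show "integrable \<mu> (\<lambda>v. ln (H (k n) v) + e / m)"
        by (intro integrable_continuous_on_sphere[OF \<mu>] continuous_on_add continuous_on_const cont Hpos)
      fix v assume "v \<in> space \<mu>"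
      then have v: "v \<in> sphere 0 1" by (simp only: sp)
      have "\<bar>ln (h v) - ln (H (k n) v)\<bar> \<le> \<bar>h v - H (k n) v\<bar> / \<delta>" by (rule ln_diff_le[OF \<delta>(1) h\<delta>[OF v] H\<delta>[OF v]])
      also have "\<dots> \<le> e' / \<delta>" using n[OF v] \<delta>(1) by (intro divide_right_mono) (auto simp: abs_minus_commute)
      also have "\<dots> = e / m" using \<delta>(1) by (simp add: e'_def)
      finally show "ln (h v) \<le> ln (H (k n) v) + e / m" by linarith
    qed
    also have "\<dots> = (\<integral>v. ln (H (k n) v) \<partial>\<mu>) + measure \<mu> (space \<mu>) * (e / m)"
      using integrable_continuous_on_sphere[OF \<mu> cont[OF Hpos[of "k n"]]] by simp
    also have "\<dots> \<le> 0 + m * (e / m)"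
      using Hadm[of "k n"] e m by (intro add_mono mult_right_mono) (auto simp: admissible_def m_def)
    finally show "(\<integral>v. ln (h v) \<partial>\<mu>) \<le> 0 + e" using m by simp
  qed
  have hadm: "admissible \<mu> h" using hpos heven hint by (simp add: admissible_def)
  define B where "B j = {x. wulff_gauge h x \<le> 1 + 1 / real (Suc j)}" for j
  have Bm: "B j \<in> sets borel" for j
    unfolding B_def using borel_measurable_wulff_gauge[OF hpos] by measurable
  have fB: "f i \<le> emeasure gaussian (B j)" for i j
  proof -
    define e where "e = \<delta> / real (Suc j)"
    have e: "0 < e" using \<delta>(1) by (simp add: e_def)
    obtain N where N: "\<And>n v. n \<ge> N \<Longrightarrow> v \<in> sphere 0 1 \<Longrightarrow> norm (H (k n) v - h v) < e" using hk(3)[OF e] by blast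
    define n where "n = max N i"
    have "wulff (H (k n)) \<subseteq> B j"
    proof
      fix x assume x: "x \<in> wulff (H (k n))"
      obtain v where v: "v \<in> sphere 0 1" "wulff_gauge h x = x \<bullet> v / h v" using wulff_gauge_attained[OF hpos] .
      have hv: "0 < h v" using h\<delta>[OF v(1)] \<delta>(1) by linarith
      have "x \<bullet> v \<le> H (k n) v" using x v(1) by (simp add: wulff_def)
      also have "\<dots> \<le> h v + e" using N[of n v] v(1) by (simp add: n_def abs_less_iff)
      also have "e \<le> h v / real (Suc j)" unfolding e_def using h\<delta>[OF v(1)] by (intro divide_right_mono) auto
      finally have "x \<bullet> v \<le> (1 + 1 / real (Suc j)) * h v" by (simp add: algebra_simps)
      then show "x \<in> B j" using hv by (simp add: B_def v(2) pos_divide_le_eq del: of_nat_Suc)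
    qed
    then have "f (i0 + k n) \<le> emeasure gaussian (B j)"
      using Bm[of j] g(2)[of "k n"] by (metis Hw emeasure_mono sets_gaussian)
    moreover have "i \<le> i0 + k n" using seq_suble[OF hk(2), of n] by (simp add: n_def)
    ultimately show ?thesis using f(1) by (meson incseqD order_trans)
  qed
  have "(\<lambda>j. emeasure gaussian (B j)) \<longlonglongrightarrow> emeasure gaussian (\<Inter>j. B j)"
  proof (rule Lim_emeasure_decseq)
    show "decseq B" unfolding decseq_def B_def by (auto intro: order_trans simp: frac_le)
    show "emeasure gaussian (B i) \<noteq> \<infinity>" for i using emeasure_gaussian_finite[of "B i"] by simp
  qed (use Bm in auto)
  moreover have "(\<Inter>j. B j) = wulff h"
  proof (intro equalityI subsetI)
    fix x assume x: "x \<in> (\<Inter>j. B j)"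
    have "wulff_gauge h x \<le> 1"
    proof (rule field_le_epsilon)
      fix e :: real assume "0 < e"
      then obtain j where "inverse (real (Suc j)) < e" using reals_Archimedean by blast
      moreover have "wulff_gauge h x \<le> 1 + 1 / real (Suc j)" using x by (auto simp: B_def)
      ultimately show "wulff_gauge h x \<le> 1 + e" by (simp add: inverse_eq_divide)
    qed
    then show "x \<in> wulff h" by (simp add: mem_wulff_iff_gauge_le_1[OF hpos])
  next
    fix x assume "x \<in> wulff h"
    then have "wulff_gauge h x \<le> 1" by (simp add: mem_wulff_iff_gauge_le_1[OF hpos])
    then show "x \<in> (\<Inter>j. B j)" by (auto simp: B_def intro: order_trans)
  qed
  ultimately have "(\<lambda>j. emeasure gaussian (B j)) \<longlonglongrightarrow> emeasure gaussian (wulff h)" by simp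
  then have fh: "f i \<le> emeasure gaussian (wulff h)" for i
    by (rule LIMSEQ_le_const) (use fB in auto)
  show thesis
  proof (rule that[OF hadm])
    fix g' assume "admissible \<mu> g'"
    then have "emeasure gaussian (wulff g') \<le> Sup G" unfolding G_def by (intro SUP_upper) simp
    also have "\<dots> \<le> emeasure gaussian (wulff h)" unfolding f(3) by (rule SUP_least) (rule fh)
    finally show "emeasure gaussian (wulff g') \<le> emeasure gaussian (wulff h)" .
  qed
qed

section \<open>First variation of Gaussian volume\<close>

text \<open>The Gaussian density in polar coordinates along the ray through the boundary point \<open>x\<close>, with the
  reciprocal \<open>t\<close> of the distance, measured in multiples of \<open>x\<close>, as coordinate. The ray meets \<open>wulff g\<close> in the
  points with \<open>t \<ge> wulff_gauge g x\<close>.\<close>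

definition tail_density :: "'a::euclidean_space \<Rightarrow> real \<Rightarrow> real" where
  "tail_density x t = real DIM('a) / t ^ (DIM('a) + 1) * exp (- (norm x)\<^sup>2 / (2 * t\<^sup>2))"

definition radial_tail :: "'a::euclidean_space \<Rightarrow> real \<Rightarrow> ennreal" where
  "radial_tail x r = (\<integral>\<^sup>+t. ennreal (tail_density x t) * indicator {0..} (t - r) \<partial>lborel)"

lemma tail_density_measurable [measurable (raw)]:
  assumes [measurable]: "f \<in> borel_measurable M" "g \<in> borel_measurable M"
  shows "(\<lambda>z. tail_density (f z :: 'a::euclidean_space) (g z)) \<in> borel_measurable M"
  unfolding tail_density_def by measurable

lemma radial_tail_measurable [measurable (raw)]:
  assumes [measurable]: "f \<in> borel_measurable M" "g \<in> borel_measurable M"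
  shows "(\<lambda>z. radial_tail (f z :: 'a::euclidean_space) (g z)) \<in> borel_measurable M"
  unfolding radial_tail_def by measurable

lemma tail_density_nonneg: "0 \<le> t \<Longrightarrow> 0 \<le> tail_density x t"
  by (simp add: tail_density_def)

lemma tail_density_at_1: "tail_density (x :: 'a::euclidean_space) 1 = real DIM('a) * exp (- (norm x)\<^sup>2 / 2)"
  by (simp add: tail_density_def)

lemma radial_tail_finite:
  fixes x :: "'a::euclidean_space"
  assumes r: "0 < r"
  shows "radial_tail x r < \<infinity>"
proof -
  let ?D = "DIM('a)"
  have "radial_tail x r \<le> (\<integral>\<^sup>+t. ennreal (real ?D / t ^ (?D + 1)) * indicator {r..} t \<partial>lborel)"
    unfolding radial_tail_def
  proof (rule nn_integral_mono)
    fix t :: real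
    have "tail_density x t \<le> real ?D / t ^ (?D + 1)" if "r \<le> t"
    proof -
      have "real ?D / t ^ (?D + 1) * exp (- (norm x)\<^sup>2 / (2 * t\<^sup>2)) \<le> real ?D / t ^ (?D + 1) * 1"
        using that r by (intro mult_left_mono) auto
      then show ?thesis by (simp add: tail_density_def)
    qed
    then show "ennreal (tail_density x t) * indicator {0..} (t - r) \<le> ennreal (real ?D / t ^ (?D + 1)) * indicator {r..} t"
      by (auto simp: indicator_def intro: ennreal_leI)
  qed
  also have "\<dots> = ennreal (0 - (- (1 / r ^ ?D)))"
  proof (rule nn_integral_FTC_atLeast)
    fix t assume "r \<le> t"
    then have t: "0 < t" using r by linarith
    have "t ^ ?D = t * t ^ (?D - 1)" by (metis DIM_positive power_minus_mult mult.commute)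
    then have "real ?D * t ^ (?D - Suc 0) / (t ^ ?D * t ^ ?D) = real ?D / t ^ (?D + 1)"
      using t by (simp add: field_simps)
    then show "DERIV (\<lambda>t. - (1 / t ^ ?D)) t :> real ?D / t ^ (?D + 1)"
      using t by (auto intro!: derivative_eq_intros)
    show "0 \<le> real ?D / t ^ (?D + 1)" using t by simp
  next
    have "((\<lambda>t::real. - (1 / t ^ ?D)) \<longlongrightarrow> - 0) at_top"
      by (intro tendsto_minus tendsto_divide_0[OF tendsto_const] filterlim_at_top_imp_at_infinity filterlim_pow_at_top filterlim_ident) simp
    then show "((\<lambda>t::real. - (1 / t ^ ?D)) \<longlongrightarrow> 0) at_top" by simp
  qed measurable
  also have "\<dots> < \<infinity>" by simp
  finally show ?thesis .
qed

lemma radial_tail_split: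
  fixes x :: "'a::euclidean_space"
  assumes a: "0 < a" "a \<le> b"
  obtains I where "0 \<le> I" "enn2real (radial_tail x a) = I + enn2real (radial_tail x b)"
    "\<And>lo. (\<And>t. a \<le> t \<Longrightarrow> t < b \<Longrightarrow> lo \<le> tail_density x t) \<Longrightarrow> lo * (b - a) \<le> I"
    "\<And>hi. 0 \<le> hi \<Longrightarrow> (\<And>t. a \<le> t \<Longrightarrow> t < b \<Longrightarrow> tail_density x t \<le> hi) \<Longrightarrow> I \<le> hi * (b - a)"
proof -
  define J where "J = (\<integral>\<^sup>+t. ennreal (tail_density x t) * indicator {a..<b} t \<partial>lborel)"
  have sum: "radial_tail x a = J + radial_tail x b"
  proof -
    have "radial_tail x a = (\<integral>\<^sup>+t. ennreal (tail_density x t) * indicator {a..<b} t + ennreal (tail_density x t) * indicator {0..} (t - b) \<partial>lborel)"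
      unfolding radial_tail_def using a by (intro nn_integral_cong) (auto simp: indicator_def)
    also have "\<dots> = J + radial_tail x b"
      unfolding J_def radial_tail_def by (rule nn_integral_add) measurable
    finally show ?thesis .
  qed
  have fa: "radial_tail x a < \<infinity>" and fb: "radial_tail x b < \<infinity>" using radial_tail_finite[of a x] radial_tail_finite[of b x] a by auto
  have fJ: "J < \<infinity>" using fa sum by (simp add: ennreal_add_less_top)
  then have J: "J = ennreal (enn2real J)" by simp
  show thesis
  proof (rule that[of "enn2real J"])
    show "enn2real (radial_tail x a) = enn2real J + enn2real (radial_tail x b)"
      unfolding sum using fJ fb by (intro enn2real_plus) auto
    fix lo :: real assume lo: "\<And>t. a \<le> t \<Longrightarrow> t < b \<Longrightarrow> lo \<le> tail_density x t"
    have "ennreal lo * emeasure lborel {a..<b} = (\<integral>\<^sup>+t. ennreal lo * indicator {a..<b} t \<partial>lborel)"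
      by (rule nn_integral_cmult_indicator[symmetric]) simp
    also have "\<dots> \<le> J" unfolding J_def using lo by (intro nn_integral_mono) (auto simp: indicator_def intro: ennreal_leI)
    finally have le: "ennreal lo * ennreal (b - a) \<le> J" using a by simp
    show "lo * (b - a) \<le> enn2real J"
    proof (cases "0 \<le> lo")
      case True
      then have "ennreal (lo * (b - a)) \<le> ennreal (enn2real J)" using le a J by (simp add: ennreal_mult)
      then show ?thesis by (simp add: ennreal_le_iff)
    next
      case False
      then have "lo * (b - a) \<le> 0" using a by (simp add: mult_nonpos_nonneg)
      then show ?thesis using enn2real_nonneg[of J] by linarith
    qed
  next
    fix hi :: real assume hi: "0 \<le> hi" "\<And>t. a \<le> t \<Longrightarrow> t < b \<Longrightarrow> tail_density x t \<le> hi"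
    have "J \<le> (\<integral>\<^sup>+t. ennreal hi * indicator {a..<b} t \<partial>lborel)"
      unfolding J_def using hi by (intro nn_integral_mono) (auto simp: indicator_def intro: ennreal_leI)
    also have "\<dots> = ennreal hi * emeasure lborel {a..<b}" by (rule nn_integral_cmult_indicator) simp
    also have "\<dots> = ennreal (hi * (b - a))" using a hi by (simp add: ennreal_mult)
    finally have "ennreal (enn2real J) \<le> ennreal (hi * (b - a))" using J by simp
    then show "enn2real J \<le> hi * (b - a)" using a hi by (simp add: ennreal_le_iff)
  qed simp
qed

text \<open>A lower bound to first order, with error \<open>e * \<bar>1 - r\<bar>\<close>: the derivative of the tail in \<open>r\<close> is \<open>- tail_density x r\<close>, and the
  density varies by at most \<open>e\<close> between \<open>1\<close> and \<open>r\<close>.\<close>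

lemma radial_tail_lower:
  fixes x :: "'a::euclidean_space"
  assumes r: "\<bar>r - 1\<bar> \<le> d" "d \<le> 1/2"
    and mod: "\<And>t. \<bar>t - 1\<bar> \<le> d \<Longrightarrow> \<bar>tail_density x t - tail_density x 1\<bar> \<le> e"
  shows "enn2real (radial_tail x 1) + (1 - r) * tail_density x 1 - e * \<bar>1 - r\<bar> \<le> enn2real (radial_tail x r)"
proof -
  have e: "0 \<le> e" using mod[of 1] r by (smt (verit) abs_ge_zero)
  have t1: "0 \<le> tail_density x 1" by (simp add: tail_density_nonneg)
  show ?thesis
  proof (cases "r \<le> 1")
    case True
    have r0: "0 < r" using r by linarith
    obtain I where I: "enn2real (radial_tail x r) = I + enn2real (radial_tail x 1)"
      "\<And>lo. (\<And>t. r \<le> t \<Longrightarrow> t < 1 \<Longrightarrow> lo \<le> tail_density x t) \<Longrightarrow> lo * (1 - r) \<le> I"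
      by (rule radial_tail_split[OF r0 True, of x]) blast
    have "tail_density x 1 - e \<le> tail_density x t" if "r \<le> t" "t < 1" for t
      using mod[of t] that r by linarith
    then have "(tail_density x 1 - e) * (1 - r) \<le> I" by (rule I(2))
    then show ?thesis using I(1) True by (simp add: algebra_simps)
  next
    case False
    then have r1: "1 \<le> r" by simp
    obtain I where I: "enn2real (radial_tail x 1) = I + enn2real (radial_tail x r)"
      "\<And>hi. 0 \<le> hi \<Longrightarrow> (\<And>t. 1 \<le> t \<Longrightarrow> t < r \<Longrightarrow> tail_density x t \<le> hi) \<Longrightarrow> I \<le> hi * (r - 1)"
      by (rule radial_tail_split[OF zero_less_one r1, of x]) blast
    have "tail_density x t \<le> tail_density x 1 + e" if "1 \<le> t" "t < r" for t
      using mod[of t] that r by linarith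
    then have "I \<le> (tail_density x 1 + e) * (r - 1)" using e t1 by (intro I(2)) auto
    then show ?thesis using I(1) False by (simp add: algebra_simps)
  qed
qed

lemma tail_density_modulus:
  assumes e: "0 < e"
  obtains d where "0 < d" "d \<le> 1/2"
    "\<And>(x :: 'a::euclidean_space) t. norm x \<le> R \<Longrightarrow> \<bar>t - 1\<bar> \<le> d \<Longrightarrow> \<bar>tail_density x t - tail_density x 1\<bar> \<le> e"
proof -
  let ?S = "cball (0::'a) R \<times> {1/2..3/2::real}"
  have "continuous_on ?S (\<lambda>p. tail_density (fst p) (snd p))"
    unfolding tail_density_def by (intro continuous_intros) auto
  then have "uniformly_continuous_on ?S (\<lambda>p. tail_density (fst p) (snd p))"
    by (rule compact_uniformly_continuous) (intro compact_Times compact_cball compact_Icc)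
  then obtain d where d: "0 < d"
    "\<And>p q. p \<in> ?S \<Longrightarrow> q \<in> ?S \<Longrightarrow> dist q p < d \<Longrightarrow> dist (tail_density (fst q) (snd q)) (tail_density (fst p) (snd p)) < e"
    using e unfolding uniformly_continuous_on_def by meson
  show thesis
  proof (rule that[of "min (d / 2) (1/2)"])
    fix x :: 'a and t assume xt: "norm x \<le> R" "\<bar>t - 1\<bar> \<le> min (d / 2) (1/2)"
    then have "1/2 \<le> t" "t \<le> 3/2" by linarith+
    then have "(x, t) \<in> ?S" "(x, 1) \<in> ?S" using xt by auto
    moreover have "dist (x, t) (x, 1) < d" using xt d(1) by (simp add: dist_Pair_Pair dist_real_def)
    ultimately show "\<bar>tail_density x t - tail_density x 1\<bar> \<le> e"
      using d(2)[of "(x, 1)" "(x, t)"] by (simp add: dist_real_def)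
  qed (use d in auto)
qed

context supported_wulff begin

lemma gaussian_wulff_polar:
  assumes g: "positive_on_sphere g"
  shows "emeasure gaussian (wulff g) =
    (\<integral>\<^sup>+z. indicator {z. 0 < N z \<and> N z < 1} z * radial_tail (radial z) (wulff_gauge g (radial z)) \<partial>lborel)"
proof -
  let ?D = "DIM('a)"
  have wb[measurable]: "wulff g \<in> sets borel" using wulff_body(1)[OF g] by (rule borel_compact)
  have "emeasure gaussian (wulff g) = (\<integral>\<^sup>+y. ennreal (exp (- (norm y)\<^sup>2 / 2)) * indicator (wulff g) y \<partial>lborel)"
    by (rule emeasure_gaussian[OF wb])
  also have "\<dots> = (\<integral>\<^sup>+z. indicator {z. 0 < N z \<and> N z < 1} z *
     (\<integral>\<^sup>+t. ennreal (real ?D / t ^ (?D + 1)) * indicator {0<..} t *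
       (ennreal (exp (- (norm (radial z /\<^sub>R t))\<^sup>2 / 2)) * indicator (wulff g) (radial z /\<^sub>R t)) \<partial>lborel) \<partial>lborel)"
    by (rule nn_integral_gauge_polar) measurable
  also have "\<dots> = (\<integral>\<^sup>+z. indicator {z. 0 < N z \<and> N z < 1} z * radial_tail (radial z) (wulff_gauge g (radial z)) \<partial>lborel)"
  proof (rule nn_integral_cong)
    fix z :: 'a
    show "indicator {z. 0 < N z \<and> N z < 1} z *
     (\<integral>\<^sup>+t. ennreal (real ?D / t ^ (?D + 1)) * indicator {0<..} t *
       (ennreal (exp (- (norm (radial z /\<^sub>R t))\<^sup>2 / 2)) * indicator (wulff g) (radial z /\<^sub>R t)) \<partial>lborel)
     = indicator {z. 0 < N z \<and> N z < 1} z * radial_tail (radial z) (wulff_gauge g (radial z))"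
    proof (cases "0 < N z \<and> N z < 1")
      case True
      then have z: "z \<noteq> 0" using pos by auto
      define x where "x = radial z"
      have r0: "0 < wulff_gauge g x" unfolding x_def by (rule wulff_gauge_pos[OF g radial_nonzero[OF z]])
      have "ennreal (real ?D / t ^ (?D + 1)) * indicator {0<..} t *
         (ennreal (exp (- (norm (x /\<^sub>R t))\<^sup>2 / 2)) * indicator (wulff g) (x /\<^sub>R t))
         = ennreal (tail_density x t) * indicator {0..} (t - wulff_gauge g x)" for t
      proof (cases "0 < t")
        case t: True
        have "wulff_gauge g (x /\<^sub>R t) = wulff_gauge g x / t"
          using wulff_gauge_scale[OF g, of "inverse t" x] t by (simp add: divide_inverse mult.commute)
        then have mem: "x /\<^sub>R t \<in> wulff g \<longleftrightarrow> wulff_gauge g x \<le> t"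
          using t by (simp add: mem_wulff_iff_gauge_le_1[OF g])
        have "norm (x /\<^sub>R t) = norm x / t" using t by (simp add: divide_inverse mult.commute)
        then have nx: "- (norm (x /\<^sub>R t))\<^sup>2 / 2 = - (norm x)\<^sup>2 / (2 * t\<^sup>2)"
          by (simp add: power_divide mult.commute)
        have "real ?D / t ^ (?D + 1) * exp (- (norm (x /\<^sub>R t))\<^sup>2 / 2) = tail_density x t"
          by (simp only: tail_density_def nx)
        then have "ennreal (real ?D / t ^ (?D + 1)) * ennreal (exp (- (norm (x /\<^sub>R t))\<^sup>2 / 2)) = ennreal (tail_density x t)"
          using t by (subst ennreal_mult[symmetric]) auto
        then show ?thesis using t mem by (simp add: indicator_def)
      next
        case False
        then show ?thesis using r0 by (simp add: indicator_def)
      qed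
      then show ?thesis using True by (simp add: radial_tail_def x_def)
    qed (auto simp: indicator_def)
  qed
  finally show ?thesis .
qed

definition perturbed :: "('a \<Rightarrow> real) \<Rightarrow> real \<Rightarrow> 'a \<Rightarrow> real" where
  "perturbed f t v = h v * exp (t * f v)"

lemma perturbed_positive:
  assumes "continuous_on (sphere 0 1) f"
  shows "positive_on_sphere (perturbed f t)"
  using assms pos unfolding positive_on_sphere_def perturbed_def by (auto intro!: continuous_intros)

lemma perturbed_gauge_lower:
  assumes f: "continuous_on (sphere 0 1) f" and x: "N x = 1" and v: "outer_unit_normal K x v"
  shows "exp (- (t * f v)) \<le> wulff_gauge (perturbed f t) x"
proof -
  have "v \<in> sphere 0 1" "x \<bullet> v = h v" using outer_unit_normal_iff[of x v] x v by auto
  then have "exp (- (t * f v)) = x \<bullet> v / perturbed f t v"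
    using h_pos[of v] by (simp add: perturbed_def exp_minus divide_inverse)
  then show ?thesis using wulff_gauge_upper[OF perturbed_positive[OF f] \<open>v \<in> sphere 0 1\<close>] by simp
qed

lemma perturbed_gauge_attained:
  assumes f: "continuous_on (sphere 0 1) f" and x: "N x = 1"
  obtains v where "v \<in> sphere 0 1" "wulff_gauge (perturbed f t) x = (x \<bullet> v / h v) * exp (- (t * f v))"
    "wulff_gauge (perturbed f t) x \<le> exp (- (t * f v))"
proof -
  obtain v where v: "v \<in> sphere 0 1" "wulff_gauge (perturbed f t) x = x \<bullet> v / perturbed f t v"
    using wulff_gauge_attained[OF perturbed_positive[OF f]] .
  then have eq: "wulff_gauge (perturbed f t) x = (x \<bullet> v / h v) * exp (- (t * f v))"
    by (simp add: perturbed_def exp_minus divide_inverse mult_ac)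
  also have "\<dots> \<le> 1 * exp (- (t * f v))" using N_upper[OF v(1), of x] x by (intro mult_right_mono) auto
  finally show thesis using that v(1) eq by simp
qed

lemma perturbed_gauge_bounds:
  assumes f: "continuous_on (sphere 0 1) f" and x: "N x = 1" and M: "\<And>v. v \<in> sphere 0 1 \<Longrightarrow> \<bar>f v\<bar> \<le> M" and t: "0 \<le> t"
  shows "exp (- (t * M)) \<le> wulff_gauge (perturbed f t) x" "wulff_gauge (perturbed f t) x \<le> exp (t * M)"
proof -
  have le: "\<bar>t * f v\<bar> \<le> t * M" if "v \<in> sphere 0 1" for v
    using M[OF that] t by (simp add: abs_mult mult_left_mono)
  obtain v where v: "outer_unit_normal K x v" using ex_outer_unit_normal[OF x] .
  then have "v \<in> sphere 0 1" by (simp add: outer_unit_normal_def)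
  have "exp (- (t * M)) \<le> exp (- (t * f v))" using le[OF \<open>v \<in> sphere 0 1\<close>] by simp
  also have "\<dots> \<le> wulff_gauge (perturbed f t) x" by (rule perturbed_gauge_lower[OF f x v])
  finally show "exp (- (t * M)) \<le> wulff_gauge (perturbed f t) x" .
  obtain w where w: "w \<in> sphere 0 1" "wulff_gauge (perturbed f t) x \<le> exp (- (t * f w))"
    using perturbed_gauge_attained[OF f x, of t] by metis
  have "exp (- (t * f w)) \<le> exp (t * M)" using le[OF w(1)] by simp
  then show "wulff_gauge (perturbed f t) x \<le> exp (t * M)" using w(2) by linarith
qed

text \<open>The maximising normals of the perturbed gauge converge to the unique normal, so the gauge is
  differentiable in the perturbation parameter.\<close>

lemma perturbed_gauge_derivative:
  assumes f: "continuous_on UNIV f" and x: "x \<in> regular"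
  shows "(\<lambda>n. (1 - wulff_gauge (perturbed f (1 / real (Suc n))) x) / (1 / real (Suc n))) \<longlonglongrightarrow> f (\<nu> x)"
proof -
  have fS: "continuous_on (sphere 0 1) f" using f continuous_on_subset by blast
  have N1: "N x = 1" by (rule regular_D(1)[OF x])
  define t where "t n = 1 / real (Suc n)" for n
  have t: "0 < t n" for n by (simp add: t_def)
  have t0: "t \<longlonglongrightarrow> 0" unfolding t_def using LIMSEQ_inverse_real_of_nat by (simp add: inverse_eq_divide)
  define r where "r n = wulff_gauge (perturbed f (t n)) x" for n
  have "bounded (f ` sphere 0 1)" by (intro compact_imp_bounded compact_continuous_image fS compact_sphere)
  then obtain M where "\<forall>y\<in>f ` sphere 0 1. norm y \<le> M" unfolding bounded_iff by blast
  then have M: "\<And>v. v \<in> sphere 0 1 \<Longrightarrow> \<bar>f v\<bar> \<le> M" by auto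
  have "\<exists>v. v \<in> sphere 0 1 \<and> r n = (x \<bullet> v / h v) * exp (- (t n * f v)) \<and> r n \<le> exp (- (t n * f v))" for n
    unfolding r_def using perturbed_gauge_attained[OF fS N1, of "t n"] by metis
  then obtain v where v: "\<And>n. v n \<in> sphere 0 1" "\<And>n. r n = (x \<bullet> v n / h (v n)) * exp (- (t n * f (v n)))"
    "\<And>n. r n \<le> exp (- (t n * f (v n)))" by metis
  have vlim: "v \<longlonglongrightarrow> \<nu> x"
  proof (rule tendstoI)
    fix d :: real assume d: "0 < d"
    define A where "A = sphere (0::'a) 1 \<inter> {v. d \<le> dist v (\<nu> x)}"
    have cA: "compact A" unfolding A_def by (intro compact_Int_closed compact_sphere closed_Collect_le continuous_intros)
    show "eventually (\<lambda>n. dist (v n) (\<nu> x) < d) sequentially"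
    proof (cases "A = {}")
      case True
      then have "dist (v n) (\<nu> x) < d" for n using v(1)[of n] by (auto simp: A_def not_le)
      then show ?thesis by simp
    next
      case False
      have "continuous_on A h"
        using pos unfolding positive_on_sphere_def A_def by (meson continuous_on_subset inf_le1)
      moreover have "\<forall>v\<in>A. h v \<noteq> 0" using h_pos by (metis A_def IntE less_irrefl)
      ultimately have "continuous_on A (\<lambda>v. x \<bullet> v / h v)" by (intro continuous_intros)
      then obtain w where w: "w \<in> A" "\<forall>v\<in>A. x \<bullet> v / h v \<le> x \<bullet> w / h w"
        using continuous_attains_sup[OF cA False] by blast
      have wS: "w \<in> sphere 0 1" "d \<le> dist w (\<nu> x)" using w(1) by (auto simp: A_def)
      have "x \<bullet> w / h w < 1"
      proof (rule ccontr)
        assume "\<not> ?thesis"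
        then have "x \<bullet> w / h w = 1" using N_upper[OF wS(1), of x] N1 by simp
        then have "x \<bullet> w = h w" using h_pos[OF wS(1)] by (simp add: field_simps)
        then have "outer_unit_normal K x w" using outer_unit_normal_iff[of x w] N1 wS by simp
        then have "w = \<nu> x" by (rule regular_D(6)[OF x])
        then show False using wS(2) d by simp
      qed
      moreover have "(\<lambda>n. exp (- (2 * M * t n))) \<longlonglongrightarrow> exp (- (2 * M * 0))" by (intro tendsto_intros t0)
      ultimately have "eventually (\<lambda>n. x \<bullet> w / h w < exp (- (2 * M * t n))) sequentially"
        by (intro order_tendstoD) auto
      then show ?thesis
      proof eventually_elim
        case (elim n)
        have b: "\<bar>t n * f (v n)\<bar> \<le> t n * M" using M[OF v(1)] t[of n] by (simp add: abs_mult mult_left_mono)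
        have "exp (- (t n * M)) \<le> r n"
          unfolding r_def by (rule perturbed_gauge_bounds(1)[OF fS N1 M less_imp_le[OF t]])
        then have "exp (- (t n * M)) * exp (t n * f (v n)) \<le> r n * exp (t n * f (v n))" by (intro mult_right_mono) auto
        also have "\<dots> = x \<bullet> v n / h (v n)" unfolding v(2)[of n] by (simp add: exp_minus mult.assoc)
        finally have "exp (- (t n * M)) * exp (t n * f (v n)) \<le> x \<bullet> v n / h (v n)" .
        moreover have "exp (- (2 * M * t n)) \<le> exp (- (t n * M)) * exp (t n * f (v n))"
          unfolding exp_add[symmetric] using b by (simp add: algebra_simps abs_le_iff)
        ultimately have "x \<bullet> w / h w < x \<bullet> v n / h (v n)" using elim by linarith
        then have "v n \<notin> A" using w(2) by force
        then show ?case using v(1)[of n] by (simp add: A_def not_le)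
      qed
    qed
  qed
  have "isCont f (\<nu> x)" using f by (simp add: continuous_on_eq_continuous_at)
  then have fv: "(\<lambda>n. f (v n)) \<longlonglongrightarrow> f (\<nu> x)" by (rule isCont_tendsto_compose[OF _ vlim])
  have low: "(\<lambda>n. exp (- (t n * f (v n))) * f (v n)) \<longlonglongrightarrow> exp (- (0 * f (\<nu> x))) * f (\<nu> x)"
    by (intro tendsto_intros t0 fv)
  \<comment> \<open>testing with \<open>\<nu> x\<close> bounds the quotient above, the maximising normals \<open>v n\<close> bound it below\<close>
  have "(\<lambda>n. (1 - r n) / t n) \<longlonglongrightarrow> f (\<nu> x)"
  proof (rule tendsto_sandwich)
    show "(\<lambda>n. exp (- (t n * f (v n))) * f (v n)) \<longlonglongrightarrow> f (\<nu> x)" using low by simp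
    show "(\<lambda>n. f (\<nu> x)) \<longlonglongrightarrow> f (\<nu> x)" by simp
    show "eventually (\<lambda>n. exp (- (t n * f (v n))) * f (v n) \<le> (1 - r n) / t n) sequentially"
    proof (rule always_eventually, rule allI)
      fix n
      let ?s = "t n * f (v n)"
      have "?s \<le> exp ?s - 1" using exp_ge_add_one_self[of ?s] by linarith
      then have "exp (- ?s) * ?s \<le> exp (- ?s) * (exp ?s - 1)" by (intro mult_left_mono) auto
      also have "\<dots> = 1 - exp (- ?s)" by (simp add: algebra_simps exp_minus)
      also have "\<dots> \<le> 1 - r n" using v(3)[of n] by simp
      finally show "exp (- ?s) * f (v n) \<le> (1 - r n) / t n"
        using t[of n] by (simp add: pos_le_divide_eq mult_ac)
    qed
    show "eventually (\<lambda>n. (1 - r n) / t n \<le> f (\<nu> x)) sequentially"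
    proof (rule always_eventually, rule allI)
      fix n
      have "1 + (- (t n * f (\<nu> x))) \<le> exp (- (t n * f (\<nu> x)))" by (rule exp_ge_add_one_self)
      also have "\<dots> \<le> r n" unfolding r_def by (rule perturbed_gauge_lower[OF fS N1 regular_D(2)[OF x]])
      finally have "1 - r n \<le> f (\<nu> x) * t n" by (simp add: mult.commute)
      then show "(1 - r n) / t n \<le> f (\<nu> x)" using t[of n] by (simp add: pos_divide_le_eq)
    qed
  qed
  then show ?thesis by (simp only: r_def t_def)
qed

definition cone_measure :: "'a measure" where
  "cone_measure = density lborel (indicator (open_cone regular))"

text \<open>The value at irregular directions is an arbitrary unit vector, so that the map takes values in the
  sphere everywhere.\<close>

definition normal_of :: "'a \<Rightarrow> 'a" where
  "normal_of z = (if radial z \<in> regular then \<nu> (radial z) else (SOME b. b \<in> Basis))"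

lemma sets_cone_measure [simp, measurable_cong]: "sets cone_measure = sets borel"
  by (simp add: cone_measure_def)

lemma space_cone_measure [simp]: "space cone_measure = UNIV"
  by (simp add: cone_measure_def)

lemma emeasure_cone_measure:
  assumes "A \<in> sets borel"
  shows "emeasure cone_measure A = emeasure lborel (open_cone regular \<inter> A)"
proof -
  have "emeasure cone_measure A = (\<integral>\<^sup>+z. indicator (open_cone regular) z * indicator A z \<partial>lborel)"
    unfolding cone_measure_def using assms by (intro emeasure_density) auto
  also have "\<dots> = (\<integral>\<^sup>+z. indicator (open_cone regular \<inter> A) z \<partial>lborel)"
    by (intro nn_integral_cong) (auto simp: indicator_def)
  also have "\<dots> = emeasure lborel (open_cone regular \<inter> A)" using assms by (intro nn_integral_indicator) auto
  finally show ?thesis .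
qed

lemma finite_cone_measure: "finite_measure cone_measure"
  by (rule finite_measureI) (use emeasure_open_cone_finite[of regular] in \<open>simp add: emeasure_cone_measure\<close>)

lemma AE_cone_measure: "AE z in cone_measure. z \<noteq> 0 \<and> radial z \<in> regular"
  unfolding cone_measure_def using pos
  by (subst AE_density) (auto simp: indicator_def open_cone_def)

lemma normal_of_measurable [measurable]: "normal_of \<in> borel_measurable borel"
proof -
  define q where "q x = (if x \<in> regular then \<nu> x else (SOME b. b \<in> Basis))" for x
  have "q \<in> borel_measurable borel"
    unfolding q_def[abs_def] using continuous_on_gauss_map[OF compact_K] regular_borel
    by (intro borel_measurable_continuous_on_if continuous_on_const) (auto simp: regular_def)
  then have "(\<lambda>z. q (radial z)) \<in> borel_measurable borel" by measurable
  then show ?thesis by (simp add: q_def normal_of_def[abs_def])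
qed

lemma normal_of_sphere: "normal_of z \<in> sphere 0 1"
  using regular_D(3) norm_Basis[OF SOME_Basis] by (auto simp: normal_of_def)

lemma gaussian_wulff_cone:
  assumes g: "positive_on_sphere g"
  shows "emeasure gaussian (wulff g) = (\<integral>\<^sup>+z. radial_tail (radial z) (wulff_gauge g (radial z)) \<partial>cone_measure)"
proof -
  note borel_measurable_wulff_gauge[OF g, measurable]
  have "emeasure gaussian (wulff g) =
    (\<integral>\<^sup>+z. indicator {z. 0 < N z \<and> N z < 1} z * radial_tail (radial z) (wulff_gauge g (radial z)) \<partial>lborel)"
    by (rule gaussian_wulff_polar[OF g])
  also have "\<dots> = (\<integral>\<^sup>+z. indicator (open_cone regular) z * radial_tail (radial z) (wulff_gauge g (radial z)) \<partial>lborel)"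
  proof (rule nn_integral_cong_AE, rule AE_mp[OF AE_regular], rule AE_I2, rule impI)
    fix z :: 'a assume "z \<noteq> 0 \<longrightarrow> radial z \<in> regular"
    then have "z \<in> {z. 0 < N z \<and> N z < 1} \<longleftrightarrow> z \<in> open_cone regular"
      using pos by (cases "z = 0") (auto simp: open_cone_def)
    then show "indicator {z. 0 < N z \<and> N z < 1} z * radial_tail (radial z) (wulff_gauge g (radial z))
      = indicator (open_cone regular) z * radial_tail (radial z) (wulff_gauge g (radial z))"
      by (simp only: indicator_def of_bool_def)
  qed
  also have "\<dots> = (\<integral>\<^sup>+z. radial_tail (radial z) (wulff_gauge g (radial z)) \<partial>cone_measure)"
    unfolding cone_measure_def by (rule nn_integral_density[symmetric]) measurable
  finally show ?thesis .
qed

lemma gaussian_wulff_integral: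
  assumes g: "positive_on_sphere g"
  shows "integrable cone_measure (\<lambda>z. enn2real (radial_tail (radial z) (wulff_gauge g (radial z))))"
    and "enn2real (emeasure gaussian (wulff g)) = (\<integral>z. enn2real (radial_tail (radial z) (wulff_gauge g (radial z))) \<partial>cone_measure)"
proof -
  note borel_measurable_wulff_gauge[OF g, measurable]
  let ?F = "\<lambda>z. enn2real (radial_tail (radial z) (wulff_gauge g (radial z)))"
  have m: "?F \<in> borel_measurable cone_measure" by measurable
  have "emeasure gaussian (wulff g) = (\<integral>\<^sup>+z. ennreal (?F z) \<partial>cone_measure)"
    unfolding gaussian_wulff_cone[OF g]
  proof (rule nn_integral_cong_AE, rule AE_mp[OF AE_cone_measure], rule AE_I2, rule impI)
    fix z :: 'a assume "z \<noteq> 0 \<and> radial z \<in> regular"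
    then have "0 < wulff_gauge g (radial z)" by (intro wulff_gauge_pos[OF g] radial_nonzero) simp
    from radial_tail_finite[OF this, of "radial z"]
    show "radial_tail (radial z) (wulff_gauge g (radial z)) = ennreal (?F z)" by simp
  qed
  note eq = this
  have fin: "(\<integral>\<^sup>+z. ennreal (?F z) \<partial>cone_measure) < \<infinity>"
    unfolding eq[symmetric] by (rule emeasure_gaussian_finite)
  show "integrable cone_measure ?F"
    by (rule integrableI_nonneg[OF m _ fin]) simp
  show "enn2real (emeasure gaussian (wulff g)) = (\<integral>z. ?F z \<partial>cone_measure)"
    unfolding eq by (rule integral_eq_nn_integral[OF m, symmetric]) simp
qed


text \<open>With \<open>t n = 1 / (n + 1)\<close> and \<open>r n z\<close> the perturbed gauge at \<open>radial z\<close>, maximality bounds the integral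
  of \<open>(1 - r n z) / t n\<close> times the density at \<open>1\<close> above by an arbitrarily small constant, and dominated convergence
  replaces the quotient by its limit \<open>f (normal_of z)\<close>.\<close>

lemma first_variation_nonpos:
  fixes \<mu> :: "'a measure" and f :: "'a \<Rightarrow> real"
  assumes \<mu>: "finite_measure \<mu>" "sets \<mu> = sets sphere_borel"
    and adm: "admissible \<mu> h"
    and max: "\<And>g. admissible \<mu> g \<Longrightarrow> emeasure gaussian (wulff g) \<le> emeasure gaussian K"
    and f: "continuous_on UNIV f" "\<And>v. f (- v) = f v" "(\<integral>v. f v \<partial>\<mu>) \<le> 0"
  shows "(\<integral>z. f (normal_of z) * exp (- (norm (radial z))\<^sup>2 / 2) \<partial>cone_measure) \<le> 0"
proof -
  interpret W: finite_measure cone_measure by (rule finite_cone_measure)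
  let ?D = "real DIM('a)"
  have fS: "continuous_on (sphere 0 1) f" using f(1) continuous_on_subset by blast
  have [measurable]: "f \<in> borel_measurable borel" using f(1) by (rule borel_measurable_continuous_onI)
  define t where "t n = 1 / real (Suc n)" for n
  have t: "0 < t n" "t n \<le> 1" for n by (auto simp: t_def)
  have t0: "t \<longlonglongrightarrow> 0" unfolding t_def using LIMSEQ_inverse_real_of_nat by (simp add: inverse_eq_divide)
  have "bounded (f ` sphere 0 1)" by (intro compact_imp_bounded compact_continuous_image fS compact_sphere)
  then obtain M where "\<forall>y\<in>f ` sphere 0 1. norm y \<le> M" unfolding bounded_iff by blast
  then have M: "\<And>v. v \<in> sphere 0 1 \<Longrightarrow> \<bar>f v\<bar> \<le> M" by auto
  have M0: "0 \<le> M" using M[OF normal_of_sphere[of 0]] by linarith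
  define C where "C = M * exp M"
  have C0: "0 \<le> C" using M0 by (simp add: C_def)
  obtain R where R: "\<And>x. x \<in> K \<Longrightarrow> norm x \<le> R" using compact_imp_bounded[OF compact_K] by (auto simp: bounded_iff)
  have pp: "positive_on_sphere (perturbed f (t n))" for n by (rule perturbed_positive[OF fS])
  have [measurable]: "wulff_gauge (perturbed f (t n)) \<in> borel_measurable borel" for n
    by (rule borel_measurable_wulff_gauge[OF pp])
  define r where "r n z = wulff_gauge (perturbed f (t n)) (radial z)" for n z
  have [measurable]: "r n \<in> borel_measurable borel" for n unfolding r_def[abs_def] by measurable
  have rC: "\<bar>1 - r n z\<bar> \<le> C * t n" if z: "z \<noteq> 0" for n z
  proof -
    note b = perturbed_gauge_bounds[OF fS N_radial[OF z] M less_imp_le[OF t(1)[of n]], folded r_def]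
    have "t n * M \<le> M" using t[of n] M0 by (simp add: mult_left_le_one_le)
    have "exp (t n * M) - 1 = exp (t n * M) * (1 - exp (- (t n * M)))" by (simp add: algebra_simps exp_minus)
    also have "\<dots> \<le> exp (t n * M) * (t n * M)"
    proof (rule mult_left_mono)
      show "1 - exp (- (t n * M)) \<le> t n * M" using exp_ge_add_one_self[of "- (t n * M)"] by linarith
    qed simp
    also have "\<dots> \<le> exp M * (t n * M)" using \<open>t n * M \<le> M\<close> t(1)[of n] M0 by (intro mult_right_mono) auto
    finally have "r n z - 1 \<le> C * t n" using b(2) by (simp add: C_def mult_ac)
    moreover have "1 - r n z \<le> t n * M" using exp_ge_add_one_self[of "- (t n * M)"] b(1) by linarith
    moreover have "t n * M \<le> C * t n"
    proof -
      have "M * 1 \<le> M * exp M" using M0 by (intro mult_left_mono) auto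
      then have "(M * 1) * t n \<le> (M * exp M) * t n" using t(1)[of n] by (intro mult_right_mono) auto
      then show ?thesis by (simp add: C_def mult.commute)
    qed
    ultimately show ?thesis by (simp add: abs_le_iff)
  qed
  have gpert: "emeasure gaussian (wulff (perturbed f (t n))) \<le> emeasure gaussian K" for n
  proof (rule max)
    have hc: "continuous_on (sphere 0 1) (\<lambda>v. ln (h v))"
      using pos by (intro continuous_intros) (auto simp: positive_on_sphere_def)
    have i1: "integrable \<mu> (\<lambda>v. ln (h v))" by (rule integrable_continuous_on_sphere[OF \<mu> hc])
    have i2: "integrable \<mu> f" by (rule integrable_continuous_on_sphere[OF \<mu> fS])
    have "(\<integral>v. ln (perturbed f (t n) v) \<partial>\<mu>) = (\<integral>v. ln (h v) + t n * f v \<partial>\<mu>)"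
    proof (rule Bochner_Integration.integral_cong[OF refl])
      fix v assume "v \<in> space \<mu>"
      then have "v \<in> sphere 0 1" by (simp only: sphere_measure_space[OF \<mu>(2)])
      then show "ln (perturbed f (t n) v) = ln (h v) + t n * f v"
        using h_pos[of v] by (simp add: perturbed_def ln_mult)
    qed
    also have "\<dots> = (\<integral>v. ln (h v) \<partial>\<mu>) + t n * (\<integral>v. f v \<partial>\<mu>)" using i1 i2 by simp
    also have "\<dots> \<le> 0" using adm f(3) t(1)[of n] by (intro add_nonpos_nonpos mult_nonneg_nonpos) (auto simp: admissible_def)
    finally show "admissible \<mu> (perturbed f (t n))"
      unfolding admissible_def using pp[of n] adm f(2) by (auto simp: perturbed_def admissible_def)
  qed
  define s where "s n z = (1 - r n z) / t n * tail_density (radial z) 1" for n z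
  have [measurable]: "s n \<in> borel_measurable borel" for n unfolding s_def[abs_def] by measurable
  have td1: "0 \<le> tail_density x 1" "tail_density x 1 \<le> ?D" for x :: 'a
    by (auto simp: tail_density_at_1 mult_left_le)
  have sC: "norm (s n z) \<le> C * ?D" if "z \<noteq> 0" for n z
  proof -
    have "\<bar>(1 - r n z) / t n\<bar> \<le> C" using rC[OF that, of n] t(1)[of n] by (simp add: abs_divide pos_divide_le_eq)
    then have "\<bar>(1 - r n z) / t n\<bar> * tail_density (radial z) 1 \<le> C * ?D"
      using td1[of "radial z"] C0 by (intro mult_mono) auto
    then show ?thesis using td1(1)[of "radial z"] by (simp add: s_def abs_mult)
  qed
  have sint: "integrable cone_measure (s n)" for n
  proof (rule W.integrable_const_bound[of _ "C * ?D"])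
    show "AE z in cone_measure. norm (s n z) \<le> C * ?D" using AE_cone_measure by eventually_elim (use sC in blast)
  qed measurable
  define w where "w = measure cone_measure UNIV"
  have w0: "0 \<le> w" by (simp add: w_def)
  have lim: "(\<lambda>n. \<integral>z. s n z \<partial>cone_measure) \<longlonglongrightarrow> (\<integral>z. f (normal_of z) * tail_density (radial z) 1 \<partial>cone_measure)"
  proof (rule integral_dominated_convergence[where w="\<lambda>_. C * ?D"])
    show "AE z in cone_measure. (\<lambda>n. s n z) \<longlonglongrightarrow> f (normal_of z) * tail_density (radial z) 1"
      using AE_cone_measure
    proof eventually_elim
      case (elim z)
      then have n: "normal_of z = \<nu> (radial z)" by (simp add: normal_of_def)
      have "(\<lambda>n. (1 - r n z) / t n) \<longlonglongrightarrow> f (\<nu> (radial z))"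
        unfolding r_def t_def using perturbed_gauge_derivative[OF f(1), of "radial z"] elim by blast
      then show ?case unfolding s_def n by (intro tendsto_mult tendsto_const)
    qed
    show "AE z in cone_measure. norm (s n z) \<le> C * ?D" for n using AE_cone_measure by eventually_elim (use sC in blast)
    show "(\<lambda>z. f (normal_of z) * tail_density (radial z) 1) \<in> borel_measurable cone_measure" by measurable
    show "s n \<in> borel_measurable cone_measure" for n by measurable
    show "integrable cone_measure (\<lambda>_. C * ?D)" by simp
  qed
  \<comment> \<open>the perturbed body has no more Gaussian volume than \<open>K\<close>; compare the radial tails to first order\<close>
  have main: "(\<integral>z. f (normal_of z) * tail_density (radial z) 1 \<partial>cone_measure) \<le> e * (C * w)" if e: "0 < e" for e
  proof -
    obtain d where d: "0 < d" "d \<le> 1/2"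
      "\<And>(x::'a) t. norm x \<le> R \<Longrightarrow> \<bar>t - 1\<bar> \<le> d \<Longrightarrow> \<bar>tail_density x t - tail_density x 1\<bar> \<le> e"
      using tail_density_modulus[OF e, of R] by metis
    have "(\<lambda>n. C * t n) \<longlonglongrightarrow> C * 0" by (intro tendsto_intros t0)
    then have "eventually (\<lambda>n. C * t n < d) sequentially" using d(1) by (intro order_tendstoD) auto
    then have "eventually (\<lambda>n. (\<integral>z. s n z \<partial>cone_measure) \<le> e * (C * w)) sequentially"
    proof eventually_elim
      case (elim n)
      let ?Q = "\<lambda>z. enn2real (radial_tail (radial z) (r n z))"
      let ?P = "\<lambda>z. enn2real (radial_tail (radial z) (N (radial z)))"
      have iQ: "integrable cone_measure ?Q" unfolding r_def by (rule gaussian_wulff_integral(1)[OF pp])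
      have iP: "integrable cone_measure ?P" by (rule gaussian_wulff_integral(1)[OF pos])
      have "(\<integral>z. t n * (s n z - e * C) + ?P z \<partial>cone_measure) \<le> (\<integral>z. ?Q z \<partial>cone_measure)"
      proof (rule integral_mono_AE)
        show "integrable cone_measure (\<lambda>z. t n * (s n z - e * C) + ?P z)" using sint iP by simp
        show "AE z in cone_measure. t n * (s n z - e * C) + ?P z \<le> ?Q z" using AE_cone_measure
        proof eventually_elim
          case z: (elim z)
          have N1: "N (radial z) = 1" using z by (intro N_radial) simp
          have nR: "norm (radial z) \<le> R" using N1 by (intro R) (simp add: mem_K)
          have rd: "\<bar>r n z - 1\<bar> \<le> d" using rC[of z n] z elim by (simp add: abs_minus_commute)
          have "enn2real (radial_tail (radial z) 1) + (1 - r n z) * tail_density (radial z) 1 - e * \<bar>1 - r n z\<bar> \<le> ?Q z"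
            by (rule radial_tail_lower[OF rd d(2) d(3)[OF nR]])
          moreover have "e * \<bar>1 - r n z\<bar> \<le> e * (C * t n)" using rC[of z n] z e by (intro mult_left_mono) auto
          moreover have "t n * s n z = (1 - r n z) * tail_density (radial z) 1" using t(1)[of n] by (simp add: s_def)
          ultimately show ?case using N1 by (simp add: algebra_simps)
        qed
      qed (rule iQ)
      also have "\<dots> \<le> (\<integral>z. ?P z \<partial>cone_measure)"
      proof -
        have "enn2real (emeasure gaussian (wulff (perturbed f (t n)))) \<le> enn2real (emeasure gaussian K)"
          using gpert[of n] emeasure_gaussian_finite[of K] by (intro enn2real_mono) auto
        then show ?thesis unfolding r_def by (simp only: gaussian_wulff_integral(2)[OF pp] gaussian_wulff_integral(2)[OF pos])
      qed
      finally have "t n * ((\<integral>z. s n z \<partial>cone_measure) - e * C * w) \<le> 0"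
        using sint[of n] iP by (simp add: w_def mult_ac)
      then show ?case using t(1)[of n] by (simp add: mult_le_0_iff mult.assoc)
    qed
    then show ?thesis by (intro tendsto_upperbound[OF lim]) auto
  qed
  have "(\<integral>z. f (normal_of z) * tail_density (radial z) 1 \<partial>cone_measure) \<le> 0"
  proof (rule field_le_epsilon)
    fix e :: real assume e: "0 < e"
    have Cw: "0 < C * w + 1" using C0 w0 by (simp add: add_nonneg_pos)
    have "(\<integral>z. f (normal_of z) * tail_density (radial z) 1 \<partial>cone_measure) \<le> e / (C * w + 1) * (C * w)"
      using e Cw by (intro main) simp
    also have "\<dots> \<le> e" using e Cw by (simp add: field_simps)
    finally show "(\<integral>z. f (normal_of z) * tail_density (radial z) 1 \<partial>cone_measure) \<le> 0 + e" by simp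
  qed
  moreover have "(\<integral>z. f (normal_of z) * tail_density (radial z) 1 \<partial>cone_measure)
      = ?D * (\<integral>z. f (normal_of z) * exp (- (norm (radial z))\<^sup>2 / 2) \<partial>cone_measure)"
    by (subst integral_mult_right_zero[symmetric]) (simp add: tail_density_at_1 mult_ac)
  ultimately show ?thesis by (simp add: mult_le_0_iff)
qed

end

section \<open>The radial Gaussian measure\<close>

text \<open>Indicators of closed sets are decreasing limits of the continuous functions
  \<open>max 0 (1 - k * infdist v C)\<close>, and closed sets generate the Borel sets.\<close>

lemma sphere_borel_measure_eqI:
  fixes M M' :: "'a::euclidean_space measure"
  assumes M: "finite_measure M" "sets M = sets sphere_borel" and M': "finite_measure M'" "sets M' = sets sphere_borel"
    and eq: "\<And>f :: 'a \<Rightarrow> real. continuous_on UNIV f \<Longrightarrow> (\<integral>v. f v \<partial>M) = (\<integral>v. f v \<partial>M')"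
  shows "M = M'"
proof -
  have id_m: "(\<lambda>x. x) \<in> L \<rightarrow>\<^sub>M borel" if "sets L = sets (sphere_borel :: 'a measure)" for L
    using measurable_ident[of "borel :: 'a measure"] by (simp add: measurable_cong_sets[OF that refl] measurable_restrict_space1)
  have closed_lim: "(\<lambda>k. \<integral>v. max 0 (1 - real k * infdist v C) \<partial>L) \<longlonglongrightarrow> measure L (C \<inter> sphere 0 1)"
    if L: "finite_measure L" "sets L = sets sphere_borel" and C: "closed C" "C \<noteq> {}" for C and L :: "'a measure"
  proof -
    interpret L: finite_measure L by (rule L(1))
    have sp: "space L = sphere 0 1" by (rule sphere_measure_space[OF L(2)])
    have "(\<lambda>k. \<integral>v. max 0 (1 - real k * infdist v C) \<partial>L) \<longlonglongrightarrow> (\<integral>v. indicator C v \<partial>L)"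
    proof (rule integral_dominated_convergence[where w="\<lambda>_. 1"])
      show "indicator C \<in> borel_measurable L"
        using measurable_compose[OF id_m[OF L(2)] borel_measurable_indicator[OF borel_closed[OF C(1)]]] by simp
      show "(\<lambda>v. max 0 (1 - real k * infdist v C)) \<in> borel_measurable L" for k
      proof -
        have "(\<lambda>v. max 0 (1 - real k * infdist v C)) \<in> borel_measurable borel"
          by (intro borel_measurable_continuous_onI continuous_intros)
        from measurable_compose[OF id_m[OF L(2)] this] show ?thesis .
      qed
      show "AE v in L. (\<lambda>k. max 0 (1 - real k * infdist v C)) \<longlonglongrightarrow> indicator C v"
      proof (rule AE_I2)
        fix v
        show "(\<lambda>k. max 0 (1 - real k * infdist v C)) \<longlonglongrightarrow> indicator C v"
        proof (cases "v \<in> C")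
          case True
          then show ?thesis by simp
        next
          case False
          then have d: "0 < infdist v C" using C by (simp add: infdist_pos_not_in_closed)
          obtain k0 where k0: "1 / infdist v C < real k0" using reals_Archimedean2 by blast
          have "max 0 (1 - real k * infdist v C) = 0" if "k0 \<le> k" for k
          proof -
            have "1 / infdist v C < real k" using k0 that by (meson of_nat_le_iff order_less_le_trans)
            then have "1 < real k * infdist v C" using d by (simp add: divide_less_eq)
            then show ?thesis by simp
          qed
          then have "eventually (\<lambda>k. max 0 (1 - real k * infdist v C) = 0) sequentially"
            unfolding eventually_sequentially by blast
          then show ?thesis using False by (simp add: tendsto_eventually)
        qed
      qed
      show "AE v in L. norm (max 0 (1 - real k * infdist v C)) \<le> 1" for k
        by (rule AE_I2) (simp add: infdist_nonneg)
    qed simp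
    also have "(\<integral>v. indicator C v \<partial>L) = measure L (C \<inter> space L)" by simp
    finally show ?thesis by (simp add: sp)
  qed
  have meas_closed: "measure M (C \<inter> sphere 0 1) = measure M' (C \<inter> sphere 0 1)" if C: "closed C" for C
  proof (cases "C = {}")
    case False
    have "(\<integral>v. max 0 (1 - real k * infdist v C) \<partial>M) = (\<integral>v. max 0 (1 - real k * infdist v C) \<partial>M')" for k
      by (intro eq continuous_intros)
    then show ?thesis
      using closed_lim[OF M C False] closed_lim[OF M' C False] LIMSEQ_unique by simp
  qed simp
  define D where "D L = distr L borel (\<lambda>x. x)" for L :: "'a measure"
  have emD: "emeasure (D L) A = emeasure L (A \<inter> sphere 0 1)" if "sets L = sets sphere_borel" "A \<in> sets borel" for L A
    unfolding D_def using that id_m[OF that(1)] sphere_measure_space[OF that(1)] by (subst emeasure_distr) auto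
  have "D M = D M'"
  proof (rule measure_eqI_generator_eq[where E="Collect closed" and \<Omega>=UNIV and A="\<lambda>_. UNIV"])
    show "Int_stable (Collect closed :: 'a set set)" by (auto simp: Int_stable_def)
    show "emeasure (D M) X = emeasure (D M') X" if "X \<in> Collect closed" for X
    proof -
      have "X \<in> sets borel" "closed X" using that by auto
      then show ?thesis using meas_closed[of X] emD[OF M(2)] emD[OF M'(2)]
        by (simp add: finite_measure.emeasure_eq_measure[OF M(1)] finite_measure.emeasure_eq_measure[OF M'(1)])
    qed
    show "emeasure (D M) UNIV \<noteq> \<infinity>"
      using finite_measure.emeasure_finite[OF M(1)] emD[OF M(2), of UNIV] by simp
  qed (auto simp: D_def borel_eq_closed)
  show ?thesis
  proof (rule measure_eqI)
    show "sets M = sets M'" by (simp only: M M')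
    fix A assume A: "A \<in> sets M"
    then have "A \<in> sets borel \<and> A \<subseteq> sphere 0 1" by (simp add: M(2) sets_restrict_space_iff)
    then show "emeasure M A = emeasure M' A"
      using emD[OF M(2), of A] emD[OF M'(2), of A] \<open>D M = D M'\<close> by (simp add: Int_absorb2)
  qed
qed

context supported_wulff begin

definition radial_gaussian :: "'a measure" where
  "radial_gaussian = distr (density cone_measure (\<lambda>z. ennreal (exp (- (norm (radial z))\<^sup>2 / 2)))) sphere_borel normal_of"

lemma normal_of_sphere_borel [measurable]: "normal_of \<in> borel \<rightarrow>\<^sub>M sphere_borel"
  using normal_of_sphere by (intro measurable_restrict_space2) auto

lemma sets_radial_gaussian: "sets radial_gaussian = sets sphere_borel"
  by (simp add: radial_gaussian_def)

lemma emeasure_radial_gaussian: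
  assumes A: "A \<in> sets sphere_borel"
  shows "emeasure radial_gaussian A = (\<integral>\<^sup>+z. ennreal (exp (- (norm (radial z))\<^sup>2 / 2)) * indicator A (normal_of z) \<partial>cone_measure)"
proof -
  have m: "normal_of \<in> density cone_measure (\<lambda>z. ennreal (exp (- (norm (radial z))\<^sup>2 / 2))) \<rightarrow>\<^sub>M sphere_borel"
    by measurable
  have "emeasure radial_gaussian A = emeasure (density cone_measure (\<lambda>z. ennreal (exp (- (norm (radial z))\<^sup>2 / 2)))) (normal_of -` A)"
    unfolding radial_gaussian_def using A by (subst emeasure_distr[OF m]) auto
  also have "\<dots> = (\<integral>\<^sup>+z. ennreal (exp (- (norm (radial z))\<^sup>2 / 2)) * indicator (normal_of -` A) z \<partial>cone_measure)"
    using measurable_sets[OF normal_of_sphere_borel A] by (intro emeasure_density) auto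
  also have "\<dots> = (\<integral>\<^sup>+z. ennreal (exp (- (norm (radial z))\<^sup>2 / 2)) * indicator A (normal_of z) \<partial>cone_measure)"
    by (intro nn_integral_cong) (auto simp: indicator_def)
  finally show ?thesis .
qed

lemma finite_radial_gaussian: "finite_measure radial_gaussian"
proof (rule finite_measureI)
  have S: "sphere 0 1 \<in> sets (sphere_borel :: 'a measure)"
    by (simp add: sets_restrict_space_iff)
  have "emeasure radial_gaussian (sphere 0 1) \<le> (\<integral>\<^sup>+z. 1 \<partial>cone_measure)"
    unfolding emeasure_radial_gaussian[OF S] by (intro nn_integral_mono) (auto simp: indicator_def)
  also have "\<dots> < \<infinity>" using finite_measure.emeasure_finite[OF finite_cone_measure, of UNIV] by (simp add: less_top)
  finally show "emeasure radial_gaussian (space radial_gaussian) \<noteq> \<infinity>"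
    by (simp add: sphere_measure_space[OF sets_radial_gaussian])
qed

lemma integral_radial_gaussian:
  fixes f :: "'a \<Rightarrow> real"
  assumes f: "continuous_on UNIV f"
  shows "(\<integral>v. f v \<partial>radial_gaussian) = (\<integral>z. f (normal_of z) * exp (- (norm (radial z))\<^sup>2 / 2) \<partial>cone_measure)"
proof -
  have fb[measurable]: "f \<in> borel_measurable borel" using f by (rule borel_measurable_continuous_onI)
  then have fs: "f \<in> borel_measurable sphere_borel" by (rule measurable_restrict_space1)
  have m: "normal_of \<in> density cone_measure (\<lambda>z. ennreal (exp (- (norm (radial z))\<^sup>2 / 2))) \<rightarrow>\<^sub>M sphere_borel"
    by measurable
  have "(\<integral>v. f v \<partial>radial_gaussian) = (\<integral>z. f (normal_of z) \<partial>density cone_measure (\<lambda>z. ennreal (exp (- (norm (radial z))\<^sup>2 / 2))))"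
    unfolding radial_gaussian_def by (rule integral_distr[OF m fs])
  also have "\<dots> = (\<integral>z. exp (- (norm (radial z))\<^sup>2 / 2) *\<^sub>R f (normal_of z) \<partial>cone_measure)"
    by (rule integral_density) auto
  finally show ?thesis by (simp add: mult.commute)
qed

lemma measure_radial_gaussian_pos: "0 < measure radial_gaussian (sphere 0 1)"
proof -
  have S: "sphere 0 1 \<in> sets (sphere_borel :: 'a measure)" by (simp add: sets_restrict_space_iff)
  have "emeasure radial_gaussian (sphere 0 1) \<noteq> 0"
  proof
    assume "emeasure radial_gaussian (sphere 0 1) = 0"
    then have "(\<integral>\<^sup>+z. ennreal (exp (- (norm (radial z))\<^sup>2 / 2)) * indicator (sphere 0 1) (normal_of z) \<partial>cone_measure) = 0"
      by (simp only: emeasure_radial_gaussian[OF S])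
    then have "(\<integral>\<^sup>+z. ennreal (exp (- (norm (radial z))\<^sup>2 / 2)) \<partial>cone_measure) = 0"
      using normal_of_sphere by simp
    then have "AE z in cone_measure. False"
      by (subst (asm) nn_integral_0_iff_AE) auto
    then have "emeasure cone_measure UNIV = 0"
      by (subst (asm) AE_iff_measurable[where N=UNIV]) auto
    then have c0: "emeasure lborel (open_cone regular) = 0" by (simp add: emeasure_cone_measure)
    have "emeasure lborel {z. 0 < N z \<and> N z < 1} = emeasure lborel (open_cone regular)"
    proof (rule emeasure_eq_AE)
      show "AE z in lborel. (z \<in> {z. 0 < N z \<and> N z < 1}) = (z \<in> open_cone regular)"
        using AE_regular
      proof eventually_elim
        case (elim z)
        then show ?case using pos by (cases "z = 0") (auto simp: open_cone_def)
      qed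
    qed auto
    then have z0: "emeasure lborel {z. 0 < N z \<and> N z < 1} = 0" using c0 by simp
    obtain m B where m: "0 < m" "m \<le> B" "\<And>v. v \<in> sphere 0 1 \<Longrightarrow> m \<le> h v \<and> h v \<le> B"
      using positive_on_sphere_bounds[OF pos] by blast
    have "ball 0 m - {0} \<subseteq> {z. 0 < N z \<and> N z < 1}"
    proof
      fix z :: 'a assume z: "z \<in> ball 0 m - {0}"
      then have "norm z / m < 1" using m(1) by simp
      then have "N z < 1" using wulff_gauge_le_norm[OF pos m(1), of z] m(3) by fastforce
      then show "z \<in> {z. 0 < N z \<and> N z < 1}" using N_pos z by simp
    qed
    then have "emeasure lborel (ball (0::'a) m - {0}) \<le> emeasure lborel {z. 0 < N z \<and> N z < 1}"
      by (intro emeasure_mono) auto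
    then have "emeasure lborel (ball (0::'a) m - {0}) = 0" using z0 by simp
    moreover have "emeasure lborel (ball (0::'a) m - {0}) = emeasure lborel (ball (0::'a) m)"
      by (rule emeasure_Diff_null_set) (auto simp: null_sets_def emeasure_lborel_countable)
    ultimately show False using m(1) unit_ball_vol_pos[of "real DIM('a)"] by (simp add: emeasure_ball)
  qed
  then show ?thesis
    by (simp add: finite_measure.emeasure_eq_measure[OF finite_radial_gaussian] less_le)
qed

text \<open>The integrated cone identity, applied to the Gaussian weight on the points whose normal lies in \<open>A\<close>.\<close>

lemma emeasure_lp_gaussian_eq_radial:
  fixes k :: real
  assumes k: "0 < k"
    and hk: "\<And>v F :: 'a set. norm v = 1 \<Longrightarrow> F \<in> sets borel \<Longrightarrow> F \<subseteq> {x. x \<bullet> v = 0} \<Longrightarrow>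
       hausdorff_outer (DIM('a) - 1) F = ennreal k * emeasure lborel (prism v F 1)"
    and A: "A \<in> sets sphere_borel"
  shows "emeasure (lp_gaussian_surface_area_measure 0 K) A
    = ennreal (1 / sqrt (2 * pi) ^ DIM('a) * (real DIM('a) * k)) * emeasure radial_gaussian A"
proof -
  let ?H = "hausdorff_measure (DIM('a) - 1) :: 'a measure" and ?c = "real DIM('a) * k"
  have AB[measurable]: "A \<in> sets borel" using A by (simp add: sets_restrict_space_iff)
  define q where "q x = (if x \<in> regular then \<nu> x else (SOME b. b \<in> Basis))" for x
  have [measurable]: "q \<in> borel_measurable borel"
    unfolding q_def[abs_def] using continuous_on_gauss_map[OF compact_K] regular_borel
    by (intro borel_measurable_continuous_on_if continuous_on_const) (auto simp: regular_def)
  define f where "f x = ennreal (exp (- (norm x)\<^sup>2 / 2)) * indicator A (q x)" for x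
  have fm: "f \<in> borel_measurable borel" unfolding f_def[abs_def] by measurable
  have "(\<integral>\<^sup>+x. ennreal (exp (- (norm x)\<^sup>2 / 2) * (x \<bullet> \<nu> x) powr (1 - 0)) * indicator (gauss_preimage K A) x \<partial>?H)
      = (\<integral>\<^sup>+x. f x * (ennreal (x \<bullet> \<nu> x) * indicator regular x) \<partial>?H)"
  proof (rule nn_integral_cong)
    fix x :: 'a
    show "ennreal (exp (- (norm x)\<^sup>2 / 2) * (x \<bullet> \<nu> x) powr (1 - 0)) * indicator (gauss_preimage K A) x
      = f x * (ennreal (x \<bullet> \<nu> x) * indicator regular x)"
    proof (cases "x \<in> regular")
      case True
      have "x \<in> gauss_preimage K A \<longleftrightarrow> \<nu> x \<in> A" using True by (auto simp: gauss_preimage_def regular_def)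
      then show ?thesis using True regular_D(5)[OF True]
        by (simp add: f_def q_def ennreal_mult indicator_def)
    next
      case False
      then have "x \<notin> gauss_preimage K A" by (auto simp: gauss_preimage_def regular_def)
      then show ?thesis using False by simp
    qed
  qed
  also have "\<dots> = ennreal ?c * (\<integral>\<^sup>+y. f (radial y) * indicator (open_cone regular) y \<partial>lborel)"
    by (rule nn_integral_surface_eq_cone[OF k hk fm])
  also have "(\<integral>\<^sup>+y. f (radial y) * indicator (open_cone regular) y \<partial>lborel)
      = (\<integral>\<^sup>+y. indicator (open_cone regular) y * (ennreal (exp (- (norm (radial y))\<^sup>2 / 2)) * indicator A (normal_of y)) \<partial>lborel)"
    by (simp only: f_def q_def normal_of_def mult_ac)
  also have "\<dots> = emeasure radial_gaussian A"
    unfolding emeasure_radial_gaussian[OF A] cone_measure_def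
    by (rule nn_integral_density[symmetric]) measurable
  finally have eq: "(\<integral>\<^sup>+x. ennreal (exp (- (norm x)\<^sup>2 / 2) * (x \<bullet> \<nu> x) powr (1 - 0)) * indicator (gauss_preimage K A) x \<partial>?H)
      = ennreal ?c * emeasure radial_gaussian A" .
  show ?thesis
    unfolding emeasure_lp_gaussian_surface_area_measure[OF compact_K A] eq
    using k by (subst ennreal_mult) (simp_all add: mult.assoc)
qed

text \<open>The body is symmetric, so \<open>z \<mapsto> - z\<close> preserves the cone measure and changes the sign of the normal.\<close>

lemma radial_gaussian_even:
  fixes f :: "'a \<Rightarrow> real"
  assumes even: "\<And>v. v \<in> sphere 0 1 \<Longrightarrow> h (- v) = h v" and f: "continuous_on UNIV f"
  shows "(\<integral>v. f (- v) \<partial>radial_gaussian) = (\<integral>v. f v \<partial>radial_gaussian)"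
proof -
  have N_le: "N (- y) \<le> N y" for y
  proof -
    obtain v where v: "v \<in> sphere 0 1" "N (- y) = (- y) \<bullet> v / h v" using wulff_gauge_attained[OF pos] .
    have "y \<bullet> (- v) / h (- v) \<le> N y" using v(1) by (intro N_upper) simp
    then show ?thesis using v(2) even[OF v(1)] by simp
  qed
  have N_minus: "N (- y) = N y" for y using N_le[of y] N_le[of "- y"] by simp
  have radial_minus: "radial (- y) = - radial y" for y by (simp add: radial_def N_minus)
  have normal_minus: "outer_unit_normal K x (- v)" if x: "N x = 1" and v: "outer_unit_normal K (- x) v" for x v
  proof -
    have "v \<in> sphere 0 1" "(- x) \<bullet> v = h v" using v x outer_unit_normal_iff[of "- x" v] by (auto simp: N_minus)
    then show ?thesis using outer_unit_normal_iff[of x "- v"] x even by simp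
  qed
  have reg: "- x \<in> regular \<and> \<nu> (- x) = - \<nu> x" if x: "x \<in> regular" for x
  proof -
    have N1: "N (- x) = 1" using regular_D(1)[OF x] by (simp add: N_minus)
    have o: "outer_unit_normal K (- x) (- \<nu> x)"
      using normal_minus[of "- x" "\<nu> x"] regular_D(2)[OF x] N1 by simp
    have u: "v = - \<nu> x" if "outer_unit_normal K (- x) v" for v
      using regular_D(6)[OF x normal_minus[OF regular_D(1)[OF x] that]] by (metis minus_minus)
    have "\<exists>!v. outer_unit_normal K (- x) v" using o u by blast
    then show ?thesis using gauss_map_eq[of K "- x" "- \<nu> x"] o N1 by (simp add: regular_def frontier_K)
  qed
  have reg_iff: "- x \<in> regular \<longleftrightarrow> x \<in> regular" for x using reg[of x] reg[of "- x"] by auto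
  have cone_minus: "- z \<in> open_cone regular \<longleftrightarrow> z \<in> open_cone regular" for z
    by (simp add: open_cone_def N_minus radial_minus reg_iff)
  have sym: "distr cone_measure borel uminus = cone_measure"
  proof (rule measure_eqI)
    fix A assume "A \<in> sets (distr cone_measure borel uminus)"
    then have A[measurable]: "A \<in> sets borel" by simp
    have WA: "open_cone regular \<inter> A \<in> sets borel" by measurable
    have "{z. - z \<in> A} \<in> sets borel" by measurable
    then have "emeasure (distr cone_measure borel uminus) A = emeasure lborel (open_cone regular \<inter> {z. - z \<in> A})"
      using A by (subst emeasure_distr) (auto simp: vimage_def emeasure_cone_measure)
    also have "open_cone regular \<inter> {z. - z \<in> A} = {z. - z \<in> open_cone regular \<inter> A}" using cone_minus by auto
    also have "emeasure lborel \<dots> = emeasure lborel (open_cone regular \<inter> A)"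
      by (rule linear_involution_emeasure_lborel[OF _ _ WA]) (auto intro: linear_uminus)
    finally show "emeasure (distr cone_measure borel uminus) A = emeasure cone_measure A"
      by (simp add: emeasure_cone_measure)
  qed simp
  have [measurable]: "f \<in> borel_measurable borel" using f by (rule borel_measurable_continuous_onI)
  let ?F = "\<lambda>z. f (normal_of z) * exp (- (norm (radial z))\<^sup>2 / 2)"
  have Fm: "?F \<in> borel_measurable borel" by measurable
  have "(\<integral>v. f v \<partial>radial_gaussian) = (\<integral>z. ?F z \<partial>distr cone_measure borel uminus)"
    unfolding integral_radial_gaussian[OF f] sym ..
  also have "\<dots> = (\<integral>z. ?F (- z) \<partial>cone_measure)" by (rule integral_distr) (use Fm in auto)
  also have "\<dots> = (\<integral>z. f (- normal_of z) * exp (- (norm (radial z))\<^sup>2 / 2) \<partial>cone_measure)"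
  proof (rule integral_cong_AE)
    show "AE z in cone_measure. ?F (- z) = f (- normal_of z) * exp (- (norm (radial z))\<^sup>2 / 2)"
      using AE_cone_measure
    proof eventually_elim
      case (elim z)
      then have "normal_of (- z) = - normal_of z"
        using reg[of "radial z"] by (simp add: normal_of_def radial_minus)
      then show ?case by (simp add: radial_minus)
    qed
  qed measurable
  also have "\<dots> = (\<integral>v. f (- v) \<partial>radial_gaussian)"
    by (rule integral_radial_gaussian[symmetric]) (intro continuous_on_compose2[OF f] continuous_intros, auto)
  finally show ?thesis by simp
qed

end

section \<open>The maximiser solves the Minkowski problem\<close>

text \<open>For a hyperplane the concentration inequality says that less than the fraction
  \<open>(DIM('a) - 1) / DIM('a)\<close> of the mass lies on it; in particular the mass is not \<open>0\<close>.\<close>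

lemma strict_subspace_concentration_spread:
  fixes \<mu> :: "'a::euclidean_space measure"
  assumes D: "2 \<le> DIM('a)" and \<mu>: "finite_measure \<mu>" "sets \<mu> = sets sphere_borel"
    and ssc: "strict_subspace_concentration \<mu>"
  shows "0 < measure \<mu> (sphere 0 1)"
    and "\<And>v. norm v = 1 \<Longrightarrow> 0 < measure \<mu> {u \<in> sphere 0 1. u \<bullet> v \<noteq> 0}"
proof -
  interpret finite_measure \<mu> by (rule \<mu>(1))
  let ?m = "measure \<mu> (sphere 0 1)"
  have key: "measure \<mu> ({u. v \<bullet> u = 0} \<inter> sphere 0 1) < 1 / real DIM('a) * ?m * real (DIM('a) - 1)" if v: "norm v = 1" for v
  proof -
    have "v \<noteq> 0" using v by auto
    then have dim: "dim {u. v \<bullet> u = 0} = DIM('a) - 1" by (rule dim_hyperplane)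
    have "subspace {u. v \<bullet> u = 0}" by (rule subspace_hyperplane)
    then show ?thesis using ssc D unfolding strict_subspace_concentration_def
      by (simp only: dim[symmetric]) (use dim D in auto)
  qed
  have le: "1 / real DIM('a) * ?m * real (DIM('a) - 1) \<le> ?m"
    using D by (simp add: of_nat_diff field_simps)
  obtain b :: 'a where "b \<in> Basis" using nonempty_Basis by blast
  then have "norm b = 1" by simp
  have "0 \<le> measure \<mu> ({u. b \<bullet> u = 0} \<inter> sphere 0 1)" by simp
  then show "0 < ?m" using key[OF \<open>norm b = 1\<close>] le by linarith
  fix v :: 'a assume v: "norm v = 1"
  have S: "{u. v \<bullet> u = 0} \<inter> sphere 0 1 \<in> sets \<mu>" "sphere 0 1 \<in> sets \<mu>"
  proof -
    have "{u. v \<bullet> u = 0} \<in> sets borel" by measurable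
    then show "{u. v \<bullet> u = 0} \<inter> sphere 0 1 \<in> sets \<mu>" "sphere 0 1 \<in> sets \<mu>"
      by (auto simp: \<mu>(2) sets_restrict_space_iff)
  qed
  have "{u \<in> sphere 0 1. u \<bullet> v \<noteq> 0} = sphere 0 1 - {u. v \<bullet> u = 0} \<inter> sphere 0 1" by (auto simp: inner_commute)
  then have "measure \<mu> {u \<in> sphere 0 1. u \<bullet> v \<noteq> 0} = ?m - measure \<mu> ({u. v \<bullet> u = 0} \<inter> sphere 0 1)"
    using S by (simp add: finite_measure_Diff)
  then show "0 < measure \<mu> {u \<in> sphere 0 1. u \<bullet> v \<noteq> 0}" using key[OF v] le by linarith
qed

lemma even_measure_integral:
  fixes \<mu> :: "'a::euclidean_space measure" and f :: "'a \<Rightarrow> real"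
  assumes \<mu>: "sets \<mu> = sets sphere_borel"
    and even: "\<And>A. A \<in> sets \<mu> \<Longrightarrow> emeasure \<mu> (uminus ` A) = emeasure \<mu> A"
    and f: "continuous_on UNIV f"
  shows "(\<integral>v. f (- v) \<partial>\<mu>) = (\<integral>v. f v \<partial>\<mu>)"
proof -
  have sp: "space \<mu> = sphere 0 1" by (rule sphere_measure_space[OF \<mu>])
  have "uminus \<in> sphere_borel \<rightarrow>\<^sub>M (sphere_borel :: 'a measure)"
    by (intro measurable_restrict_space2 measurable_restrict_space1) (auto simp: space_restrict_space)
  then have m: "uminus \<in> \<mu> \<rightarrow>\<^sub>M \<mu>" by (simp add: measurable_cong_sets[OF \<mu> \<mu>])
  have "distr \<mu> \<mu> uminus = \<mu>"
  proof (rule measure_eqI)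
    fix A assume "A \<in> sets (distr \<mu> \<mu> uminus)"
    then have A: "A \<in> sets \<mu>" by simp
    have "A \<subseteq> sphere 0 1" using sets.sets_into_space[OF A] by (simp add: sp)
    then have "uminus -` A \<inter> space \<mu> = uminus ` A"
      by (auto simp: sp image_iff) (metis minus_minus)+
    then show "emeasure (distr \<mu> \<mu> uminus) A = emeasure \<mu> A"
      using emeasure_distr[OF m A] even[OF A] by simp
  qed simp
  moreover have "f \<in> borel_measurable \<mu>"
    using measurable_restrict_space1[OF borel_measurable_continuous_onI[OF f]] by (simp add: measurable_cong_sets[OF \<mu> refl])
  ultimately show ?thesis using integral_distr[OF m, of f] by simp
qed

text \<open>The first variation vanishes on even functions with \<open>\<mu>\<close>-mean \<open>0\<close>. Every continuous function becomes
  one after symmetrising and subtracting its mean, and symmetrising changes neither integral; so the two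
  measures are proportional.\<close>

lemma (in supported_wulff) maximiser_solves:
  fixes \<mu> :: "'a measure"
  assumes \<mu>: "finite_measure \<mu>" "sets \<mu> = sets sphere_borel"
    and even: "\<And>A. A \<in> sets \<mu> \<Longrightarrow> emeasure \<mu> (uminus ` A) = emeasure \<mu> A"
    and mpos: "0 < measure \<mu> (sphere 0 1)"
    and adm: "admissible \<mu> h"
    and max: "\<And>g. admissible \<mu> g \<Longrightarrow> emeasure gaussian (wulff g) \<le> emeasure gaussian K"
    and A: "A \<in> sets sphere_borel"
  shows "emeasure \<mu> A = ennreal (measure \<mu> (sphere 0 1) / measure radial_gaussian (sphere 0 1)) * emeasure radial_gaussian A"
proof -
  interpret \<mu>: finite_measure \<mu> by (rule \<mu>(1))
  interpret G: finite_measure radial_gaussian by (rule finite_radial_gaussian)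
  define m where "m = measure \<mu> (sphere 0 1)"
  define g where "g = measure radial_gaussian (sphere 0 1)"
  have m: "0 < m" and g: "0 < g" using mpos measure_radial_gaussian_pos by (auto simp: m_def g_def)
  have sp: "space \<mu> = sphere 0 1" "space radial_gaussian = sphere 0 1"
    by (rule sphere_measure_space[OF \<mu>(2)], rule sphere_measure_space[OF sets_radial_gaussian])
  have int\<mu>: "integrable \<mu> f" and intG: "integrable radial_gaussian f" if "continuous_on UNIV f" for f :: "'a \<Rightarrow> real"
    using that by (auto intro!: integrable_continuous_on_sphere[OF \<mu>]
        integrable_continuous_on_sphere[OF finite_radial_gaussian sets_radial_gaussian] elim: continuous_on_subset)
  have zero: "(\<integral>v. f v \<partial>radial_gaussian) = 0"
    if f: "continuous_on UNIV f" "\<And>v. f (- v) = f v" "(\<integral>v. f v \<partial>\<mu>) = 0" for f :: "'a \<Rightarrow> real"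
  proof (rule antisym)
    show "(\<integral>v. f v \<partial>radial_gaussian) \<le> 0"
      unfolding integral_radial_gaussian[OF f(1)]
      by (rule first_variation_nonpos[OF \<mu> adm max f(1,2)]) (use f(3) in auto)
    have f': "continuous_on UNIV (\<lambda>v. - f v)" using f(1) by (intro continuous_intros)
    have "(\<integral>v. - f v \<partial>radial_gaussian) \<le> 0"
      unfolding integral_radial_gaussian[OF f']
      by (rule first_variation_nonpos[OF \<mu> adm max f']) (use f(2,3) in auto)
    then show "0 \<le> (\<integral>v. f v \<partial>radial_gaussian)" by simp
  qed
  have heven: "\<And>v. v \<in> sphere 0 1 \<Longrightarrow> h (- v) = h v" using adm by (simp add: admissible_def)
  have ratio: "(\<integral>v. f v \<partial>radial_gaussian) = g / m * (\<integral>v. f v \<partial>\<mu>)" if f: "continuous_on UNIV f" for f :: "'a \<Rightarrow> real"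
  proof -
    have fn: "continuous_on UNIV (\<lambda>v. f (- v))" by (intro continuous_on_compose2[OF f] continuous_intros) auto
    define a where "a = (\<integral>v. f v \<partial>\<mu>) / m"
    define F where "F v = (f v + f (- v)) / 2 - a" for v
    have Fc: "continuous_on UNIV F" unfolding F_def by (intro continuous_intros f fn) auto
    have I: "(\<integral>v. F v \<partial>M) = (\<integral>v. f v \<partial>M) - a * measure M (space M)"
      if "finite_measure M" "integrable M f" "integrable M (\<lambda>v. f (- v))" "(\<integral>v. f (- v) \<partial>M) = (\<integral>v. f v \<partial>M)" for M
    proof -
      interpret finite_measure M by (rule that(1))
      have "(\<integral>v. F v \<partial>M) = (\<integral>v. (f v + f (- v)) / 2 \<partial>M) - (\<integral>v. a \<partial>M)"
        unfolding F_def using that(2,3) by (intro Bochner_Integration.integral_diff) auto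
      also have "(\<integral>v. (f v + f (- v)) / 2 \<partial>M) = (\<integral>v. f v \<partial>M)"
        using that by simp
      finally show ?thesis by (simp add: mult.commute)
    qed
    have "(\<integral>v. F v \<partial>\<mu>) = (\<integral>v. f v \<partial>\<mu>) - a * m"
      using I[OF \<mu>(1) int\<mu>[OF f] int\<mu>[OF fn] even_measure_integral[OF \<mu>(2) even f]] by (simp add: sp m_def)
    then have "(\<integral>v. F v \<partial>\<mu>) = 0" using m by (simp add: a_def)
    then have "(\<integral>v. F v \<partial>radial_gaussian) = 0" by (intro zero Fc) (simp_all add: F_def add.commute)
    then have "(\<integral>v. f v \<partial>radial_gaussian) = a * g"
      using I[OF finite_radial_gaussian intG[OF f] intG[OF fn] radial_gaussian_even[OF heven f]] by (simp add: sp g_def)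
    then show ?thesis by (simp add: a_def)
  qed
  define M where "M = density radial_gaussian (\<lambda>_. ennreal (m / g))"
  have setsM: "sets M = sets sphere_borel" by (simp add: M_def sets_radial_gaussian)
  have emM: "emeasure M B = ennreal (m / g) * emeasure radial_gaussian B" if "B \<in> sets sphere_borel" for B
    unfolding M_def using that by (subst emeasure_density) (auto simp: sets_radial_gaussian nn_integral_cmult_indicator)
  have "\<mu> = M"
  proof (rule sphere_borel_measure_eqI[OF \<mu> _ setsM])
    show "finite_measure M"
    proof (rule finite_measureI)
      have "sphere 0 1 \<in> sets (sphere_borel :: 'a measure)" by (simp add: sets_restrict_space_iff)
      then show "emeasure M (space M) \<noteq> \<infinity>"
        using G.emeasure_finite[of "sphere 0 1"] by (simp add: sphere_measure_space[OF setsM] emM ennreal_mult_eq_top_iff)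
    qed
    fix f :: "'a \<Rightarrow> real" assume f: "continuous_on UNIV f"
    have "f \<in> borel_measurable radial_gaussian"
      using intG[OF f] by (rule borel_measurable_integrable)
    then have "(\<integral>v. f v \<partial>M) = (\<integral>v. (m / g) *\<^sub>R f v \<partial>radial_gaussian)"
      unfolding M_def using m g by (intro integral_density) auto
    also have "\<dots> = m / g * (\<integral>v. f v \<partial>radial_gaussian)" by simp
    also have "\<dots> = (\<integral>v. f v \<partial>\<mu>)" unfolding ratio[OF f] using m g by simp
    finally show "(\<integral>v. f v \<partial>\<mu>) = (\<integral>v. f v \<partial>M)" by simp
  qed
  then show ?thesis using emM[OF A] by (simp add: m_def g_def)
qed

theorem theorem1p2:
  fixes \<mu> :: "'a::euclidean_space measure" and n :: nat
  assumes "n \<ge> 1" and "DIM('a) = n + 1"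
    and "sets \<mu> = sets (restrict_space borel (sphere (0::'a) 1))"
    and "finite_measure \<mu>"
    and "\<And>A. A \<in> sets \<mu> \<Longrightarrow> emeasure \<mu> (uminus ` A) = emeasure \<mu> A"
    and "strict_subspace_concentration \<mu>"
  shows "\<exists>(K :: 'a set) (c :: real). convex_body K \<and> o_symmetric K \<and> 0 < c \<and>
           \<mu> = scale_measure (ennreal c) (lp_gaussian_surface_area_measure 0 K)"
proof -
  note \<mu> = assms(4,3)
  have D: "2 \<le> DIM('a)" using assms(1,2) by simp
  note spread = strict_subspace_concentration_spread[OF D \<mu> assms(6)]
  obtain h0 where h0: "admissible \<mu> h0" "\<And>g. admissible \<mu> g \<Longrightarrow> emeasure gaussian (wulff g) \<le> emeasure gaussian (wulff h0)"
    using gaussian_maximiser_exists[OF \<mu> spread(2)] by blast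
  have p0: "positive_on_sphere h0" using h0(1) by (simp add: admissible_def)
  define h where "h = support_fun (wulff h0)"
  have h: "positive_on_sphere h" "wulff h = wulff h0" unfolding h_def using support_fun_wulff[OF p0] by auto
  have adm: "admissible \<mu> h" unfolding h_def by (rule admissible_support_fun[OF \<mu> h0(1)])
  have K: "compact (wulff h)" "convex (wulff h)" "0 \<in> interior (wulff h)" by (rule wulff_body[OF h(1)])+
  interpret supported_wulff h
  proof
    fix v :: 'a assume "v \<in> sphere 0 1"
    have "wulff h0 \<noteq> {}" using K(3) interior_subset h(2) by blast
    then obtain x where "x \<in> wulff h0" "support_fun (wulff h0) v = x \<bullet> v"
      using support_fun_attained[of "wulff h0" v] K(1) h(2) by auto
    then show "\<exists>x\<in>wulff h. x \<bullet> v = h v" unfolding h(2) by (intro bexI[of _ x]) (simp_all add: h_def)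
  qed (rule h(1))
  obtain k where k: "0 < k" "\<And>v F :: 'a set. norm v = 1 \<Longrightarrow> F \<in> sets borel \<Longrightarrow> F \<subseteq> {x. x \<bullet> v = 0} \<Longrightarrow>
       hausdorff_outer (DIM('a) - 1) F = ennreal k * emeasure lborel (prism v F 1)"
    using hausdorff_outer_hyperplane by blast
  have max: "\<And>g. admissible \<mu> g \<Longrightarrow> emeasure gaussian (wulff g) \<le> emeasure gaussian (wulff h)"
    unfolding h(2) by (rule h0(2))
  define c1 where "c1 = 1 / sqrt (2 * pi) ^ DIM('a) * (real DIM('a) * k)"
  define c2 where "c2 = measure \<mu> (sphere 0 1) / measure radial_gaussian (sphere 0 1)"
  have c: "0 < c1" "0 < c2" using k(1) spread(1) measure_radial_gaussian_pos by (auto simp: c1_def c2_def)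
  have "\<mu> = scale_measure (ennreal (c2 / c1)) (lp_gaussian_surface_area_measure 0 (wulff h))"
  proof (rule measure_eqI)
    show "sets \<mu> = sets (scale_measure (ennreal (c2 / c1)) (lp_gaussian_surface_area_measure 0 (wulff h)))"
      by (simp add: \<mu>(2))
    fix A assume "A \<in> sets \<mu>"
    then have A: "A \<in> sets sphere_borel" by (simp only: \<mu>(2))
    have "emeasure \<mu> A = ennreal c2 * emeasure radial_gaussian A"
      unfolding c2_def by (rule maximiser_solves[OF \<mu> assms(5) spread(1) adm max A])
    also have "\<dots> = ennreal (c2 / c1) * (ennreal c1 * emeasure radial_gaussian A)"
      using c by (simp add: mult.assoc[symmetric] ennreal_mult[symmetric])
    also have "ennreal c1 * emeasure radial_gaussian A = emeasure (lp_gaussian_surface_area_measure 0 (wulff h)) A"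
      unfolding c1_def by (rule emeasure_lp_gaussian_eq_radial[OF k A, symmetric])
    finally show "emeasure \<mu> A = emeasure (scale_measure (ennreal (c2 / c1)) (lp_gaussian_surface_area_measure 0 (wulff h))) A"
      by simp
  qed
  moreover have "convex_body (wulff h)" using K by (auto simp: convex_body_def)
  moreover have "o_symmetric (wulff h)"
  proof -
    have even: "\<And>v. v \<in> sphere 0 1 \<Longrightarrow> h (- v) = h v" using adm by (simp add: admissible_def)
    have "- x \<in> wulff h" if "x \<in> wulff h" for x by (rule wulff_symmetric[OF h(1) even that])
    then show ?thesis unfolding o_symmetric_def by (auto simp: image_iff) (metis minus_minus)
  qed
  moreover have "0 < c2 / c1" using c by simp
  ultimately show ?thesis by blast
qed

end
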